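(* $\alpha(W_{5}^{\Box 3}\Box K_3) = 170$.
   Context: All graphs are finite and simple. $W_{5}$ denotes the $5$-wheel, the join of the cycle $C_{5}$ with a single vertex $K_1$ (so $W_5$ has $6$ vertices). The Cartesian product $G \Box H$ has vertex set $V(G)\times V(H)$, with $(u,x)$ adjacent to $(v,y)$ if and only if either $u=v$ and $xy\in E(H)$, or $x=y$ and $uv\in E(G)$. Set $G^{\Box 1}=G$ and $G^{\Box k}=G^{\Box (k-1)}\Box G$ for $k\ge 2$. $\alpha(G)$ is the independence number of $G$, and $K_3$ is the complete graph on $3$ vertices. *)

theory Defs
  imports "Graph_Theory.Graph_Theory"
begin

text \<open>
  A finite simple graph is a \<^locale>\<open>pair_graph\<close>: finitely many vertices and a symmetric
  irreflexive arc relation, so that an undirected edge \<open>uv\<close> is the pair of arcs \<open>(u, v)\<close>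
  and \<open>(v, u)\<close>.
\<close>

definition complete_graph :: "nat \<Rightarrow> nat pair_pre_digraph" where
  "complete_graph n = \<lparr> pverts = {..<n}, parcs = {(i, j). i < n \<and> j < n \<and> i \<noteq> j} \<rparr>"

text \<open>A simple graph only for \<open>n \<ge> 3\<close>.\<close>

definition cycle_graph :: "nat \<Rightarrow> nat pair_pre_digraph" where
  "cycle_graph n = \<lparr> pverts = {..<n},
     parcs = {(i, j). i < n \<and> j < n \<and> (j = Suc i mod n \<or> i = Suc j mod n)} \<rparr>"

definition graph_join ::
  "'a pair_pre_digraph \<Rightarrow> 'b pair_pre_digraph \<Rightarrow> ('a + 'b) pair_pre_digraph" where
  "graph_join G H = \<lparr> pverts = pverts G <+> pverts H,
     parcs = {(Inl u, Inl v) | u v. (u, v) \<in> parcs G}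
           \<union> {(Inr x, Inr y) | x y. (x, y) \<in> parcs H}
           \<union> {(Inl u, Inr x) | u x. u \<in> pverts G \<and> x \<in> pverts H}
           \<union> {(Inr x, Inl u) | x u. u \<in> pverts G \<and> x \<in> pverts H} \<rparr>"

definition wheel_graph :: "nat \<Rightarrow> (nat + nat) pair_pre_digraph" where
  "wheel_graph n = graph_join (cycle_graph n) (complete_graph 1)"

text \<open>
  The iterated power \<open>G \<box> \<dots> \<box> G\<close> cannot be one recursive function, since the type of its
  vertices depends on the exponent; powers are therefore written out as left-nested products.
\<close>

definition cartesian_graph_product ::
  "'a pair_pre_digraph \<Rightarrow> 'b pair_pre_digraph \<Rightarrow> ('a \<times> 'b) pair_pre_digraph"
  (infixl \<open>\<box>\<close> 70) where
  "G \<box> H = \<lparr> pverts = pverts G \<times> pverts H,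
     parcs = {((u, x), (v, y)) | u x v y.
        (u, x) \<in> pverts G \<times> pverts H \<and> (v, y) \<in> pverts G \<times> pverts H \<and>
        (u = v \<and> (x, y) \<in> parcs H \<or> x = y \<and> (u, v) \<in> parcs G)} \<rparr>"

definition independent_set :: "'a pair_pre_digraph \<Rightarrow> 'a set \<Rightarrow> bool" where
  "independent_set G S \<longleftrightarrow> S \<subseteq> pverts G \<and> (\<forall>u\<in>S. \<forall>v\<in>S. (u, v) \<notin> parcs G)"

definition independence_number :: "'a pair_pre_digraph \<Rightarrow> nat" where
  "independence_number G = Max (card ` {S. independent_set G S})"

lemma pair_graphI:
  assumes "finite (pverts G)"
    and "parcs G \<subseteq> pverts G \<times> pverts G"
    and "\<And>u. (u, u) \<notin> parcs G"
    and "\<And>u v. (u, v) \<in> parcs G \<Longrightarrow> (v, u) \<in> parcs G"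
  shows "pair_graph G"
proof -
  have "finite (parcs G)"
    using assms(1,2) by (meson finite_SigmaI finite_subset)
  then show ?thesis
    using assms
    by unfold_locales (auto simp: symmetric_def intro!: symI)
qed

lemma pair_graphD:
  assumes "pair_graph G"
  shows "finite (pverts G)"
    and "(u, v) \<in> parcs G \<Longrightarrow> u \<in> pverts G \<and> v \<in> pverts G"
    and "(u, u) \<notin> parcs G"
    and "(u, v) \<in> parcs G \<Longrightarrow> (v, u) \<in> parcs G"
proof -
  interpret pair_graph G by fact
  show "finite (pverts G)" by simp
  show "(u, v) \<in> parcs G \<Longrightarrow> u \<in> pverts G \<and> v \<in> pverts G"
    by (auto dest: in_arcsD1 in_arcsD2)
  show "(u, u) \<notin> parcs G" using pair_no_loops by fastforce
  show "(u, v) \<in> parcs G \<Longrightarrow> (v, u) \<in> parcs G"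
    using pair_sym_arcs by (auto simp: symmetric_def dest: symD)
qed

lemma pair_graph_complete_graph: "pair_graph (complete_graph n)"
  by (rule pair_graphI) (auto simp: complete_graph_def)

lemma complete_graph_complete_digraph: "K\<^bsub>n\<^esub> (with_proj (complete_graph n))"
  unfolding complete_digraph_pair_def by (auto simp: complete_graph_def)

lemma pair_graph_cycle_graph:
  assumes "n \<ge> 3"
  shows "pair_graph (cycle_graph n)"
proof (rule pair_graphI)
  show "(u, u) \<notin> parcs (cycle_graph n)" for u
    using assms by (auto simp: cycle_graph_def mod_Suc split: if_splits)
qed (auto simp: cycle_graph_def)

lemma pair_graph_graph_join:
  assumes "pair_graph G" "pair_graph H"
  shows "pair_graph (graph_join G H)"
  using pair_graphD[OF assms(1)] pair_graphD[OF assms(2)]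
  by (intro pair_graphI) (auto simp: graph_join_def)

lemma pair_graph_wheel_graph: "n \<ge> 3 \<Longrightarrow> pair_graph (wheel_graph n)"
  by (simp add: wheel_graph_def pair_graph_graph_join pair_graph_cycle_graph
      pair_graph_complete_graph)

lemma pair_graph_cartesian_graph_product:
  assumes "pair_graph G" "pair_graph H"
  shows "pair_graph (G \<box> H)"
  using pair_graphD[OF assms(1)] pair_graphD[OF assms(2)]
  by (intro pair_graphI) (auto simp: cartesian_graph_product_def)

end

(*
  Reading colour classes off an independent set turns the claim into: a proper partial 3-colouring
  of W5 x W5 x W5 leaves at least 46 of the 216 vertices uncoloured (deleted), and 46 is attained.
  Every line W5 has at least one deletion (W5 is not 3-colourable) and every plane W5 x W5 has at
  least 7.  If there were at most 45 deletions, then in each direction at most three of the six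
  parallel planes would have more than 7 ("charged" planes, total surplus at most 3), hence two
  adjacent parallel planes would have exactly 7 (be "optimal").  Optimal planes form eight orbits
  under symmetry, so the first plane may be taken from eight representatives and the second from its
  finitely many neighbours.  All planes crossing these two contain two known lines, so an uncharged
  one is a member of a short list; a search over these lists, branching on "charged or which member",
  and finally over the columns in which two charged planes meet, refutes every case.  Two cases
  suffice: either some hub plane is optimal, or all three hub planes are charged.
*)
theory Submission
  imports Defs
begin

text \<open>The tally behind the case split is 45 = 6 * 7 + 3. If a hub plane is optimal, the five
  rim planes parallel to it cannot all be charged, since 7 + 5 * 8 = 47. If it is charged, two
  adjacent rim planes are optimal, since a set meeting every edge of a 5-cycle has at least three
  vertices and 8 + 3 * 8 + 2 * 7 = 46; with all hub planes charged beforehand, the search has only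
  two more charges in each direction. The obstacle is that all finite work is rewriting in the
  kernel. A crossing plane inherits one line from each known layer. The sixty symmetries of a line
  (ten automorphisms, six recolourings) move the first of them to one of seven words, so two tables
  indexed by these words serve every pair of layers. Tables and symmetry lists are certificates:
  each table is compared with an exhaustive generator whose completeness is proved. The lower bound
  7 for planes comes from the same data, since every plane with at most seven deletions is, up to
  symmetry, in a table all of whose planes have exactly seven.\<close>

section \<open>Partial colourings of the wheel\<close>

text \<open>
  \<open>D\<close> marks a deleted vertex; \<open>I0\<close>, ..., \<open>I4\<close> are the rim of the wheel and \<open>I5\<close> is its hub. Words and
  planes are lists in the order \<open>I5\<close>, ..., \<open>I0\<close>. The functions below are evaluated by rewriting in
  the kernel; auxiliary functions that match on a Boolean argument replace \<open>if\<close> and \<open>case\<close>, which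
  would make the simplifier traverse the remaining arguments again.
\<close>

datatype col = D | R | G | B
datatype ix = I0 | I1 | I2 | I3 | I4 | I5

fun adj :: "ix \<Rightarrow> ix \<Rightarrow> bool" where
  "adj I0 I1 = True" | "adj I1 I0 = True"
| "adj I1 I2 = True" | "adj I2 I1 = True"
| "adj I2 I3 = True" | "adj I3 I2 = True"
| "adj I3 I4 = True" | "adj I4 I3 = True"
| "adj I4 I0 = True" | "adj I0 I4 = True"
| "adj I5 I5 = False" | "adj I5 _ = True" | "adj _ I5 = True"
| "adj _ _ = False"

fun same_index :: "ix \<Rightarrow> ix \<Rightarrow> bool" where
  "same_index I0 I0 = True" | "same_index I1 I1 = True" | "same_index I2 I2 = True"
| "same_index I3 I3 = True" | "same_index I4 I4 = True" | "same_index I5 I5 = True"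
| "same_index _ _ = False"

fun sel :: "ix \<Rightarrow> 'a list \<Rightarrow> 'a" where
  "sel I5 (a # _) = a"
| "sel I4 (_ # a # _) = a"
| "sel I3 (_ # _ # a # _) = a"
| "sel I2 (_ # _ # _ # a # _) = a"
| "sel I1 (_ # _ # _ # _ # a # _) = a"
| "sel I0 (_ # _ # _ # _ # _ # a # _) = a"

fun compat :: "col \<Rightarrow> col \<Rightarrow> bool" where
  "compat R R = False" | "compat G G = False" | "compat B B = False" | "compat _ _ = True"

fun compat_word :: "col list \<Rightarrow> col list \<Rightarrow> bool" where
  "compat_word [] bs = True"
| "compat_word (a # as) [] = True"
| "compat_word (D # as) (b # bs) = compat_word as bs"
| "compat_word (R # as) (D # bs) = compat_word as bs"
| "compat_word (R # as) (R # bs) = False"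
| "compat_word (R # as) (G # bs) = compat_word as bs"
| "compat_word (R # as) (B # bs) = compat_word as bs"
| "compat_word (G # as) (D # bs) = compat_word as bs"
| "compat_word (G # as) (R # bs) = compat_word as bs"
| "compat_word (G # as) (G # bs) = False"
| "compat_word (G # as) (B # bs) = compat_word as bs"
| "compat_word (B # as) (D # bs) = compat_word as bs"
| "compat_word (B # as) (R # bs) = compat_word as bs"
| "compat_word (B # as) (G # bs) = compat_word as bs"
| "compat_word (B # as) (B # bs) = False"

fun compat_plane :: "col list list \<Rightarrow> col list list \<Rightarrow> bool" and compat_plane_aux :: "bool \<Rightarrow> col list list \<Rightarrow> col list list \<Rightarrow> bool" where
  "compat_plane (a # as) (b # bs) = compat_plane_aux (compat_word a b) as bs"
| "compat_plane [] bs = True"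
| "compat_plane (a # as) [] = True"
| "compat_plane_aux True as bs = compat_plane as bs"
| "compat_plane_aux False as bs = False"

fun eq_word :: "col list \<Rightarrow> col list \<Rightarrow> bool" where
  "eq_word [] [] = True"
| "eq_word [] (b # bs) = False"
| "eq_word (a # as) [] = False"
| "eq_word (D # as) (D # bs) = eq_word as bs"
| "eq_word (D # as) (R # bs) = False"
| "eq_word (D # as) (G # bs) = False"
| "eq_word (D # as) (B # bs) = False"
| "eq_word (R # as) (D # bs) = False"
| "eq_word (R # as) (R # bs) = eq_word as bs"
| "eq_word (R # as) (G # bs) = False"
| "eq_word (R # as) (B # bs) = False"
| "eq_word (G # as) (D # bs) = False"
| "eq_word (G # as) (R # bs) = False"
| "eq_word (G # as) (G # bs) = eq_word as bs"
| "eq_word (G # as) (B # bs) = False"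
| "eq_word (B # as) (D # bs) = False"
| "eq_word (B # as) (R # bs) = False"
| "eq_word (B # as) (G # bs) = False"
| "eq_word (B # as) (B # bs) = eq_word as bs"

fun eq_plane :: "col list list \<Rightarrow> col list list \<Rightarrow> bool" and eq_plane_aux :: "bool \<Rightarrow> col list list \<Rightarrow> col list list \<Rightarrow> bool" where
  "eq_plane (a # as) (b # bs) = eq_plane_aux (eq_word a b) as bs"
| "eq_plane [] [] = True"
| "eq_plane [] (b # bs) = False"
| "eq_plane (a # as) [] = False"
| "eq_plane_aux True as bs = eq_plane as bs"
| "eq_plane_aux False as bs = False"

fun mem_plane :: "col list list \<Rightarrow> col list list list \<Rightarrow> bool" and mem_plane_aux :: "bool \<Rightarrow> col list list \<Rightarrow> col list list list \<Rightarrow> bool" where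
  "mem_plane a [] = False"
| "mem_plane a (b # bs) = mem_plane_aux (eq_plane a b) a bs"
| "mem_plane_aux True a bs = True"
| "mem_plane_aux False a bs = mem_plane a bs"

fun keep :: "bool \<Rightarrow> 'a \<Rightarrow> 'a list \<Rightarrow> 'a list" where
  "keep True a as = a # as" | "keep False a as = as"

fun dels :: "col list \<Rightarrow> nat" where
  "dels [] = 0" | "dels (D # as) = Suc (dels as)" | "dels (R # as) = dels as" | "dels (G # as) = dels as" | "dels (B # as) = dels as"

fun excess :: "col list \<Rightarrow> nat" where
  "excess [] = 0" | "excess (D # as) = dels as" | "excess (R # as) = excess as" | "excess (G # as) = excess as" | "excess (B # as) = excess as"

text \<open>The set of forbidden colours, as flags for \<open>D\<close>, \<open>R\<close>, \<open>G\<close> and \<open>B\<close>.\<close>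

datatype palette = Forbid bool bool bool bool

fun forbid :: "col \<Rightarrow> palette \<Rightarrow> palette" where
  "forbid D f = f"
| "forbid R (Forbid d r g b) = Forbid d True g b"
| "forbid G (Forbid d r g b) = Forbid d r True b"
| "forbid B (Forbid d r g b) = Forbid d r g True"

fun forbid_if :: "bool \<Rightarrow> col \<Rightarrow> palette \<Rightarrow> palette" where
  "forbid_if True c f = forbid c f" | "forbid_if False c f = f"

fun only :: "col \<Rightarrow> palette" where
  "only D = Forbid False True True True"
| "only R = Forbid True False True True"
| "only G = Forbid True True False True"
| "only B = Forbid True True True False"

type_synonym cells = "(ix \<times> palette) list"

fun forbid_adjacent :: "ix \<Rightarrow> col \<Rightarrow> cells \<Rightarrow> cells" where
  "forbid_adjacent i c [] = []"
| "forbid_adjacent i c ((j, f) # cs) = (j, forbid_if (adj i j) c f) # forbid_adjacent i c cs"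

section \<open>Enumeration of the proper words of a line\<close>

type_synonym partial_word = "col list \<times> nat \<times> cells"

fun extend_D :: "bool \<Rightarrow> col list \<Rightarrow> nat \<Rightarrow> cells \<Rightarrow> partial_word list \<Rightarrow> partial_word list" where
  "extend_D True acc n cs ts = ts"
| "extend_D False acc 0 cs ts = ts"
| "extend_D False acc (Suc n) cs ts = (D # acc, n, cs) # ts"

fun extend_col :: "bool \<Rightarrow> col \<Rightarrow> ix \<Rightarrow> col list \<Rightarrow> nat \<Rightarrow> cells \<Rightarrow> partial_word list \<Rightarrow> partial_word list" where
  "extend_col True c i acc n cs ts = ts"
| "extend_col False c i acc n cs ts = (c # acc, n, forbid_adjacent i c cs) # ts"

fun word_steps :: "partial_word list \<Rightarrow> partial_word list" where
  "word_steps [] = []"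
| "word_steps ((acc, n, []) # ss) = (acc, n, []) # word_steps ss"
| "word_steps ((acc, n, (i, Forbid d r g b) # cs) # ss) =
    extend_D d acc n cs (extend_col r R i acc n cs (extend_col g G i acc n cs (extend_col b B i acc n cs (word_steps ss))))"

fun rev_onto :: "'a list \<Rightarrow> 'a list \<Rightarrow> 'a list" where
  "rev_onto [] bs = bs" | "rev_onto (a # as) bs = rev_onto as (a # bs)"

fun finished_words :: "('a list \<times> 'b) list \<Rightarrow> 'a list list" where
  "finished_words [] = []" | "finished_words ((a, b) # xs) = rev_onto a [] # finished_words xs"

text \<open>One step for each of the six cells. The budget \<open>n\<close> bounds the deletions,
  and a chosen colour is forbidden at once in the adjacent cells that are still open.\<close>

definition words_upto :: "nat \<Rightarrow> cells \<Rightarrow> col list list" where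
  "words_upto n cs = finished_words (word_steps (word_steps (word_steps (word_steps (word_steps (word_steps [([], n, cs)]))))))"

fun search_all :: "('c \<Rightarrow> 'w \<Rightarrow> 's) \<Rightarrow> ('s \<Rightarrow> bool) \<Rightarrow> 'c \<times> 'w list \<Rightarrow> bool" where
  "search_all ap f (c, []) = True"
| "search_all ap f (c, w # ws) = (f (ap c w) \<and> search_all ap f (c, ws))"

text \<open>\<open>True\<close> means refuted: a state without successors succeeds, and exhausted
  fuel fails, so a wrong amount of fuel cannot make the result unsound. What all successors share is
  kept in \<open>c\<close>, apart from the list of choices.\<close>

primrec search :: "('s \<Rightarrow> 'c \<times> 'w list) \<Rightarrow> ('c \<Rightarrow> 'w \<Rightarrow> 's) \<Rightarrow> nat \<Rightarrow> 's \<Rightarrow> bool" where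
  "search ch ap 0 s = False"
| "search ch ap (Suc n) s = search_all ap (search ch ap n) (ch s)"

section \<open>Enumeration of the planes with at most seven deletions\<close>

fun filter_word :: "col list \<Rightarrow> col list list \<Rightarrow> col list list" where
  "filter_word w [] = []" | "filter_word w (v # vs) = keep (compat_word w v) v (filter_word w vs)"

fun filter_word_if :: "bool \<Rightarrow> col list \<Rightarrow> col list list \<Rightarrow> col list list" where
  "filter_word_if True w vs = filter_word w vs" | "filter_word_if False w vs = vs"

text \<open>
  For each line that is still open, its candidates with one deletion and those with two. At most
  one line of a plane with seven deletions has two.
\<close>

type_synonym line_choices = "(ix \<times> col list list \<times> col list list) list"

fun narrow :: "ix \<Rightarrow> col list \<Rightarrow> line_choices \<Rightarrow> line_choices" where
  "narrow i w [] = []"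
| "narrow i w ((j, a, b) # us) = (j, filter_word_if (adj i j) w a, filter_word_if (adj i j) w b) # narrow i w us"

fun narrow_single :: "ix \<Rightarrow> col list \<Rightarrow> line_choices \<Rightarrow> line_choices" where
  "narrow_single i w [] = []"
| "narrow_single i w ((j, a, b) # us) = (j, filter_word_if (adj i j) w a, []) # narrow_single i w us"

type_synonym chosen_lines = "(ix \<times> col list) list"

fun line_at :: "ix \<Rightarrow> chosen_lines \<Rightarrow> col list" and line_at_aux where
  "line_at i [] = []"
| "line_at i ((j, w) # d) = line_at_aux (same_index i j) i w d"
| "line_at_aux True i w d = w"
| "line_at_aux False i w d = line_at i d"

definition rows :: "chosen_lines \<Rightarrow> col list list" where
  "rows d = [line_at I5 d, line_at I4 d, line_at I3 d, line_at I2 d, line_at I1 d, line_at I0 d]"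

fun column :: "ix \<Rightarrow> col list list \<Rightarrow> col list" where
  "column i [] = []" | "column i (w # ws) = sel i w # column i ws"

definition transp :: "col list list \<Rightarrow> col list list" where
  "transp P = [column I5 P, column I4 P, column I3 P, column I2 P, column I1 P, column I0 P]"

fun double_words :: "col list list \<Rightarrow> col list list" and is_one where
  "double_words [] = []"
| "double_words (w # ws) = keep (is_one (excess w)) w (double_words ws)"
| "is_one 0 = False" | "is_one (Suc 0) = True" | "is_one (Suc (Suc n)) = False"

definition free_cells :: cells where
  "free_cells = [(I5, Forbid False False False False), (I4, Forbid False False False False), (I3, Forbid False False False False),
     (I2, Forbid False False False False), (I1, Forbid False False False False), (I0, Forbid False False False False)]"

fun forbid_word :: "col list \<Rightarrow> cells \<Rightarrow> cells" where
  "forbid_word w [] = []"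
| "forbid_word [] (c # cs) = c # cs"
| "forbid_word (D # w) (c # cs) = c # forbid_word w cs"
| "forbid_word (R # w) ((i, Forbid d r g b) # cs) = (i, Forbid d True g b) # forbid_word w cs"
| "forbid_word (G # w) ((i, Forbid d r g b) # cs) = (i, Forbid d r True b) # forbid_word w cs"
| "forbid_word (B # w) ((i, Forbid d r g b) # cs) = (i, Forbid d r g True) # forbid_word w cs"

fun forbid_word_if :: "bool \<Rightarrow> col list \<Rightarrow> cells \<Rightarrow> cells" where
  "forbid_word_if True w cs = forbid_word w cs" | "forbid_word_if False w cs = cs"

text \<open>A proper line has at least one deletion, so budget one yields exactly the words with
  one; the second list keeps the words with exactly two.\<close>

definition line_choice :: "ix \<Rightarrow> cells \<Rightarrow> ix \<times> col list list \<times> col list list" where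
  "line_choice i cs = (i, words_upto (Suc 0) cs, double_words (words_upto (Suc (Suc 0)) cs))"

fun lines_beside :: "ix \<Rightarrow> col list \<Rightarrow> ix list \<Rightarrow> line_choices" and lines_beside_aux where
  "lines_beside p k [] = []"
| "lines_beside p k (j # js) = lines_beside_aux (same_index p j) p k j js"
| "lines_beside_aux True p k j js = lines_beside p k js"
| "lines_beside_aux False p k j js = line_choice j (forbid_word_if (adj p j) k free_cells) # lines_beside p k js"

text \<open>The number is the excess of the known line, which decides whether it counts as a line
  with one deletion or as the one with more.\<close>

fun fixed_line :: "ix \<Rightarrow> col list \<Rightarrow> nat \<Rightarrow> ix \<times> col list list \<times> col list list" where
  "fixed_line p k 0 = (p, [k], [])"
| "fixed_line p k (Suc n) = (p, [], [k])"

definition indices :: "ix list" where "indices = [I5, I4, I3, I2, I1, I0]"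

fun gen_single :: "(chosen_lines \<Rightarrow> line_choices \<Rightarrow> col list list list) \<Rightarrow> chosen_lines \<Rightarrow> ix \<Rightarrow> line_choices \<Rightarrow> col list list \<Rightarrow> col list list list" where
  "gen_single f d i us [] = []"
| "gen_single f d i us (w # ws) = f ((i, w) # d) (narrow i w us) @ gen_single f d i us ws"

fun gen_double :: "(chosen_lines \<Rightarrow> line_choices \<Rightarrow> col list list list) \<Rightarrow> chosen_lines \<Rightarrow> ix \<Rightarrow> line_choices \<Rightarrow> col list list \<Rightarrow> col list list list" where
  "gen_double f d i us [] = []"
| "gen_double f d i us (w # ws) = f ((i, w) # d) (narrow_single i w us) @ gen_double f d i us ws"

fun gen_step :: "(chosen_lines \<Rightarrow> line_choices \<Rightarrow> col list list list) \<Rightarrow> chosen_lines \<Rightarrow> line_choices \<Rightarrow> col list list list" where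
  "gen_step f d [] = [rows d]"
| "gen_step f d ((i, a, b) # us) = gen_single f d i us a @ gen_double f d i us b"

primrec gen_planes :: "nat \<Rightarrow> chosen_lines \<Rightarrow> line_choices \<Rightarrow> col list list list" where
  "gen_planes 0 d us = []"
| "gen_planes (Suc n) d us = gen_step (gen_planes n) d us"

text \<open>Six steps choose the lines, a seventh emits the plane.\<close>

definition fuel7 :: nat where "fuel7 = Suc (Suc (Suc (Suc (Suc (Suc (Suc 0))))))"


section \<open>Lookup in tables keyed by two words\<close>

fun table_row :: "col list \<Rightarrow> (col list \<times> 'b list) list \<Rightarrow> 'b list" and table_row_aux where
  "table_row k [] = []"
| "table_row k ((k', v) # t) = table_row_aux (eq_word k k') k v t"
| "table_row_aux True k v t = v"
| "table_row_aux False k v t = table_row k t"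

fun table_entry :: "col list \<Rightarrow> (col list \<times> 'b) list \<Rightarrow> 'b list" and table_entry_aux where
  "table_entry k [] = []"
| "table_entry k ((k', v) # t) = table_entry_aux (eq_word k k') k v t"
| "table_entry_aux True k v t = [v]"
| "table_entry_aux False k v t = table_entry k t"

section \<open>Planes with seven deletions\<close>

text \<open>An address of three base-six digits. The tables hold addresses in place of plane lists,
  so that a lookup handles small terms and \<open>planes\<close> unfolds a single list at the
  end.\<close>

datatype entry = T ix ix ix
type_synonym table = "(col list \<times> (col list \<times> entry) list) list"

primrec tp0 :: "ix \<Rightarrow> col list list list" where
 "tp0 I0 = [[[B,G,R,D,G,R],[G,R,B,R,D,B],[R,B,D,G,B,G],[D,R,G,B,R,B],[R,D,B,G,B,G],[D,B,G,B,R,D]],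
   [[B,G,D,R,G,R],[G,D,R,B,R,B],[R,B,G,D,B,G],[D,R,B,G,R,B],[R,B,G,B,D,G],[D,R,B,G,B,D]]]"
| "tp0 I1 = [[[B,G,R,D,R,D],[G,R,B,R,D,B],[R,B,D,G,B,G],[D,R,G,R,G,B],[R,D,B,G,B,G],[D,B,G,B,G,R]],
   [[B,G,R,D,R,D],[G,R,B,R,D,B],[R,B,D,G,B,G],[D,R,G,B,G,B],[R,D,B,G,B,G],[D,B,G,B,G,R]],
   [[B,R,D,R,G,D],[G,D,R,B,R,B],[R,B,G,D,B,G],[D,G,R,G,R,B],[R,B,G,B,D,G],[D,G,B,G,B,R]],
   [[B,R,D,R,G,D],[G,D,R,B,R,B],[R,B,G,D,B,G],[D,G,B,G,R,B],[R,B,G,B,D,G],[D,G,B,G,B,R]]]"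
| "tp0 I2 = [[[B,R,D,R,D,G],[G,B,R,B,R,D],[R,G,B,D,G,B],[D,B,R,G,B,R],[R,D,G,B,G,B],[D,G,B,G,B,R]],
   [[B,R,G,R,D,G],[G,B,R,B,R,D],[R,G,B,D,G,B],[D,B,R,G,B,R],[R,D,D,B,G,B],[D,G,B,G,B,R]],
   [[B,R,G,R,D,G],[G,B,R,B,R,D],[R,G,B,D,G,B],[D,B,R,G,B,R],[R,G,D,B,G,B],[D,D,B,G,B,R]],
   [[B,D,R,D,R,G],[G,R,B,R,B,D],[R,G,D,B,G,B],[D,B,G,R,B,R],[R,G,B,G,D,B],[D,B,G,B,G,R]],
   [[B,D,R,G,R,G],[G,R,B,R,B,D],[R,G,D,B,G,B],[D,B,G,R,B,R],[R,G,B,D,D,B],[D,B,G,B,G,R]],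
   [[B,D,R,G,R,G],[G,R,B,R,B,D],[R,G,D,B,G,B],[D,B,G,R,B,R],[R,G,B,D,G,B],[D,B,G,B,D,R]]]"
| "tp0 I3 = [[[B,G,D,R,D,R],[G,D,R,B,R,B],[R,B,G,D,B,G],[D,R,B,G,R,B],[R,B,G,B,G,D],[D,R,B,G,B,G]],
   [[B,D,R,D,G,R],[G,R,B,R,D,B],[R,B,D,G,B,G],[D,R,G,B,R,B],[R,G,B,G,B,D],[D,B,G,B,R,G]],
   [[B,G,R,D,G,R],[G,R,B,R,D,B],[R,B,D,G,B,G],[D,R,G,B,R,B],[R,D,B,G,B,D],[D,B,G,B,R,G]],
   [[B,G,D,R,G,R],[G,D,R,B,R,B],[R,B,G,D,B,G],[D,R,B,G,R,B],[R,B,G,B,D,D],[D,R,B,G,B,G]]]"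
| "tp0 I4 = [[[B,G,D,R,D,R],[G,R,B,D,R,B],[R,B,G,B,G,D],[D,R,B,G,R,G],[R,D,G,B,G,B],[D,B,R,G,B,G]],
   [[B,G,D,R,D,R],[G,R,B,D,R,B],[R,B,G,B,G,D],[D,R,B,G,B,G],[R,D,G,B,G,B],[D,B,R,G,B,G]],
   [[B,D,R,G,D,R],[G,R,B,D,R,B],[R,B,G,B,G,D],[D,R,B,R,B,G],[R,G,D,B,G,B],[D,B,G,R,B,G]],
   [[B,G,R,G,D,R],[G,R,B,D,R,B],[R,B,G,B,G,D],[D,R,B,R,B,G],[R,D,D,B,G,B],[D,B,G,R,B,G]],
   [[B,G,R,G,D,R],[G,R,B,D,R,B],[R,B,G,B,G,D],[D,R,B,R,B,G],[R,D,G,B,G,B],[D,B,D,R,B,G]],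
   [[B,D,G,R,D,R],[G,R,D,B,R,B],[R,G,B,G,B,D],[D,B,R,B,R,G],[R,G,B,D,G,B],[D,B,R,G,B,G]],
   [[B,D,R,D,G,R],[G,R,D,B,R,B],[R,G,B,G,B,D],[D,R,G,B,R,G],[R,G,B,G,D,B],[D,B,G,R,B,G]],
   [[B,D,R,D,G,R],[G,R,D,B,R,B],[R,G,B,G,B,D],[D,B,G,B,R,G],[R,G,B,G,D,B],[D,B,G,R,B,G]],
   [[B,D,G,R,G,R],[G,R,D,B,R,B],[R,G,B,G,B,D],[D,B,R,B,R,G],[R,G,B,D,D,B],[D,B,R,G,B,G]],
   [[B,D,G,R,G,R],[G,R,D,B,R,B],[R,G,B,G,B,D],[D,B,R,B,R,G],[R,G,B,G,D,B],[D,B,R,D,B,G]]]"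
| "tp0 I5 = [[[B,D,G,R,D,R],[G,B,R,B,R,D],[R,G,B,D,G,B],[D,B,R,G,R,G],[R,G,D,B,G,B],[D,R,B,G,B,G]],
   [[B,D,G,R,D,R],[G,B,R,B,R,D],[R,G,B,D,G,B],[D,B,R,G,B,G],[R,G,D,B,G,B],[D,R,B,G,B,G]],
   [[B,D,R,G,D,R],[G,R,B,R,B,D],[R,G,D,B,G,B],[D,R,G,R,B,G],[R,G,B,D,G,B],[D,B,G,B,R,G]],
   [[B,D,R,G,D,R],[G,R,B,R,B,D],[R,G,D,B,G,B],[D,B,G,R,B,G],[R,G,B,D,G,B],[D,B,G,B,R,G]]]"

primrec tp1 :: "ix \<Rightarrow> col list list list" where
 "tp1 I0 = [[[B,R,D,R,D,G],[G,B,R,D,B,R],[R,D,G,B,G,B],[D,G,R,G,B,R],[R,B,G,B,G,D],[D,G,B,G,R,B]],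
   [[B,R,D,R,D,G],[G,B,R,D,B,R],[R,D,G,B,G,B],[D,G,B,G,B,R],[R,B,G,B,G,D],[D,G,B,G,R,B]],
   [[B,D,R,D,R,G],[G,B,D,R,B,R],[R,G,B,G,D,B],[D,B,G,R,G,R],[R,G,B,G,B,D],[D,R,G,B,G,B]],
   [[B,D,R,D,R,G],[G,B,D,R,B,R],[R,G,B,G,D,B],[D,B,G,B,G,R],[R,G,B,G,B,D],[D,R,G,B,G,B]],
   [[B,R,G,D,R,G],[G,B,D,R,B,R],[R,G,B,G,D,B],[D,B,R,B,G,R],[R,D,B,G,B,D],[D,G,R,B,G,B]],
   [[B,R,G,D,R,G],[G,B,D,R,B,R],[R,G,B,G,D,B],[D,B,R,B,G,R],[R,G,B,G,B,D],[D,D,R,B,G,B]],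
   [[B,R,D,G,R,G],[G,B,R,D,B,R],[R,D,G,B,G,B],[D,G,B,R,B,R],[R,B,G,B,D,D],[D,G,B,R,G,B]],
   [[B,R,D,G,R,G],[G,B,R,D,B,R],[R,D,G,B,G,B],[D,G,B,R,B,R],[R,B,G,B,G,D],[D,G,B,R,D,B]]]"
| "tp1 I1 = [[[B,R,G,D,R,D],[G,B,R,B,D,R],[R,D,B,G,B,G],[D,G,R,B,G,R],[R,B,D,G,B,G],[D,G,B,R,G,B]],
   [[B,R,D,G,R,D],[G,D,B,R,B,R],[R,B,G,B,D,G],[D,G,B,R,G,R],[R,B,G,D,B,G],[D,G,R,B,G,B]]]"
| "tp1 I2 = [[[B,R,G,D,R,D],[G,B,D,R,B,R],[R,G,B,G,D,B],[D,B,R,B,G,R],[R,D,B,G,B,G],[D,G,R,B,G,B]],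
   [[B,R,D,G,R,D],[G,B,R,D,B,R],[R,D,G,B,G,B],[D,G,B,R,B,R],[R,B,G,B,D,G],[D,G,B,R,G,B]]]"
| "tp1 I3 = [[[B,R,G,D,R,D],[G,B,R,B,D,R],[R,D,B,G,B,G],[D,G,R,B,G,B],[R,B,D,G,B,G],[D,G,B,R,G,B]],
   [[B,G,R,D,R,D],[G,D,B,R,B,R],[R,B,G,B,D,G],[D,R,B,R,G,B],[R,B,D,G,B,G],[D,R,G,B,G,B]],
   [[B,R,D,G,R,D],[G,D,B,R,B,R],[R,B,G,B,D,G],[D,G,B,R,G,B],[R,B,G,D,B,G],[D,G,R,B,G,B]],
   [[B,G,R,G,R,D],[G,D,B,R,B,R],[R,B,G,B,D,G],[D,R,B,R,G,B],[R,B,D,D,B,G],[D,R,G,B,G,B]],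
   [[B,G,R,G,R,D],[G,D,B,R,B,R],[R,B,G,B,D,G],[D,R,B,R,G,B],[R,B,G,D,B,G],[D,R,D,B,G,B]],
   [[B,R,D,R,G,D],[G,B,R,B,D,R],[R,D,B,G,B,G],[D,G,R,B,R,B],[R,B,G,D,B,G],[D,G,B,G,R,B]],
   [[B,R,G,R,G,D],[G,B,R,B,D,R],[R,D,B,G,B,G],[D,G,R,B,R,B],[R,B,D,D,B,G],[D,G,B,G,R,B]],
   [[B,R,G,R,G,D],[G,B,R,B,D,R],[R,D,B,G,B,G],[D,G,R,B,R,B],[R,B,D,G,B,G],[D,G,B,D,R,B]]]"
| "tp1 I4 = [[[B,G,R,D,G,R],[G,R,B,R,D,B],[R,B,G,D,B,G],[G,R,D,B,R,B],[R,D,B,G,B,G],[D,B,G,B,R,D]],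
   [[B,G,R,D,G,R],[G,R,B,R,D,B],[R,B,D,G,B,G],[G,R,D,B,R,B],[R,D,B,G,B,G],[D,B,G,B,R,D]],
   [[B,G,D,R,G,R],[G,D,R,B,R,B],[R,B,G,D,B,G],[G,R,B,D,R,B],[R,B,G,B,D,G],[D,R,B,G,B,D]],
   [[B,G,D,R,G,R],[G,D,R,B,R,B],[R,B,D,G,B,G],[G,R,B,D,R,B],[R,B,G,B,D,G],[D,R,B,G,B,D]]]"
| "tp1 I5 = [[[B,R,D,G,R,G],[G,B,R,B,D,R],[R,G,B,D,G,B],[G,B,R,D,B,R],[R,D,G,B,G,B],[D,G,B,R,B,D]],
   [[B,R,D,G,R,G],[G,B,R,B,D,R],[R,G,B,D,G,B],[G,B,D,R,B,R],[R,D,G,B,G,B],[D,G,B,R,B,D]],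
   [[B,R,G,D,R,G],[G,D,B,R,B,R],[R,G,D,B,G,B],[G,B,R,D,B,R],[R,G,B,G,D,B],[D,B,R,B,G,D]],
   [[B,R,G,D,R,G],[G,D,B,R,B,R],[R,G,D,B,G,B],[G,B,D,R,B,R],[R,G,B,G,D,B],[D,B,R,B,G,D]]]"

primrec tp2 :: "ix \<Rightarrow> col list list list" where
 "tp2 I0 = [[[B,D,R,G,D,G],[G,R,B,D,R,B],[R,B,G,B,G,D],[G,R,B,R,B,D],[R,G,D,B,G,B],[D,B,G,R,B,R]],
   [[B,D,G,R,D,G],[G,R,D,B,R,B],[R,G,B,G,B,D],[G,B,R,B,R,D],[R,G,B,D,G,B],[D,B,R,G,B,R]],
   [[B,R,G,R,D,G],[G,D,D,B,R,B],[R,G,B,G,B,D],[G,B,R,B,R,D],[R,G,B,D,G,B],[D,B,R,G,B,R]],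
   [[B,R,G,R,D,G],[G,D,R,B,R,B],[R,G,B,G,B,D],[G,B,R,B,R,D],[R,G,B,D,G,B],[D,B,D,G,B,R]],
   [[B,D,R,G,R,G],[G,R,B,D,D,B],[R,B,G,B,G,D],[G,R,B,R,B,D],[R,G,D,B,G,B],[D,B,G,R,B,R]],
   [[B,D,R,G,R,G],[G,R,B,R,D,B],[R,B,G,B,G,D],[G,R,B,R,B,D],[R,G,D,B,G,B],[D,B,G,D,B,R]]]"
| "tp2 I1 = [[[B,D,R,G,D,G],[G,R,B,D,R,B],[R,B,G,B,G,D],[G,D,B,R,B,R],[R,G,D,B,G,B],[D,B,G,R,B,R]],
   [[B,D,G,R,D,G],[G,R,D,B,R,B],[R,G,B,G,B,D],[G,B,R,B,D,R],[R,G,B,D,G,B],[D,B,R,G,B,R]],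
   [[B,R,G,R,D,G],[G,D,D,B,R,B],[R,G,B,G,B,D],[G,B,R,B,D,R],[R,G,B,D,G,B],[D,B,R,G,B,R]],
   [[B,R,G,R,D,G],[G,D,R,B,R,B],[R,G,B,G,B,D],[G,B,R,B,D,R],[R,G,B,D,G,B],[D,B,D,G,B,R]],
   [[B,D,R,G,R,G],[G,R,B,D,D,B],[R,B,G,B,G,D],[G,D,B,R,B,R],[R,G,D,B,G,B],[D,B,G,R,B,R]],
   [[B,D,R,G,R,G],[G,R,B,R,D,B],[R,B,G,B,G,D],[G,D,B,R,B,R],[R,G,D,B,G,B],[D,B,G,D,B,R]]]"
| "tp2 I2 = [[[B,R,D,R,D,G],[G,B,R,B,R,D],[R,G,B,G,D,B],[G,B,R,D,B,R],[R,D,G,B,G,B],[D,G,B,G,B,R]],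
   [[B,R,G,R,D,G],[G,B,R,B,R,D],[R,G,B,G,D,B],[G,B,R,D,B,R],[R,D,D,B,G,B],[D,G,B,G,B,R]],
   [[B,R,G,R,D,G],[G,B,R,B,R,D],[R,G,B,G,D,B],[G,B,R,D,B,R],[R,G,D,B,G,B],[D,D,B,G,B,R]],
   [[B,R,D,R,D,G],[G,B,R,B,R,D],[R,G,B,D,G,B],[G,B,R,D,B,R],[R,D,G,B,G,B],[D,G,B,G,B,R]],
   [[B,R,G,R,D,G],[G,B,R,B,R,D],[R,G,B,D,G,B],[G,B,R,D,B,R],[R,D,D,B,G,B],[D,G,B,G,B,R]],
   [[B,R,G,R,D,G],[G,B,R,B,R,D],[R,G,B,D,G,B],[G,B,R,D,B,R],[R,G,D,B,G,B],[D,D,B,G,B,R]],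
   [[B,R,D,G,D,G],[G,B,R,B,R,D],[R,G,B,D,G,B],[G,B,R,D,B,R],[R,D,G,B,G,B],[D,G,B,R,B,R]],
   [[B,R,D,G,D,G],[G,B,R,B,R,D],[R,G,B,D,G,B],[G,B,D,R,B,R],[R,D,G,B,G,B],[D,G,B,R,B,R]],
   [[B,R,D,G,R,G],[G,B,R,B,D,D],[R,G,B,D,G,B],[G,B,R,D,B,R],[R,D,G,B,G,B],[D,G,B,R,B,R]],
   [[B,R,D,G,R,G],[G,B,R,B,D,D],[R,G,B,D,G,B],[G,B,D,R,B,R],[R,D,G,B,G,B],[D,G,B,R,B,R]],
   [[B,D,G,D,R,G],[G,R,B,R,B,D],[R,G,D,B,G,B],[G,B,R,D,B,R],[R,G,B,G,D,B],[D,B,R,B,G,R]],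
   [[B,R,G,D,R,G],[G,D,B,R,B,D],[R,G,D,B,G,B],[G,B,R,D,B,R],[R,G,B,G,D,B],[D,B,R,B,G,R]],
   [[B,D,R,D,R,G],[G,R,B,R,B,D],[R,G,D,B,G,B],[G,B,D,R,B,R],[R,G,B,G,D,B],[D,B,G,B,G,R]],
   [[B,D,R,D,R,G],[G,R,B,R,B,D],[R,D,G,B,G,B],[G,B,D,R,B,R],[R,G,B,G,D,B],[D,B,G,B,G,R]],
   [[B,D,G,D,R,G],[G,R,B,R,B,D],[R,G,D,B,G,B],[G,B,D,R,B,R],[R,G,B,G,D,B],[D,B,R,B,G,R]],
   [[B,R,G,D,R,G],[G,D,B,R,B,D],[R,G,D,B,G,B],[G,B,D,R,B,R],[R,G,B,G,D,B],[D,B,R,B,G,R]],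
   [[B,D,R,G,R,G],[G,R,B,R,B,D],[R,G,D,B,G,B],[G,B,D,R,B,R],[R,G,B,D,D,B],[D,B,G,B,G,R]],
   [[B,D,R,G,R,G],[G,R,B,R,B,D],[R,D,G,B,G,B],[G,B,D,R,B,R],[R,G,B,D,D,B],[D,B,G,B,G,R]],
   [[B,D,R,G,R,G],[G,R,B,R,B,D],[R,G,D,B,G,B],[G,B,D,R,B,R],[R,G,B,D,G,B],[D,B,G,B,D,R]],
   [[B,D,R,G,R,G],[G,R,B,R,B,D],[R,D,G,B,G,B],[G,B,D,R,B,R],[R,G,B,D,G,B],[D,B,G,B,D,R]]]"
| "tp2 I3 = [[[B,G,D,G,D,R],[G,D,R,B,R,B],[R,B,G,D,B,G],[G,R,B,R,D,B],[R,B,G,B,G,D],[D,R,B,R,B,G]],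
   [[B,G,R,G,D,R],[G,D,D,B,R,B],[R,B,G,D,B,G],[G,R,B,R,D,B],[R,B,G,B,G,D],[D,R,B,R,B,G]],
   [[B,G,R,G,D,R],[G,R,D,B,R,B],[R,B,G,D,B,G],[G,R,B,R,D,B],[R,B,G,B,G,D],[D,D,B,R,B,G]],
   [[B,G,D,R,D,R],[G,D,R,B,R,B],[R,B,G,D,B,G],[G,R,B,D,R,B],[R,B,G,B,G,D],[D,R,B,G,B,G]],
   [[B,G,D,R,D,R],[G,D,R,B,R,B],[R,B,D,G,B,G],[G,R,B,D,R,B],[R,B,G,B,G,D],[D,R,B,G,B,G]],
   [[B,G,D,G,D,R],[G,D,R,B,R,B],[R,B,G,D,B,G],[G,R,B,D,R,B],[R,B,G,B,G,D],[D,R,B,R,B,G]],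
   [[B,G,R,G,D,R],[G,D,D,B,R,B],[R,B,G,D,B,G],[G,R,B,D,R,B],[R,B,G,B,G,D],[D,R,B,R,B,G]],
   [[B,G,R,G,D,R],[G,R,D,B,R,B],[R,B,G,D,B,G],[G,R,B,D,R,B],[R,B,G,B,G,D],[D,D,B,R,B,G]],
   [[B,D,R,D,G,R],[G,R,B,R,D,B],[R,B,G,D,B,G],[G,R,D,B,R,B],[R,G,B,G,B,D],[D,B,G,B,R,G]],
   [[B,G,R,D,G,R],[G,R,B,R,D,B],[R,B,G,D,B,G],[G,R,D,B,R,B],[R,D,B,G,B,D],[D,B,G,B,R,G]],
   [[B,D,R,D,G,R],[G,R,B,R,D,B],[R,B,D,G,B,G],[G,R,D,B,R,B],[R,G,B,G,B,D],[D,B,G,B,R,G]],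
   [[B,G,R,D,G,R],[G,R,B,R,D,B],[R,B,D,G,B,G],[G,R,D,B,R,B],[R,D,B,G,B,D],[D,B,G,B,R,G]],
   [[B,D,G,D,G,R],[G,R,B,R,D,B],[R,B,D,G,B,G],[G,R,D,B,R,B],[R,G,B,G,B,D],[D,B,R,B,R,G]],
   [[B,D,G,D,G,R],[G,R,B,R,D,B],[R,B,D,G,B,G],[G,D,R,B,R,B],[R,G,B,G,B,D],[D,B,R,B,R,G]],
   [[B,D,G,R,G,R],[G,R,B,D,D,B],[R,B,D,G,B,G],[G,R,D,B,R,B],[R,G,B,G,B,D],[D,B,R,B,R,G]],
   [[B,D,G,R,G,R],[G,R,B,D,D,B],[R,B,D,G,B,G],[G,D,R,B,R,B],[R,G,B,G,B,D],[D,B,R,B,R,G]],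
   [[B,G,D,R,G,R],[G,D,R,B,R,B],[R,B,G,D,B,G],[G,R,B,D,R,B],[R,B,G,B,D,D],[D,R,B,G,B,G]],
   [[B,G,D,R,G,R],[G,D,R,B,R,B],[R,B,D,G,B,G],[G,R,B,D,R,B],[R,B,G,B,D,D],[D,R,B,G,B,G]],
   [[B,D,G,R,G,R],[G,R,B,D,R,B],[R,B,D,G,B,G],[G,R,D,B,R,B],[R,G,B,G,B,D],[D,B,R,B,D,G]],
   [[B,D,G,R,G,R],[G,R,B,D,R,B],[R,B,D,G,B,G],[G,D,R,B,R,B],[R,G,B,G,B,D],[D,B,R,B,D,G]]]"
| "tp2 I4 = [[[B,D,R,G,D,R],[G,R,B,D,R,B],[R,B,G,B,G,D],[G,R,B,R,B,D],[R,G,D,B,G,B],[D,B,G,R,B,G]],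
   [[B,G,R,G,D,R],[G,R,B,D,R,B],[R,B,G,B,G,D],[G,R,B,R,B,D],[R,D,D,B,G,B],[D,B,G,R,B,G]],
   [[B,G,R,G,D,R],[G,R,B,D,R,B],[R,B,G,B,G,D],[G,R,B,R,B,D],[R,D,G,B,G,B],[D,B,D,R,B,G]],
   [[B,D,G,R,D,R],[G,R,D,B,R,B],[R,G,B,G,B,D],[G,B,R,B,R,D],[R,G,B,D,G,B],[D,B,R,G,B,G]],
   [[B,D,G,R,G,R],[G,R,D,B,R,B],[R,G,B,G,B,D],[G,B,R,B,R,D],[R,G,B,D,D,B],[D,B,R,G,B,G]],
   [[B,D,G,R,G,R],[G,R,D,B,R,B],[R,G,B,G,B,D],[G,B,R,B,R,D],[R,G,B,G,D,B],[D,B,R,D,B,G]]]"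
| "tp2 I5 = [[[B,D,R,G,D,R],[G,R,B,D,R,B],[R,B,G,B,D,G],[G,R,B,R,B,D],[R,G,D,B,G,B],[D,B,G,R,B,G]],
   [[B,G,R,G,D,R],[G,R,B,D,R,B],[R,B,G,B,D,G],[G,R,B,R,B,D],[R,D,D,B,G,B],[D,B,G,R,B,G]],
   [[B,G,R,G,D,R],[G,R,B,D,R,B],[R,B,G,B,D,G],[G,R,B,R,B,D],[R,D,G,B,G,B],[D,B,D,R,B,G]],
   [[B,D,G,R,D,R],[G,R,D,B,R,B],[R,D,B,G,B,G],[G,B,R,B,R,D],[R,G,B,D,G,B],[D,B,R,G,B,G]],
   [[B,D,G,R,G,R],[G,R,D,B,R,B],[R,D,B,G,B,G],[G,B,R,B,R,D],[R,G,B,D,D,B],[D,B,R,G,B,G]],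
   [[B,D,G,R,G,R],[G,R,D,B,R,B],[R,D,B,G,B,G],[G,B,R,B,R,D],[R,G,B,G,D,B],[D,B,R,D,B,G]]]"

primrec tp3 :: "ix \<Rightarrow> col list list list" where
 "tp3 I0 = [[[B,R,G,D,R,G],[G,B,D,R,B,R],[R,G,B,G,D,B],[G,B,R,B,D,R],[R,D,B,G,B,D],[D,G,R,B,G,B]],
   [[B,R,G,D,R,G],[G,B,D,R,B,R],[R,G,B,G,D,B],[G,B,R,B,D,R],[R,G,B,G,B,D],[D,D,R,B,G,B]],
   [[B,R,G,D,R,G],[G,B,D,R,B,R],[R,G,B,D,G,B],[G,B,R,B,D,R],[R,D,B,G,B,D],[D,G,R,B,G,B]],
   [[B,R,G,D,R,G],[G,B,D,R,B,R],[R,G,B,D,G,B],[G,B,R,B,D,R],[R,G,B,G,B,D],[D,D,R,B,G,B]],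
   [[B,R,D,G,R,G],[G,B,R,D,B,R],[R,G,D,B,G,B],[G,D,B,R,B,R],[R,B,G,B,D,D],[D,G,B,R,G,B]],
   [[B,R,D,G,R,G],[G,B,R,D,B,R],[R,D,G,B,G,B],[G,D,B,R,B,R],[R,B,G,B,D,D],[D,G,B,R,G,B]],
   [[B,R,D,G,R,G],[G,B,R,D,B,R],[R,G,D,B,G,B],[G,D,B,R,B,R],[R,B,G,B,G,D],[D,G,B,R,D,B]],
   [[B,R,D,G,R,G],[G,B,R,D,B,R],[R,D,G,B,G,B],[G,D,B,R,B,R],[R,B,G,B,G,D],[D,G,B,R,D,B]]]"
| "tp3 I1 = [[[B,G,D,G,R,D],[G,B,R,D,B,R],[R,D,G,B,G,B],[G,R,B,R,B,D],[R,B,G,B,D,G],[D,R,B,R,G,B]],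
   [[B,G,R,G,R,D],[G,B,D,D,B,R],[R,D,G,B,G,B],[G,R,B,R,B,D],[R,B,G,B,D,G],[D,R,B,R,G,B]],
   [[B,G,R,G,R,D],[G,B,D,R,B,R],[R,D,G,B,G,B],[G,R,B,R,B,D],[R,B,G,B,D,G],[D,R,B,D,G,B]],
   [[B,R,G,D,G,D],[G,B,D,R,B,R],[R,G,B,G,D,B],[G,B,R,B,R,D],[R,D,B,G,B,G],[D,G,R,B,R,B]],
   [[B,R,G,R,G,D],[G,B,D,D,B,R],[R,G,B,G,D,B],[G,B,R,B,R,D],[R,D,B,G,B,G],[D,G,R,B,R,B]],
   [[B,R,G,R,G,D],[G,B,R,D,B,R],[R,G,B,G,D,B],[G,B,R,B,R,D],[R,D,B,G,B,G],[D,G,D,B,R,B]]]"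
| "tp3 I2 = [[[B,R,G,D,R,D],[G,B,D,R,B,R],[R,G,B,G,D,B],[G,B,R,B,D,R],[R,D,B,G,B,G],[D,G,R,B,G,B]],
   [[B,R,G,D,R,D],[G,B,D,R,B,R],[R,G,B,D,G,B],[G,B,R,B,D,R],[R,D,B,G,B,G],[D,G,R,B,G,B]],
   [[B,R,D,G,R,D],[G,B,R,D,B,R],[R,G,D,B,G,B],[G,D,B,R,B,R],[R,B,G,B,D,G],[D,G,B,R,G,B]],
   [[B,R,D,G,R,D],[G,B,R,D,B,R],[R,D,G,B,G,B],[G,D,B,R,B,R],[R,B,G,B,D,G],[D,G,B,R,G,B]],
   [[B,G,D,G,R,D],[G,B,R,D,B,R],[R,D,G,B,G,B],[G,D,B,R,B,R],[R,B,G,B,D,G],[D,R,B,R,G,B]],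
   [[B,G,R,G,R,D],[G,B,D,D,B,R],[R,D,G,B,G,B],[G,D,B,R,B,R],[R,B,G,B,D,G],[D,R,B,R,G,B]],
   [[B,G,R,G,R,D],[G,B,D,R,B,R],[R,D,G,B,G,B],[G,D,B,R,B,R],[R,B,G,B,D,G],[D,R,B,D,G,B]],
   [[B,R,G,D,G,D],[G,B,D,R,B,R],[R,G,B,G,D,B],[G,B,R,B,D,R],[R,D,B,G,B,G],[D,G,R,B,R,B]],
   [[B,R,G,R,G,D],[G,B,D,D,B,R],[R,G,B,G,D,B],[G,B,R,B,D,R],[R,D,B,G,B,G],[D,G,R,B,R,B]],
   [[B,R,G,R,G,D],[G,B,R,D,B,R],[R,G,B,G,D,B],[G,B,R,B,D,R],[R,D,B,G,B,G],[D,G,D,B,R,B]]]"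
| "tp3 I3 = [[[B,G,R,D,R,D],[G,D,B,R,B,R],[R,B,G,B,G,D],[G,R,B,R,D,B],[R,B,D,G,B,G],[D,R,G,B,G,B]],
   [[B,G,R,G,R,D],[G,D,B,R,B,R],[R,B,G,B,G,D],[G,R,B,R,D,B],[R,B,D,D,B,G],[D,R,G,B,G,B]],
   [[B,G,R,G,R,D],[G,D,B,R,B,R],[R,B,G,B,G,D],[G,R,B,R,D,B],[R,B,G,D,B,G],[D,R,D,B,G,B]],
   [[B,R,D,R,G,D],[G,B,R,B,D,R],[R,G,B,G,B,D],[G,D,R,B,R,B],[R,B,G,D,B,G],[D,G,B,G,R,B]],
   [[B,R,G,R,G,D],[G,B,R,B,D,R],[R,G,B,G,B,D],[G,D,R,B,R,B],[R,B,D,D,B,G],[D,G,B,G,R,B]],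
   [[B,R,G,R,G,D],[G,B,R,B,D,R],[R,G,B,G,B,D],[G,D,R,B,R,B],[R,B,D,G,B,G],[D,G,B,D,R,B]]]"
| "tp3 I4 = [[[B,G,D,R,G,R],[G,B,R,B,D,D],[R,D,B,G,B,G],[G,R,D,B,R,B],[R,B,G,D,B,G],[D,R,B,G,R,B]],
   [[B,G,D,R,G,R],[G,B,R,B,D,D],[R,D,B,G,B,G],[G,D,R,B,R,B],[R,B,G,D,B,G],[D,R,B,G,R,B]],
   [[B,G,D,R,G,R],[G,B,R,B,R,D],[R,D,B,G,B,G],[G,R,D,B,R,B],[R,B,G,D,B,G],[D,R,B,G,D,B]],
   [[B,G,D,R,G,R],[G,B,R,B,R,D],[R,D,B,G,B,G],[G,D,R,B,R,B],[R,B,G,D,B,G],[D,R,B,G,D,B]],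
   [[B,G,R,D,G,R],[G,D,B,R,B,D],[R,B,G,B,D,G],[G,R,B,R,D,B],[R,B,D,G,B,G],[D,R,G,B,R,B]],
   [[B,G,R,D,G,R],[G,R,B,R,B,D],[R,B,G,B,D,G],[G,R,B,R,D,B],[R,B,D,G,B,G],[D,D,G,B,R,B]],
   [[B,G,R,D,G,R],[G,D,B,R,B,D],[R,B,G,B,D,G],[G,R,B,D,R,B],[R,B,D,G,B,G],[D,R,G,B,R,B]],
   [[B,G,R,D,G,R],[G,R,B,R,B,D],[R,B,G,B,D,G],[G,R,B,D,R,B],[R,B,D,G,B,G],[D,D,G,B,R,B]]]"
| "tp3 I5 = [[[B,G,R,D,R,D],[G,D,B,R,B,R],[R,B,G,B,D,G],[G,R,B,R,D,B],[R,B,D,G,B,G],[D,R,G,B,G,B]],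
   [[B,G,R,G,R,D],[G,D,B,R,B,R],[R,B,G,B,D,G],[G,R,B,R,D,B],[R,B,D,D,B,G],[D,R,G,B,G,B]],
   [[B,G,R,G,R,D],[G,D,B,R,B,R],[R,B,G,B,D,G],[G,R,B,R,D,B],[R,B,G,D,B,G],[D,R,D,B,G,B]],
   [[B,G,D,R,G,D],[G,B,R,B,D,R],[R,D,B,G,B,G],[G,R,D,B,R,B],[R,B,G,D,B,G],[D,R,B,G,R,B]],
   [[B,R,D,R,G,D],[G,B,R,B,D,R],[R,D,B,G,B,G],[G,D,R,B,R,B],[R,B,G,D,B,G],[D,G,B,G,R,B]],
   [[B,G,D,R,G,D],[G,B,R,B,D,R],[R,D,B,G,B,G],[G,D,R,B,R,B],[R,B,G,D,B,G],[D,R,B,G,R,B]],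
   [[B,R,G,R,G,D],[G,B,R,B,D,R],[R,D,B,G,B,G],[G,D,R,B,R,B],[R,B,D,D,B,G],[D,G,B,G,R,B]],
   [[B,R,G,R,G,D],[G,B,R,B,D,R],[R,D,B,G,B,G],[G,D,R,B,R,B],[R,B,D,G,B,G],[D,G,B,D,R,B]],
   [[B,G,R,D,G,D],[G,D,B,R,B,R],[R,B,G,B,D,G],[G,R,B,R,D,B],[R,B,D,G,B,G],[D,R,G,B,R,B]],
   [[B,G,R,D,G,D],[G,D,B,R,B,R],[R,B,G,B,D,G],[G,R,B,D,R,B],[R,B,D,G,B,G],[D,R,G,B,R,B]]]"

primrec tp4 :: "ix \<Rightarrow> col list list list" where
 "tp4 I0 = [[[R,D,B,G,D,B],[B,G,D,R,G,R],[D,R,G,B,R,G],[G,B,R,D,B,R],[B,R,G,R,G,D],[G,B,R,B,R,D]],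
   [[R,G,B,G,D,B],[B,D,D,R,G,R],[D,R,G,B,R,G],[G,B,R,D,B,R],[B,R,G,R,G,D],[G,B,R,B,R,D]],
   [[R,G,B,G,D,B],[B,D,G,R,G,R],[D,R,D,B,R,G],[G,B,R,D,B,R],[B,R,G,R,G,D],[G,B,R,B,R,D]]]"
| "tp4 I1 = [[[R,D,G,B,G,B],[G,B,D,R,B,R],[D,R,B,D,R,G],[B,G,R,G,D,R],[G,R,B,R,B,D],[B,G,R,G,R,D]],
   [[R,D,G,B,G,B],[G,B,D,R,B,R],[D,R,B,G,R,G],[B,G,R,D,D,R],[G,R,B,R,B,D],[B,G,R,G,R,D]]]"
| "tp4 I2 = [[[R,D,G,B,D,B],[G,B,D,R,B,R],[D,R,B,G,R,G],[B,G,R,D,G,R],[G,R,B,R,B,D],[B,G,R,G,R,D]]]"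
| "tp4 I3 = [[[R,G,B,G,D,B],[G,B,R,D,B,R],[D,R,D,B,R,G],[B,D,G,R,G,R],[G,B,R,B,R,D],[B,R,G,R,G,D]],
   [[R,D,B,G,D,B],[G,B,R,D,B,R],[D,R,G,B,R,G],[B,G,D,R,G,R],[G,B,R,B,R,D],[B,R,G,R,G,D]],
   [[R,G,B,G,D,B],[G,B,R,D,B,R],[D,R,G,B,R,G],[B,D,D,R,G,R],[G,B,R,B,R,D],[B,R,G,R,G,D]]]"
| "tp4 I4 = [[[R,D,G,B,G,B],[B,G,R,D,D,R],[D,R,B,G,R,G],[G,B,D,R,B,R],[B,G,R,G,R,D],[G,R,B,R,B,D]],
   [[R,D,G,B,G,B],[B,G,R,G,D,R],[D,R,B,D,R,G],[G,B,D,R,B,R],[B,G,R,G,R,D],[G,R,B,R,B,D]]]"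
| "tp4 I5 = [[[R,D,G,B,D,B],[B,G,R,D,G,R],[D,R,B,G,R,G],[G,B,D,R,B,R],[B,G,R,G,R,D],[G,R,B,R,B,D]]]"

primrec tp5 :: "ix \<Rightarrow> col list list list" where
 "tp5 I0 = [[[G,R,D,B,R,B],[D,B,G,R,B,G],[B,G,R,D,G,R],[R,D,B,G,B,G],[D,B,G,R,G,R],[R,G,B,G,D,D]],
   [[G,R,D,B,R,B],[D,B,G,R,B,G],[B,G,R,D,G,R],[R,D,B,G,B,G],[D,B,G,R,G,R],[B,G,R,G,D,D]],
   [[G,R,D,B,R,B],[D,B,G,R,B,G],[B,G,R,D,G,R],[R,B,D,G,B,G],[B,D,G,R,G,R],[R,G,B,G,D,D]],
   [[G,R,D,B,R,B],[D,B,G,R,B,G],[B,G,R,D,G,R],[R,D,B,G,B,G],[B,D,G,R,G,R],[R,G,B,G,D,D]],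
   [[G,R,D,B,R,B],[R,B,G,D,B,G],[B,G,R,D,G,R],[R,D,B,G,B,G],[D,B,G,R,G,R],[B,G,R,G,D,D]],
   [[G,R,D,B,R,B],[R,B,G,D,B,G],[B,G,D,R,G,R],[R,D,B,G,B,G],[D,B,G,R,G,R],[B,G,R,G,D,D]]]"
| "tp5 I1 = [[[R,G,D,B,G,B],[D,B,R,G,R,G],[G,D,B,R,B,R],[B,R,G,D,R,G],[D,B,R,G,B,R],[G,R,B,R,D,D]],
   [[R,G,D,B,G,B],[D,B,R,G,R,G],[G,D,B,R,B,R],[B,R,G,D,R,G],[D,B,R,G,B,R],[B,R,G,R,D,D]],
   [[R,G,D,B,G,B],[D,B,R,G,R,G],[G,D,B,R,B,R],[B,R,G,D,R,G],[G,B,R,D,B,R],[B,R,G,R,D,D]],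
   [[R,G,D,B,G,B],[D,B,R,G,R,G],[G,D,B,R,B,R],[B,R,D,G,R,G],[G,B,R,D,B,R],[B,R,G,R,D,D]],
   [[R,G,D,B,G,B],[B,D,R,G,R,G],[G,B,D,R,B,R],[B,R,G,D,R,G],[D,B,R,G,B,R],[G,R,B,R,D,D]],
   [[R,G,D,B,G,B],[B,D,R,G,R,G],[G,D,B,R,B,R],[B,R,G,D,R,G],[D,B,R,G,B,R],[G,R,B,R,D,D]]]"
| "tp5 I2 = [[[R,D,B,G,D,B],[D,R,G,R,B,G],[B,G,R,D,G,R],[D,R,G,B,R,G],[B,G,D,R,G,R],[G,B,R,B,R,D]],
   [[R,D,B,G,D,B],[D,R,G,R,B,G],[B,G,R,D,G,R],[D,B,G,B,R,G],[B,G,D,R,G,R],[G,B,R,B,R,D]],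
   [[G,R,B,R,D,B],[R,B,G,D,B,G],[D,G,D,B,G,R],[B,D,R,G,R,G],[D,B,G,B,G,R],[B,G,R,G,R,D]],
   [[G,D,B,R,D,B],[R,B,G,D,B,G],[D,G,R,B,G,R],[B,R,D,G,R,G],[D,B,G,B,G,R],[B,G,R,G,R,D]],
   [[G,R,B,R,D,B],[R,B,G,D,B,G],[D,G,R,B,G,R],[B,D,D,G,R,G],[D,B,G,B,G,R],[B,G,R,G,R,D]],
   [[G,R,D,B,D,B],[R,B,G,D,B,G],[D,G,B,R,G,R],[B,D,R,G,R,G],[D,B,G,R,G,R],[B,G,R,G,R,D]]]"
| "tp5 I3 = [[[R,G,B,G,D,B],[B,R,G,R,D,G],[G,B,R,D,B,R],[D,R,D,B,R,G],[B,D,G,R,G,R],[G,B,R,B,R,D]],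
   [[R,D,B,G,D,B],[B,R,G,R,D,G],[G,B,R,D,B,R],[D,R,G,B,R,G],[B,G,D,R,G,R],[G,B,R,B,R,D]],
   [[R,G,B,G,D,B],[B,R,G,R,D,G],[G,B,R,D,B,R],[D,R,G,B,R,G],[B,D,D,R,G,R],[G,B,R,B,R,D]]]"
| "tp5 I4 = [[[G,R,D,R,D,B],[R,B,G,B,D,G],[B,G,R,D,G,R],[R,D,B,G,B,G],[D,B,G,B,G,R],[B,G,R,G,R,D]],
   [[G,R,B,R,D,B],[R,B,G,B,D,G],[B,G,R,D,G,R],[R,D,D,G,B,G],[D,B,G,B,G,R],[B,G,R,G,R,D]],
   [[G,R,B,R,D,B],[R,B,G,B,D,G],[B,G,R,D,G,R],[R,B,D,G,B,G],[D,D,G,B,G,R],[B,G,R,G,R,D]]]"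
| "tp5 I5 = [[[G,R,D,B,D,B],[D,B,G,R,B,G],[B,G,R,D,G,R],[R,D,B,G,B,G],[D,B,G,R,G,R],[B,G,R,G,R,D]],
   [[G,R,D,R,D,B],[R,B,G,D,B,G],[D,G,R,B,G,R],[R,D,B,G,B,G],[D,B,G,B,G,R],[B,G,R,G,R,D]],
   [[G,R,B,R,D,B],[R,B,G,D,B,G],[D,G,R,B,G,R],[R,D,D,G,B,G],[D,B,G,B,G,R],[B,G,R,G,R,D]],
   [[G,R,B,R,D,B],[R,B,G,D,B,G],[D,G,R,B,G,R],[R,B,D,G,B,G],[D,D,G,B,G,R],[B,G,R,G,R,D]],
   [[G,R,D,R,D,B],[R,B,G,D,B,G],[B,G,R,D,G,R],[R,D,B,G,B,G],[D,B,G,B,G,R],[B,G,R,G,R,D]],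
   [[G,R,B,R,D,B],[R,B,G,D,B,G],[B,G,R,D,G,R],[R,D,D,G,B,G],[D,B,G,B,G,R],[B,G,R,G,R,D]],
   [[G,R,B,R,D,B],[R,B,G,D,B,G],[B,G,R,D,G,R],[R,B,D,G,B,G],[D,D,G,B,G,R],[B,G,R,G,R,D]],
   [[G,R,D,B,D,B],[R,B,G,D,B,G],[B,G,R,D,G,R],[R,D,B,G,B,G],[D,B,G,R,G,R],[B,G,R,G,R,D]],
   [[G,R,D,B,D,B],[R,B,G,D,B,G],[B,G,D,R,G,R],[R,D,B,G,B,G],[D,B,G,R,G,R],[B,G,R,G,R,D]]]"

primrec tp6 :: "ix \<Rightarrow> col list list list" where
 "tp6 I0 = [[[R,G,B,D,G,B],[B,R,G,R,D,G],[G,B,R,B,D,R],[B,R,D,G,R,G],[D,D,G,R,B,R],[G,B,R,B,R,D]],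
   [[R,G,B,D,G,B],[B,R,G,R,D,G],[G,B,R,B,D,R],[B,R,D,G,R,G],[D,B,G,R,B,R],[G,D,R,B,R,D]]]"
| "tp6 I1 = [[[R,D,G,D,G,B],[D,R,B,R,B,G],[G,B,R,B,D,R],[D,R,B,G,R,G],[G,B,D,R,B,R],[B,G,R,G,R,D]],
   [[R,D,G,B,G,B],[D,R,B,R,B,G],[G,B,R,D,D,R],[D,R,B,G,R,G],[G,B,D,R,B,R],[B,G,R,G,R,D]],
   [[R,D,G,D,G,B],[D,R,B,R,B,G],[G,B,R,B,D,R],[B,R,D,G,R,G],[D,G,B,R,B,R],[G,B,R,B,R,D]],
   [[R,G,B,D,G,B],[D,R,G,R,B,G],[G,B,R,B,D,R],[B,R,D,G,R,G],[D,D,G,R,B,R],[G,B,R,B,R,D]],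
   [[R,G,B,D,G,B],[D,R,G,R,B,G],[G,B,R,B,D,R],[B,R,D,G,R,G],[D,B,G,R,B,R],[G,D,R,B,R,D]],
   [[R,D,G,D,G,B],[D,R,B,G,B,G],[G,B,R,B,D,R],[B,R,D,G,R,G],[D,G,B,R,B,R],[G,B,R,B,R,D]],
   [[R,D,B,D,G,B],[D,R,G,R,B,G],[G,B,R,B,D,R],[B,R,D,G,R,G],[D,B,G,R,B,R],[B,G,R,G,R,D]],
   [[R,G,B,D,G,B],[D,R,G,R,B,G],[G,B,R,B,D,R],[B,R,D,G,R,G],[D,B,G,R,B,R],[B,D,R,G,R,D]],
   [[R,D,B,D,G,B],[D,R,G,R,B,G],[G,B,R,B,D,R],[B,R,G,D,R,G],[G,B,D,R,B,R],[B,G,R,G,R,D]],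
   [[R,G,B,D,G,B],[D,R,G,R,B,G],[G,B,R,B,D,R],[B,R,G,D,R,G],[G,B,D,R,B,R],[B,D,R,G,R,D]],
   [[R,D,G,D,G,B],[D,R,B,R,B,G],[G,B,R,B,D,R],[B,R,D,G,R,G],[G,B,D,R,B,R],[B,G,R,G,R,D]],
   [[R,D,G,D,G,B],[D,R,B,R,B,G],[G,B,R,B,D,R],[B,R,D,G,R,G],[G,D,B,R,B,R],[B,G,R,G,R,D]],
   [[R,D,B,D,G,B],[D,R,G,R,B,G],[G,B,R,B,D,R],[B,R,D,G,R,G],[G,B,D,R,B,R],[B,G,R,G,R,D]],
   [[R,G,B,D,G,B],[D,R,G,R,B,G],[G,B,R,B,D,R],[B,R,D,G,R,G],[G,B,D,R,B,R],[B,D,R,G,R,D]],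
   [[R,D,G,B,G,B],[D,R,B,R,B,G],[G,B,R,D,D,R],[B,R,D,G,R,G],[G,B,D,R,B,R],[B,G,R,G,R,D]],
   [[R,D,G,B,G,B],[D,R,B,R,B,G],[G,B,R,D,D,R],[B,R,D,G,R,G],[G,D,B,R,B,R],[B,G,R,G,R,D]],
   [[R,D,B,D,G,B],[D,R,G,R,B,G],[B,G,R,G,D,R],[D,R,G,B,R,G],[G,B,D,R,B,R],[B,G,R,G,R,D]],
   [[R,D,B,D,G,B],[D,B,G,R,B,G],[B,G,R,G,D,R],[D,R,G,B,R,G],[G,B,D,R,B,R],[B,G,R,G,R,D]],
   [[R,D,G,B,G,B],[D,R,B,R,B,G],[B,G,R,D,D,R],[D,R,B,G,R,G],[G,B,D,R,B,R],[B,G,R,G,R,D]],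
   [[R,D,G,B,G,B],[D,R,B,R,B,G],[B,G,R,G,D,R],[D,R,B,D,R,G],[G,B,D,R,B,R],[B,G,R,G,R,D]]]"
| "tp6 I2 = [[[R,D,G,B,D,B],[D,R,B,R,B,G],[B,G,R,D,G,R],[D,R,B,G,R,G],[G,B,D,R,B,R],[B,G,R,G,R,D]],
   [[G,R,D,B,D,B],[R,B,G,D,B,G],[D,G,B,R,G,R],[B,D,R,G,R,G],[D,B,G,R,B,R],[B,G,R,G,R,D]]]"
| "tp6 I3 = [[[R,D,G,B,G,B],[D,R,B,R,D,G],[G,B,R,D,B,R],[D,R,B,G,R,G],[G,B,D,R,B,R],[B,G,R,G,R,D]],
   [[R,D,G,B,G,B],[D,R,B,R,D,G],[G,B,R,D,B,R],[B,R,D,G,R,G],[G,B,D,R,B,R],[B,G,R,G,R,D]],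
   [[R,D,G,B,G,B],[D,R,B,R,D,G],[G,B,R,D,B,R],[B,R,D,G,R,G],[G,D,B,R,B,R],[B,G,R,G,R,D]],
   [[R,G,D,B,G,B],[B,R,G,R,D,G],[D,B,R,G,B,R],[B,R,G,D,R,G],[G,D,B,R,B,R],[D,B,R,G,R,D]],
   [[R,G,B,D,G,B],[B,R,G,R,D,G],[G,B,R,D,B,R],[B,R,D,G,R,G],[D,D,G,R,B,R],[G,B,R,B,R,D]],
   [[R,G,B,D,G,B],[B,R,G,R,D,G],[G,B,R,D,B,R],[B,R,D,G,R,G],[D,B,G,R,B,R],[G,D,R,B,R,D]],
   [[R,G,D,B,G,B],[B,R,G,R,D,G],[G,B,R,D,B,R],[B,R,G,D,R,G],[G,D,B,R,B,R],[D,B,R,G,R,D]],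
   [[R,G,D,B,G,B],[B,R,G,R,D,G],[G,B,R,D,B,R],[B,R,D,G,R,G],[G,D,B,R,B,R],[D,B,R,G,R,D]]]"
| "tp6 I4 = [[[G,R,B,D,R,B],[D,D,R,G,B,G],[B,G,D,R,G,R],[R,B,G,B,D,G],[B,G,R,G,D,R],[R,B,G,B,G,D]],
   [[G,R,B,D,R,B],[D,B,R,G,B,G],[B,G,D,R,G,R],[R,B,G,B,D,G],[B,G,R,G,D,R],[R,D,G,B,G,D]]]"
| "tp6 I5 = [[[R,G,D,G,D,B],[D,B,R,B,R,G],[G,D,B,R,B,R],[B,R,G,D,R,G],[G,B,R,B,D,R],[B,R,G,R,G,D]],
   [[R,G,B,G,D,B],[D,D,R,B,R,G],[G,B,D,R,B,R],[B,R,G,D,R,G],[G,B,R,B,D,R],[B,R,G,R,G,D]],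
   [[R,G,B,G,D,B],[D,B,R,B,R,G],[G,D,D,R,B,R],[B,R,G,D,R,G],[G,B,R,B,D,R],[B,R,G,R,G,D]]]"

primrec tp7 :: "ix \<Rightarrow> col list list list" where
 "tp7 I0 = [[[G,D,B,R,D,B],[B,R,D,G,R,G],[D,G,R,B,G,R],[R,B,G,D,B,G],[B,G,R,G,D,R],[R,B,G,B,G,D]],
   [[G,R,B,R,D,B],[B,D,D,G,R,G],[D,G,R,B,G,R],[R,B,G,D,B,G],[B,G,R,G,D,R],[R,B,G,B,G,D]],
   [[G,R,B,R,D,B],[B,D,R,G,R,G],[D,G,D,B,G,R],[R,B,G,D,B,G],[B,G,R,G,D,R],[R,B,G,B,G,D]]]"
| "tp7 I1 = [[[G,R,B,D,R,B],[D,D,R,G,B,G],[B,G,D,R,G,R],[R,B,G,D,B,G],[B,G,R,G,D,R],[R,B,G,B,G,D]],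
   [[G,R,B,D,R,B],[D,B,R,G,B,G],[B,G,D,R,G,R],[R,B,G,D,B,G],[B,G,R,G,D,R],[R,D,G,B,G,D]],
   [[G,D,R,B,R,B],[R,B,D,G,B,G],[D,G,B,R,G,R],[R,B,G,D,B,G],[D,G,B,G,D,R],[B,R,G,R,G,D]],
   [[G,R,D,B,R,B],[R,D,B,G,B,G],[B,G,R,D,G,R],[D,B,G,R,B,G],[B,G,R,G,D,R],[D,B,G,R,G,D]],
   [[G,D,R,B,R,B],[R,B,D,G,B,G],[B,G,D,R,G,R],[R,B,G,D,B,G],[D,G,B,G,D,R],[B,R,G,R,G,D]],
   [[G,D,R,B,R,B],[R,D,B,G,B,G],[B,G,D,R,G,R],[R,B,G,D,B,G],[D,G,B,G,D,R],[B,R,G,R,G,D]],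
   [[G,R,D,B,R,B],[R,D,B,G,B,G],[B,G,R,D,G,R],[R,B,G,D,B,G],[B,G,R,G,D,R],[D,B,G,R,G,D]],
   [[G,R,D,B,R,B],[R,D,B,G,B,G],[B,G,D,R,G,R],[R,B,G,D,B,G],[B,G,R,G,D,R],[D,B,G,R,G,D]]]"
| "tp7 I2 = [[[G,D,R,D,R,B],[D,R,B,G,B,G],[B,G,D,R,G,R],[R,B,G,B,D,G],[D,G,B,R,B,R],[R,B,G,B,G,D]],
   [[G,D,R,D,R,B],[D,R,B,G,B,G],[B,G,D,R,G,R],[R,B,G,B,D,G],[D,G,B,G,B,R],[R,B,G,B,G,D]],
   [[G,R,B,D,R,B],[D,D,R,G,B,G],[B,G,D,R,G,R],[R,B,G,B,D,G],[D,G,R,G,B,R],[R,B,G,B,G,D]],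
   [[G,R,B,D,R,B],[D,B,R,G,B,G],[B,G,D,R,G,R],[R,B,G,B,D,G],[D,G,R,G,B,R],[R,D,G,B,G,D]],
   [[G,D,B,D,R,B],[D,B,R,G,B,G],[B,G,D,R,G,R],[R,B,G,B,D,G],[D,G,R,G,B,R],[B,R,G,R,G,D]],
   [[G,R,B,D,R,B],[D,B,R,G,B,G],[B,G,D,R,G,R],[R,B,G,B,D,G],[D,G,R,G,B,R],[B,D,G,R,G,D]],
   [[G,D,R,D,R,B],[R,B,D,G,B,G],[D,G,B,R,G,R],[R,B,G,B,D,G],[D,G,B,G,B,R],[B,R,G,R,G,D]],
   [[G,D,R,B,R,B],[R,B,D,G,B,G],[D,G,B,R,G,R],[R,B,G,D,D,G],[D,G,B,G,B,R],[B,R,G,R,G,D]],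
   [[G,D,B,D,R,B],[R,B,D,G,B,G],[D,G,R,B,G,R],[B,R,G,R,D,G],[D,G,R,G,B,R],[B,R,G,R,G,D]],
   [[G,D,B,D,R,B],[R,B,D,G,B,G],[D,G,R,B,G,R],[B,R,G,R,D,G],[D,B,R,G,B,R],[B,R,G,R,G,D]],
   [[G,D,R,B,R,B],[R,B,D,G,B,G],[D,G,B,D,G,R],[B,R,G,R,D,G],[D,G,B,G,B,R],[B,R,G,R,G,D]],
   [[G,D,R,B,R,B],[R,B,D,G,B,G],[D,G,B,R,G,R],[B,R,G,D,D,G],[D,G,B,G,B,R],[B,R,G,R,G,D]],
   [[G,D,B,D,R,B],[R,B,D,G,B,G],[B,G,R,D,G,R],[R,B,G,B,D,G],[D,G,R,G,B,R],[B,R,G,R,G,D]],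
   [[G,R,B,D,R,B],[R,B,D,G,B,G],[B,G,R,D,G,R],[R,B,G,B,D,G],[D,G,R,G,B,R],[B,D,G,R,G,D]],
   [[G,D,R,D,R,B],[R,B,D,G,B,G],[B,G,D,R,G,R],[R,B,G,B,D,G],[D,G,B,G,B,R],[B,R,G,R,G,D]],
   [[G,D,R,D,R,B],[R,D,B,G,B,G],[B,G,D,R,G,R],[R,B,G,B,D,G],[D,G,B,G,B,R],[B,R,G,R,G,D]],
   [[G,D,B,D,R,B],[R,B,D,G,B,G],[B,G,D,R,G,R],[R,B,G,B,D,G],[D,G,R,G,B,R],[B,R,G,R,G,D]],
   [[G,R,B,D,R,B],[R,B,D,G,B,G],[B,G,D,R,G,R],[R,B,G,B,D,G],[D,G,R,G,B,R],[B,D,G,R,G,D]],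
   [[G,D,R,B,R,B],[R,B,D,G,B,G],[B,G,D,R,G,R],[R,B,G,D,D,G],[D,G,B,G,B,R],[B,R,G,R,G,D]],
   [[G,D,R,B,R,B],[R,D,B,G,B,G],[B,G,D,R,G,R],[R,B,G,D,D,G],[D,G,B,G,B,R],[B,R,G,R,G,D]]]"
| "tp7 I3 = [[[R,D,B,G,D,B],[D,B,R,B,R,G],[B,G,D,R,G,R],[D,R,G,B,R,G],[G,B,R,D,B,R],[B,R,G,R,G,D]],
   [[R,G,B,G,D,B],[D,B,R,B,R,G],[B,D,D,R,G,R],[D,R,G,B,R,G],[G,B,R,D,B,R],[B,R,G,R,G,D]],
   [[R,G,B,G,D,B],[D,B,R,B,R,G],[B,D,G,R,G,R],[D,R,D,B,R,G],[G,B,R,D,B,R],[B,R,G,R,G,D]],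
   [[R,G,D,B,D,B],[D,B,R,G,R,G],[B,D,G,R,G,R],[D,R,B,G,R,G],[G,B,R,D,B,R],[B,R,G,R,G,D]],
   [[G,D,B,R,D,B],[B,R,D,G,R,G],[D,G,R,B,G,R],[B,R,G,D,R,G],[D,G,R,G,B,R],[R,B,G,B,G,D]],
   [[G,D,B,R,D,B],[B,R,D,G,R,G],[D,B,R,B,G,R],[B,R,G,D,R,G],[D,G,R,G,B,R],[R,B,G,B,G,D]]]"
| "tp7 I4 = [[[R,G,D,B,D,B],[D,B,R,G,B,G],[B,D,G,R,G,R],[D,R,B,G,R,G],[G,B,R,D,B,R],[B,R,G,R,G,D]],
   [[G,D,R,B,D,B],[R,B,D,G,B,G],[D,G,B,R,G,R],[B,R,G,D,R,G],[D,G,B,G,B,R],[B,R,G,R,G,D]]]"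
| "tp7 I5 = [[[R,G,D,G,D,B],[D,B,R,B,R,G],[G,D,B,R,B,R],[D,R,G,B,R,G],[G,B,R,D,B,R],[B,R,G,R,G,D]],
   [[R,G,B,G,D,B],[D,D,R,B,R,G],[G,B,D,R,B,R],[D,R,G,B,R,G],[G,B,R,D,B,R],[B,R,G,R,G,D]],
   [[R,G,B,G,D,B],[D,B,R,B,R,G],[G,D,D,R,B,R],[D,R,G,B,R,G],[G,B,R,D,B,R],[B,R,G,R,G,D]],
   [[R,G,D,B,D,B],[D,B,R,G,R,G],[G,D,B,R,B,R],[B,R,G,D,R,G],[D,B,R,G,B,R],[B,R,G,R,G,D]],
   [[R,G,D,G,D,B],[D,B,R,B,R,G],[G,D,B,R,B,R],[B,R,G,D,R,G],[G,B,R,D,B,R],[B,R,G,R,G,D]],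
   [[R,G,B,G,D,B],[D,D,R,B,R,G],[G,B,D,R,B,R],[B,R,G,D,R,G],[G,B,R,D,B,R],[B,R,G,R,G,D]],
   [[R,G,B,G,D,B],[D,B,R,B,R,G],[G,D,D,R,B,R],[B,R,G,D,R,G],[G,B,R,D,B,R],[B,R,G,R,G,D]],
   [[R,G,D,B,D,B],[D,B,R,G,R,G],[G,D,B,R,B,R],[B,R,G,D,R,G],[G,B,R,D,B,R],[B,R,G,R,G,D]],
   [[R,G,D,B,D,B],[D,B,R,G,R,G],[G,D,B,R,B,R],[B,R,D,G,R,G],[G,B,R,D,B,R],[B,R,G,R,G,D]]]"

primrec tp8 :: "ix \<Rightarrow> col list list list" where
 "tp8 I0 = [[[R,G,D,B,G,B],[D,B,R,G,R,G],[G,D,B,R,B,R],[B,R,G,D,R,G],[D,B,R,G,D,R],[G,R,B,R,B,D]],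
   [[R,G,B,D,G,B],[B,D,R,G,R,G],[D,B,G,R,B,R],[B,R,D,G,R,G],[G,B,R,B,D,R],[D,R,G,R,B,D]],
   [[R,D,G,B,G,B],[B,D,R,G,R,G],[G,B,D,R,B,R],[D,R,B,D,R,G],[B,G,R,G,D,R],[G,R,B,R,B,D]],
   [[R,D,G,B,G,B],[B,D,R,G,R,G],[G,B,D,R,B,R],[D,R,B,G,R,G],[B,G,R,D,D,R],[G,R,B,R,B,D]],
   [[R,G,D,B,G,B],[B,D,R,G,R,G],[G,B,D,R,B,R],[B,R,G,D,R,G],[D,B,R,G,D,R],[G,R,B,R,B,D]],
   [[R,G,D,B,G,B],[B,D,R,G,R,G],[G,D,B,R,B,R],[B,R,G,D,R,G],[D,B,R,G,D,R],[G,R,B,R,B,D]],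
   [[R,G,B,D,G,B],[B,D,R,G,R,G],[G,B,D,R,B,R],[B,R,G,D,R,G],[G,B,R,B,D,R],[D,R,G,R,B,D]],
   [[R,G,B,D,G,B],[B,D,R,G,R,G],[G,B,D,R,B,R],[B,R,D,G,R,G],[G,B,R,B,D,R],[D,R,G,R,B,D]]]"
| "tp8 I1 = [[[R,D,G,B,D,B],[D,B,R,G,R,G],[B,G,D,R,G,R],[D,R,B,G,R,G],[B,G,R,D,G,R],[G,R,B,R,B,D]],
   [[G,D,R,B,D,B],[B,R,G,D,R,G],[D,G,B,R,G,R],[B,R,D,G,R,G],[D,B,G,R,G,R],[R,G,B,G,B,D]]]"
| "tp8 I2 = [[[R,G,D,G,D,B],[D,B,R,B,R,G],[G,D,B,R,B,R],[B,R,G,D,R,G],[D,B,R,B,G,R],[G,R,B,R,B,D]],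
   [[R,G,D,G,D,B],[D,B,G,B,R,G],[G,D,B,R,B,R],[B,R,G,D,R,G],[D,B,R,B,G,R],[G,R,B,R,B,D]],
   [[R,D,G,B,D,B],[B,D,R,G,R,G],[G,B,D,R,B,R],[D,R,B,G,R,G],[B,G,R,D,G,R],[G,R,B,R,B,D]],
   [[G,D,R,B,D,B],[B,R,G,D,R,G],[D,G,B,R,B,R],[B,R,D,G,R,G],[D,B,G,R,G,R],[R,G,B,G,B,D]]]"
| "tp8 I3 = [[[G,R,D,B,R,B],[D,B,G,R,D,G],[B,G,R,D,G,R],[R,D,B,G,B,G],[D,B,G,R,G,R],[R,G,B,G,B,D]],
   [[G,R,D,B,R,B],[D,B,G,R,D,G],[B,G,R,D,G,R],[R,B,D,G,B,G],[B,D,G,R,G,R],[R,G,B,G,B,D]],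
   [[G,R,D,B,R,B],[D,B,G,R,D,G],[B,G,R,D,G,R],[R,D,B,G,B,G],[B,D,G,R,G,R],[R,G,B,G,B,D]],
   [[G,R,B,D,R,B],[R,B,G,B,D,G],[B,G,D,R,G,R],[D,B,R,G,B,G],[B,D,G,R,G,R],[D,G,R,G,B,D]],
   [[G,R,B,D,R,B],[R,B,G,B,D,G],[B,G,R,D,G,R],[R,B,D,G,B,G],[B,D,G,R,G,R],[D,G,R,G,B,D]],
   [[G,R,B,D,R,B],[R,B,G,B,D,G],[B,G,D,R,G,R],[R,B,D,G,B,G],[B,D,G,R,G,R],[D,G,R,G,B,D]],
   [[G,D,R,B,R,B],[B,R,G,D,D,G],[D,G,B,R,G,R],[R,B,D,G,B,G],[B,D,G,R,G,R],[R,G,B,G,B,D]],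
   [[G,D,R,B,R,B],[B,R,G,R,D,G],[D,G,B,D,G,R],[R,B,D,G,B,G],[B,D,G,R,G,R],[R,G,B,G,B,D]]]"
| "tp8 I4 = [[[R,D,G,B,D,B],[D,B,R,G,R,G],[B,G,D,R,G,R],[D,R,B,G,B,G],[B,G,R,D,G,R],[G,R,B,R,B,D]],
   [[G,R,D,R,D,B],[D,B,G,B,R,G],[B,G,R,D,G,R],[R,D,B,G,B,G],[D,B,R,B,G,R],[R,G,B,G,B,D]],
   [[G,R,D,R,D,B],[D,B,G,B,R,G],[B,G,R,D,G,R],[R,D,B,G,B,G],[D,B,G,B,G,R],[R,G,B,G,B,D]],
   [[G,D,R,B,D,B],[B,R,G,D,R,G],[D,G,B,R,G,R],[R,B,D,G,B,G],[B,D,G,R,G,R],[R,G,B,G,B,D]]]"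
| "tp8 I5 = [[[R,B,G,B,G,D],[G,R,B,R,D,B],[D,G,R,D,B,R],[B,R,D,G,R,G],[G,D,B,R,B,R],[B,G,R,G,R,D]],
   [[R,B,D,B,G,D],[G,R,B,R,D,B],[D,G,R,G,B,R],[B,R,G,D,R,G],[G,D,B,R,B,R],[B,G,R,G,R,D]],
   [[R,B,G,B,G,D],[G,R,B,R,D,B],[D,G,R,G,B,R],[B,R,D,D,R,G],[G,D,B,R,B,R],[B,G,R,G,R,D]]]"

primrec tp9 :: "ix \<Rightarrow> col list list list" where
 "tp9 I0 = [[[R,G,B,D,B,D],[G,D,R,B,R,B],[D,B,G,R,G,R],[B,R,D,G,R,G],[G,B,R,B,D,R],[B,R,G,R,G,D]],
   [[R,G,B,G,B,D],[G,D,R,B,R,B],[D,B,D,R,G,R],[B,R,G,D,R,G],[G,B,R,B,D,R],[B,R,G,R,G,D]],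
   [[R,G,B,G,B,D],[G,D,R,B,R,B],[D,B,G,R,G,R],[B,R,D,D,R,G],[G,B,R,B,D,R],[B,R,G,R,G,D]]]"
| "tp9 I1 = [[[G,R,B,D,B,D],[R,D,G,B,G,B],[D,B,R,G,R,G],[B,G,D,R,G,R],[R,B,G,B,D,G],[B,G,R,G,D,R]],
   [[G,R,B,R,B,D],[R,D,G,B,G,B],[D,B,D,G,R,G],[B,G,R,D,G,R],[R,B,G,B,D,G],[B,G,R,G,D,R]],
   [[G,R,B,R,B,D],[R,D,G,B,G,B],[D,B,R,G,R,G],[B,G,D,D,G,R],[R,B,G,B,D,G],[B,G,R,G,D,R]]]"
| "tp9 I2 = [[[G,R,B,D,R,D],[R,D,G,B,G,B],[D,B,R,G,B,G],[B,G,D,R,G,R],[R,B,G,B,D,G],[B,G,R,G,D,R]]]"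
| "tp9 I3 = [[[R,G,B,D,B,D],[D,R,G,R,G,B],[B,D,R,G,R,G],[D,B,G,R,G,R],[B,R,D,G,R,G],[G,B,R,B,D,R]],
   [[R,G,B,D,B,D],[D,R,G,R,G,B],[B,D,R,G,R,G],[D,B,G,B,G,R],[B,R,D,G,R,G],[G,B,R,B,D,R]],
   [[G,R,B,D,B,D],[R,D,G,B,G,B],[D,B,R,G,R,G],[B,G,D,R,G,R],[D,B,G,B,R,G],[B,G,R,G,D,R]],
   [[G,B,D,R,B,D],[R,D,G,B,G,B],[D,R,B,G,R,G],[B,G,R,D,G,R],[D,R,G,B,R,G],[B,G,R,G,D,R]],
   [[G,R,B,R,B,D],[R,D,G,B,G,B],[D,B,D,G,R,G],[B,G,R,D,G,R],[D,B,G,B,R,G],[B,G,R,G,D,R]],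
   [[G,R,B,R,B,D],[R,D,G,B,G,B],[D,B,R,G,R,G],[B,G,D,D,G,R],[D,B,G,B,R,G],[B,G,R,G,D,R]]]"
| "tp9 I4 = [[[G,B,D,B,R,D],[D,R,G,R,G,B],[R,D,B,G,B,G],[B,G,R,D,G,R],[D,R,G,R,B,G],[B,G,R,G,D,R]],
   [[G,B,D,B,R,D],[D,R,G,R,G,B],[R,D,B,G,B,G],[B,G,R,D,G,R],[D,R,B,R,B,G],[B,G,R,G,D,R]],
   [[G,R,B,D,R,D],[R,D,G,B,G,B],[D,B,R,G,B,G],[B,G,D,R,G,R],[R,B,G,D,B,G],[B,G,R,G,D,R]],
   [[B,R,G,D,R,D],[D,G,B,R,G,B],[R,B,D,G,B,G],[D,G,R,B,G,R],[R,D,B,G,B,G],[G,B,R,B,D,R]]]"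
| "tp9 I5 = [[[R,G,B,D,B,D],[G,D,R,B,R,B],[B,R,G,R,D,G],[G,B,R,B,D,R],[B,R,D,G,R,G],[D,B,G,R,G,R]],
   [[R,G,B,G,B,D],[G,D,R,B,R,B],[B,R,G,R,D,G],[G,B,R,B,D,R],[B,R,D,D,R,G],[D,B,G,R,G,R]],
   [[R,G,B,G,B,D],[G,D,R,B,R,B],[B,R,G,R,D,G],[G,B,R,B,D,R],[B,R,G,D,R,G],[D,B,D,R,G,R]]]"

primrec tp10 :: "ix \<Rightarrow> col list list list" where
 "tp10 I0 = [[[R,G,B,D,B,D],[G,D,R,B,R,B],[B,R,G,R,D,G],[D,B,R,B,G,R],[B,R,D,G,R,G],[D,B,G,R,G,R]],
   [[R,B,D,G,B,D],[G,D,R,B,R,B],[B,R,G,R,D,G],[D,G,R,B,G,R],[B,R,G,D,R,G],[D,G,B,R,G,R]],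
   [[R,G,B,G,B,D],[G,D,R,B,R,B],[B,R,G,R,D,G],[D,B,R,B,G,R],[B,R,D,D,R,G],[D,B,G,R,G,R]],
   [[R,G,B,G,B,D],[G,D,R,B,R,B],[B,R,G,R,D,G],[D,B,R,B,G,R],[B,R,G,D,R,G],[D,B,D,R,G,R]],
   [[G,R,B,D,B,D],[D,G,R,G,R,B],[R,B,G,B,D,G],[B,G,D,R,G,R],[D,B,R,G,R,G],[B,D,G,R,G,R]],
   [[G,R,B,D,B,D],[D,G,R,G,R,B],[R,B,G,B,D,G],[B,G,D,R,G,R],[D,B,R,B,R,G],[B,D,G,R,G,R]]]"
| "tp10 I1 = [[[R,B,G,D,B,D],[G,R,B,R,D,B],[B,D,R,G,R,G],[D,G,B,R,G,R],[B,R,D,G,R,G],[D,G,R,B,G,R]],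
   [[G,B,R,D,B,D],[R,G,B,G,D,B],[D,R,G,B,R,G],[B,G,D,R,G,R],[D,R,B,G,R,G],[B,D,G,R,G,R]]]"
| "tp10 I2 = [[[G,B,R,B,R,D],[R,G,B,G,D,B],[D,R,G,D,B,G],[B,G,D,R,G,R],[D,R,B,G,B,G],[B,D,G,R,G,R]],
   [[G,B,D,B,R,D],[R,G,B,G,D,B],[D,R,G,R,B,G],[B,G,R,D,G,R],[D,R,B,G,B,G],[B,D,G,R,G,R]],
   [[G,B,R,B,R,D],[R,G,B,G,D,B],[D,R,G,R,B,G],[B,G,D,D,G,R],[D,R,B,G,B,G],[B,D,G,R,G,R]],
   [[G,R,D,B,R,D],[R,G,B,G,D,B],[D,B,G,R,B,G],[B,G,R,D,G,R],[R,D,B,G,B,G],[D,B,G,R,G,R]],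
   [[G,B,R,B,R,D],[R,G,B,G,D,B],[D,R,G,D,B,G],[B,G,D,R,G,R],[R,D,B,G,B,G],[B,D,G,R,G,R]],
   [[G,R,D,B,R,D],[R,G,B,G,D,B],[D,B,G,R,B,G],[B,G,R,D,G,R],[R,B,D,G,B,G],[B,D,G,R,G,R]],
   [[G,R,D,B,R,D],[R,G,B,G,D,B],[D,B,G,R,B,G],[B,G,R,D,G,R],[R,D,B,G,B,G],[B,D,G,R,G,R]],
   [[G,B,D,B,R,D],[R,G,B,G,D,B],[D,R,G,R,B,G],[B,G,R,D,G,R],[R,D,B,G,B,G],[B,D,G,R,G,R]],
   [[G,B,R,B,R,D],[R,G,B,G,D,B],[D,R,G,R,B,G],[B,G,D,D,G,R],[R,D,B,G,B,G],[B,D,G,R,G,R]]]"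
| "tp10 I3 = [[[G,R,B,D,R,D],[R,D,G,B,G,B],[D,B,R,G,B,G],[B,G,D,R,G,R],[R,B,G,B,D,G],[D,G,R,G,B,R]],
   [[B,R,D,G,R,D],[D,G,R,B,G,B],[R,B,G,D,B,G],[D,G,B,R,G,R],[R,B,G,B,D,G],[G,D,B,R,B,R]]]"
| "tp10 I4 = [[[R,G,B,D,G,D],[G,D,R,B,R,B],[B,R,G,R,D,G],[G,B,R,B,D,R],[B,R,D,G,R,G],[D,B,G,R,B,R]]]"
| "tp10 I5 = [[[R,G,B,D,G,D],[G,D,R,B,R,B],[D,R,G,R,B,G],[G,B,R,B,D,R],[B,R,D,G,R,G],[D,B,G,R,B,R]],
   [[B,G,D,R,G,D],[D,R,G,B,R,B],[R,D,B,G,B,G],[G,B,R,B,D,R],[D,R,B,G,R,G],[G,B,R,D,B,R]]]"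

primrec tp11 :: "ix \<Rightarrow> col list list list" where
 "tp11 I0 = [[[R,B,D,B,G,D],[D,G,R,G,R,B],[B,R,G,R,D,G],[D,G,R,G,B,R],[B,R,G,D,R,G],[G,D,B,R,B,R]],
   [[R,B,D,B,G,D],[D,G,R,G,R,B],[B,R,G,R,D,G],[D,G,B,G,B,R],[B,R,G,D,R,G],[G,D,B,R,B,R]],
   [[R,G,B,D,G,D],[G,D,R,B,R,B],[B,R,G,R,D,G],[G,B,R,D,B,R],[B,R,D,G,R,G],[D,B,G,R,B,R]],
   [[B,G,R,D,G,D],[D,R,B,G,R,B],[R,B,G,B,D,G],[G,D,B,R,B,R],[D,R,G,B,R,G],[G,B,D,R,B,R]]]"
| "tp11 I1 = [[[R,G,D,B,G,D],[G,R,B,R,D,B],[D,B,R,G,R,G],[G,D,B,R,B,R],[B,R,G,D,R,G],[D,B,R,G,B,R]],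
   [[R,B,D,B,G,D],[G,R,B,R,D,B],[B,D,R,G,R,G],[D,G,B,R,B,R],[B,R,G,D,R,G],[D,G,R,G,B,R]],
   [[R,B,G,B,G,D],[G,R,B,R,D,B],[B,D,R,G,R,G],[D,G,B,R,B,R],[B,R,D,D,R,G],[D,G,R,G,B,R]],
   [[R,B,G,B,G,D],[G,R,B,R,D,B],[B,D,R,G,R,G],[D,G,B,R,B,R],[B,R,D,G,R,G],[D,G,R,D,B,R]],
   [[R,G,D,B,G,D],[G,R,B,R,D,B],[B,D,R,G,R,G],[G,B,D,R,B,R],[B,R,G,D,R,G],[D,B,R,G,B,R]],
   [[R,G,D,B,G,D],[G,R,B,R,D,B],[B,D,R,G,R,G],[G,D,B,R,B,R],[B,R,G,D,R,G],[D,B,R,G,B,R]],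
   [[R,B,D,B,G,D],[G,R,B,R,D,B],[B,D,R,G,R,G],[G,D,B,R,B,R],[B,R,G,D,R,G],[D,G,R,G,B,R]],
   [[R,B,G,B,G,D],[G,R,B,R,D,B],[B,D,R,G,R,G],[G,D,B,R,B,R],[B,R,D,D,R,G],[D,G,R,G,B,R]],
   [[R,B,G,B,G,D],[G,R,B,R,D,B],[B,D,R,G,R,G],[G,D,B,R,B,R],[B,R,D,G,R,G],[D,G,R,D,B,R]]]"
| "tp11 I2 = []"
| "tp11 I3 = []"
| "tp11 I4 = []"
| "tp11 I5 = []"

primrec tq0 :: "ix \<Rightarrow> ix \<Rightarrow> col list list list" where
 "tq0 I0 = tp0"
| "tq0 I1 = tp1"
| "tq0 I2 = tp2"
| "tq0 I3 = tp3"
| "tq0 I4 = tp4"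
| "tq0 I5 = tp5"

primrec tq1 :: "ix \<Rightarrow> ix \<Rightarrow> col list list list" where
 "tq1 I0 = tp6"
| "tq1 I1 = tp7"
| "tq1 I2 = tp8"
| "tq1 I3 = tp9"
| "tq1 I4 = tp10"
| "tq1 I5 = tp11"

text \<open>The argument is a result of \<open>table_entry\<close> and so has at most one element.
  Leading digits from \<open>I2\<close> on address nothing.\<close>

fun planes :: "entry list \<Rightarrow> col list list list" where
  "planes [] = []"
| "planes (T I0 i j # ts) = tq0 i j"
| "planes (T I1 i j # ts) = tq1 i j"
| "planes (T I2 i j # ts) = []"
| "planes (T I3 i j # ts) = []"
| "planes (T I4 i j # ts) = []"
| "planes (T I5 i j # ts) = []"

text \<open>
  The planes with seven deletions, indexed by two of their lines: those at \<open>I5\<close> and \<open>I0\<close> in \<open>tabH\<close>,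
  those at \<open>I0\<close> and \<open>I1\<close> in \<open>tabN\<close>. The first line is normalised up to symmetry and recolouring.
\<close>

definition tabH :: table where
 "tabH = [([B,R,G,R,D,D], []),
 ([B,G,R,D,R,D], [([R,B,G,B,G,D], T I0 I0 I0),
  ([D,B,G,B,G,R], T I0 I0 I1),
  ([G,D,B,R,B,R], T I0 I0 I2),
  ([R,B,G,B,D,G], T I0 I0 I3),
  ([R,B,D,G,B,G], T I0 I0 I4),
  ([R,D,B,G,B,G], T I0 I0 I5),
  ([G,R,B,R,D,B], T I0 I1 I0),
  ([D,R,G,R,G,B], T I0 I1 I1),
  ([D,R,B,R,G,B], T I0 I1 I2),
  ([D,R,G,B,G,B], T I0 I1 I3)]),
 ([D,G,R,G,R,D], []),
 ([B,G,R,G,R,D], [([R,B,G,B,G,D], T I0 I1 I4),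
  ([G,R,B,R,B,D], T I0 I1 I5),
  ([G,B,D,D,B,R], T I0 I2 I0),
  ([G,B,D,R,B,R], T I0 I2 I1),
  ([G,D,B,R,B,R], T I0 I2 I2),
  ([R,B,G,B,D,G], T I0 I2 I3),
  ([R,B,D,D,B,G], T I0 I2 I4),
  ([R,B,G,D,B,G], T I0 I2 I5),
  ([G,R,B,R,D,B], T I0 I3 I0),
  ([D,R,B,D,G,B], T I0 I3 I1),
  ([D,R,B,R,G,B], T I0 I3 I2),
  ([D,R,D,B,G,B], T I0 I3 I3),
  ([R,D,G,B,G,B], T I0 I3 I4),
  ([D,R,G,B,G,B], T I0 I3 I5)]),
 ([D,B,R,G,R,D], []),
 ([D,R,B,G,R,D], []),
 ([D,B,G,R,G,R], [])]"

definition tabN :: table where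
 "tabN = [([B,R,G,R,D,D], [([D,G,R,B,G,R], T I0 I4 I0),
  ([G,B,R,D,B,R], T I0 I4 I1),
  ([D,B,R,G,B,R], T I0 I4 I2),
  ([D,B,R,G,R,G], T I0 I4 I3),
  ([G,D,R,B,R,B], T I0 I4 I4),
  ([D,G,R,B,R,B], T I0 I4 I5)]),
 ([B,G,R,D,R,D], []),
 ([D,G,R,G,R,D], []),
 ([B,G,R,G,R,D], [([R,B,G,B,G,D], T I0 I5 I0),
  ([G,R,B,R,B,D], T I0 I5 I1),
  ([D,B,G,R,G,R], T I0 I5 I2),
  ([D,D,B,R,G,R], T I0 I5 I3),
  ([D,D,G,B,G,R], T I0 I5 I4),
  ([D,B,G,B,G,R], T I0 I5 I5),
  ([G,D,D,R,B,R], T I1 I0 I0),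
  ([G,B,D,R,B,R], T I1 I0 I1),
  ([D,B,G,R,B,R], T I1 I0 I2),
  ([G,D,B,R,B,R], T I1 I0 I3),
  ([R,B,G,D,D,G], T I1 I0 I4),
  ([D,R,B,R,D,G], T I1 I0 I5),
  ([D,R,G,B,D,G], T I1 I1 I0),
  ([R,B,G,B,D,G], T I1 I1 I1),
  ([R,B,G,D,B,G], T I1 I1 I2),
  ([D,R,G,R,B,G], T I1 I1 I3),
  ([D,B,G,R,B,G], T I1 I1 I4),
  ([D,R,B,R,B,G], T I1 I1 I5),
  ([G,R,B,R,D,B], T I1 I2 I0),
  ([D,R,G,R,G,B], T I1 I2 I1),
  ([D,R,B,R,G,B], T I1 I2 I2),
  ([R,D,G,B,G,B], T I1 I2 I3),
  ([D,R,G,B,G,B], T I1 I2 I4)]),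
 ([D,B,R,G,R,D], [([G,D,B,R,B,R], T I1 I2 I5),
  ([B,R,G,R,D,G], T I1 I3 I0)]),
 ([D,R,B,G,R,D], []),
 ([D,B,G,R,G,R], [([B,G,R,G,D,D], T I1 I3 I1),
  ([R,G,B,G,D,D], T I1 I3 I2),
  ([B,G,R,G,R,D], T I1 I3 I3),
  ([R,G,B,G,B,D], T I1 I3 I4),
  ([B,R,D,D,R,G], T I1 I3 I5),
  ([B,R,D,G,R,G], T I1 I4 I0),
  ([B,D,R,G,R,G], T I1 I4 I1),
  ([R,D,B,G,B,G], T I1 I4 I2),
  ([R,G,B,G,D,B], T I1 I4 I3),
  ([G,R,D,D,R,B], T I1 I4 I4),
  ([G,R,B,D,R,B], T I1 I4 I5),
  ([G,R,D,B,R,B], T I1 I5 I0),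
  ([G,D,R,B,R,B], T I1 I5 I1)])]"

text \<open>Orbit representatives of the words with one or two deletions: one word each for a
  deleted rim vertex, a deleted hub, two adjacent and two non-adjacent deleted rim vertices, and
  three for hub and rim vertex, according to the colour pattern abab, abac or abca on the remaining
  path.\<close>

definition keys :: "col list list" where
  "keys = [[B,R,G,R,D,D], [B,G,R,D,R,D], [D,G,R,G,R,D], [B,G,R,G,R,D], [D,B,R,G,R,D], [D,R,B,G,R,D], [D,B,G,R,G,R]]"

text \<open>The key lines run across the stored lists: planes are stored transposed. A symmetry of
  the known lines then permutes the outer list, and the search receives planes as lists of
  columns.\<close>

definition in_tabH :: "col list list \<Rightarrow> bool" where
  "in_tabH P = mem_plane (transp P) (planes (table_entry (sel I0 P) (table_row (sel I5 P) tabH)))"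
definition in_tabN :: "col list list \<Rightarrow> bool" where
  "in_tabN P = mem_plane (transp P) (planes (table_entry (sel I1 P) (table_row (sel I0 P) tabN)))"

fun allin :: "(col list list \<Rightarrow> bool) \<Rightarrow> col list list list \<Rightarrow> bool" where
  "allin f [] = True" | "allin f (P # Ps) = (f P \<and> allin f Ps)"

fun table_complete :: "(col list list \<Rightarrow> bool) \<Rightarrow> ix \<Rightarrow> col list list \<Rightarrow> bool" where
  "table_complete f p [] = True"
| "table_complete f p (k # ks) = (allin f (gen_planes fuel7 [] (fixed_line p k (excess k) # lines_beside p k indices)) \<and> table_complete f p ks)"

section \<open>The search\<close>

text \<open>
  \<open>X i\<close> and \<open>Y j\<close> name the planes with first coordinate \<open>i\<close> and second coordinate \<open>j\<close>; a plane is the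
  list of its columns along the third coordinate.
\<close>

datatype key = X ix | Y ix

type_synonym plane = "col list list"
type_synonym undecided = "(key \<times> plane list) list"
type_synonym decided = "(key \<times> plane) list"
type_synonym open_row = "ix \<times> nat \<times> (ix \<times> cells) list"

section \<open>Narrowing of candidates and choice of the branching plane\<close>

fun filter_adjacent :: "bool \<Rightarrow> plane \<Rightarrow> plane list \<Rightarrow> plane list" where
  "filter_adjacent False p ps = ps"
| "filter_adjacent True p [] = []"
| "filter_adjacent True p (q # ps) = keep (compat_plane p q) q (filter_adjacent True p ps)"

fun filter_crossing :: "ix \<Rightarrow> col list \<Rightarrow> plane list \<Rightarrow> plane list" where
  "filter_crossing i w [] = []"
| "filter_crossing i w (q # ps) = keep (eq_word w (sel i q)) q (filter_crossing i w ps)"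

text \<open>Parallel planes constrain each other only at adjacent indices; crossing planes must
  agree on their common column.\<close>

fun filter_candidates :: "key \<Rightarrow> key \<Rightarrow> plane \<Rightarrow> plane list \<Rightarrow> plane list" where
  "filter_candidates (X i) (X j) p ps = filter_adjacent (adj i j) p ps"
| "filter_candidates (Y i) (Y j) p ps = filter_adjacent (adj i j) p ps"
| "filter_candidates (X i) (Y j) p ps = filter_crossing i (sel j p) ps"
| "filter_candidates (Y i) (X j) p ps = filter_crossing i (sel j p) ps"

fun filter_undecided :: "key \<Rightarrow> plane \<Rightarrow> undecided \<Rightarrow> undecided" where
  "filter_undecided k p [] = []"
| "filter_undecided k p ((k', ps) # us) = (k', filter_candidates k k' p ps) # filter_undecided k p us"

fun shorter :: "'a list \<Rightarrow> 'b list \<Rightarrow> bool" where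
  "shorter xs [] = False" | "shorter [] (y # ys) = True" | "shorter (x # xs) (y # ys) = shorter xs ys"

text \<open>Branching on a plane with fewest candidates keeps the tree small.\<close>

fun pick :: "key \<times> plane list \<Rightarrow> undecided \<Rightarrow> undecided \<Rightarrow> (key \<times> plane list) \<times> undecided"
and pickk :: "bool \<Rightarrow> key \<times> plane list \<Rightarrow> key \<times> plane list \<Rightarrow> undecided \<Rightarrow> undecided \<Rightarrow> (key \<times> plane list) \<times> undecided" where
  "pick u [] acc = (u, acc)"
| "pick (k, ps) ((k', qs) # us) acc = pickk (shorter qs ps) (k, ps) (k', qs) us acc"
| "pickk True u v us acc = pick v us (u # acc)"
| "pickk False u v us acc = pick u us (v # acc)"

fun charged_xs :: "key list \<Rightarrow> ix list" where
  "charged_xs [] = []" | "charged_xs (X i # ks) = i # charged_xs ks" | "charged_xs (Y i # ks) = charged_xs ks"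
fun charged_ys :: "key list \<Rightarrow> ix list" where
  "charged_ys [] = []" | "charged_ys (Y i # ks) = i # charged_ys ks" | "charged_ys (X i # ks) = charged_ys ks"

fun at_most_two :: "ix list \<Rightarrow> bool" where
  "at_most_two (a # b # c # xs) = False" | "at_most_two [] = True" | "at_most_two [a] = True" | "at_most_two [a, b] = True"

text \<open>The list holds the planes charged earlier; a third one per direction exhausts the
  surplus of 3.\<close>

fun may_charge :: "key \<Rightarrow> key list \<Rightarrow> bool" where
  "may_charge (X i) ch = at_most_two (charged_xs ch)"
| "may_charge (Y i) ch = at_most_two (charged_ys ch)"

text \<open>The flag says whether the known layers are \<open>I5\<close> and \<open>I0\<close>, or \<open>I0\<close> and \<open>I1\<close>.\<close>

type_synonym base = "bool \<times> plane \<times> plane"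

datatype K = K col col col
fun recolour :: "K \<Rightarrow> col \<Rightarrow> col" where
  "recolour k D = D" | "recolour (K a b c) R = a" | "recolour (K a b c) G = b" | "recolour (K a b c) B = c"

text \<open>
  \<open>Hint f k h m w\<close>: applying the permutation \<open>f\<close> and the recolouring \<open>k\<close> turns a line into the
  canonical word \<open>w\<close>; \<open>h\<close> and \<open>m\<close> are their inverses.
\<close>

datatype hint = Hint "ix list" K "ix list" K "col list"

text \<open>
  \<open>Main\<close> holds the undecided planes with their candidates, the decided planes and the charged ones.
  In \<open>Leaf c s t rs\<close> every plane is decided or charged: \<open>c\<close> bounds the excess (deletions minus one,
  summed over columns) of each charged \<open>X\<close>-plane, \<open>s\<close> that of all of them, \<open>t\<close> is the excess used so
  far, and \<open>rs\<close> lists the open columns of each charged plane.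
\<close>

datatype state =
    Main base undecided decided "key list"
  | Leaf nat nat nat "open_row list"

text \<open>A column with known entries \<open>a\<close> and \<open>b\<close> at the two layers. The
  adjacencies of \<open>I5\<close>, \<open>I0\<close> and of \<open>I0\<close>, \<open>I1\<close>
  are written out; in the hub case \<open>f\<close> already forbids \<open>a\<close> on the
  rim.\<close>

fun base_cells :: "bool \<Rightarrow> col \<Rightarrow> col \<Rightarrow> palette \<Rightarrow> cells" where
  "base_cells True a b f =
    [(I5, only a), (I4, forbid b f), (I3, f), (I2, f), (I1, forbid b f), (I0, only b)]"
| "base_cells False a b f =
    [(I5, forbid a (forbid b f)), (I4, forbid a f), (I3, f), (I2, forbid b f), (I1, only b), (I0, only a)]"

fun base_palette :: "bool \<Rightarrow> col \<Rightarrow> palette" where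
  "base_palette True a = forbid a (Forbid False False False False)"
| "base_palette False a = Forbid False False False False"

fun base_column :: "base \<Rightarrow> ix \<Rightarrow> ix \<Rightarrow> cells" where
  "base_column (h, P, Q) x y = base_cells h (sel y (sel x P)) (sel y (sel x Q)) (base_palette h (sel y (sel x P)))"

fun forbid_neighbours :: "ix \<Rightarrow> ix \<Rightarrow> decided \<Rightarrow> cells \<Rightarrow> cells" where
  "forbid_neighbours x y [] cs = cs"
| "forbid_neighbours x y ((X i, p) # fx) cs = forbid_neighbours x y fx (forbid_word_if (adj i x) (sel y p) cs)"
| "forbid_neighbours x y ((Y j, p) # fx) cs = forbid_neighbours x y fx (forbid_word_if (adj j y) (sel x p) cs)"

fun row_cells :: "base \<Rightarrow> decided \<Rightarrow> ix \<Rightarrow> ix list \<Rightarrow> (ix \<times> cells) list" where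
  "row_cells A fx x [] = []"
| "row_cells A fx x (y # ys) = (y, forbid_neighbours x y fx (base_column A x y)) # row_cells A fx x ys"

section \<open>Excess accounting for the charged planes\<close>

fun used_excess :: "ix \<Rightarrow> decided \<Rightarrow> nat" where
  "used_excess x [] = 0"
| "used_excess x ((X i, p) # fx) = used_excess x fx"
| "used_excess x ((Y j, p) # fx) = excess (sel x p) + used_excess x fx"

fun open_rows :: "base \<Rightarrow> decided \<Rightarrow> ix list \<Rightarrow> ix list \<Rightarrow> open_row list" where
  "open_rows A fx [] ys = []"
| "open_rows A fx (x # xs) ys = (x, used_excess x fx, row_cells A fx x ys) # open_rows A fx xs ys"

fun total_used :: "open_row list \<Rightarrow> nat" where
  "total_used [] = 0" | "total_used ((x, u, us) # rs) = u + total_used rs"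

text \<open>If n planes are charged, each has surplus at least 1 and all together at most 3, so one
  has at most 4 - n. Six columns absorb one deletion each, so the excess of a plane over its columns
  is its surplus plus 1: at most 5 - n for one plane and, in \<open>total_cap\<close>, 3 + n for
  all.\<close>

fun row_cap :: "ix list \<Rightarrow> nat" where
  "row_cap [] = 0" | "row_cap [a] = Suc (Suc (Suc (Suc 0)))" | "row_cap [a, b] = Suc (Suc (Suc 0))" | "row_cap (a # b # c # xs) = Suc (Suc 0)"

fun total_cap :: "ix list \<Rightarrow> nat" where
  "total_cap [] = Suc (Suc (Suc 0))" | "total_cap (x # xs) = Suc (total_cap xs)"

fun le :: "nat \<Rightarrow> nat \<Rightarrow> bool" where
  "le 0 n = True" | "le (Suc m) 0 = False" | "le (Suc m) (Suc n) = le m n"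
fun sb :: "nat \<Rightarrow> nat \<Rightarrow> nat" where
  "sb m 0 = m" | "sb 0 (Suc n) = 0" | "sb (Suc m) (Suc n) = sb m n"
fun mn :: "nat \<Rightarrow> nat \<Rightarrow> nat" where
  "mn 0 n = 0" | "mn (Suc m) 0 = 0" | "mn (Suc m) (Suc n) = Suc (mn m n)"

fun used_within :: "nat \<Rightarrow> open_row list \<Rightarrow> bool" where
  "used_within c [] = True" | "used_within c ((x, u, us) # rs) = (le u c \<and> used_within c rs)"

datatype common = CMain base key undecided decided "key list"
  | CLeaf nat nat nat ix nat ix "(ix \<times> cells) list" "open_row list"
  | CNone

datatype choice = Charge | Plane plane | Word "col list" | State state

fun leaf_start_aux :: "bool \<Rightarrow> nat \<Rightarrow> nat \<Rightarrow> open_row list \<Rightarrow> common \<times> choice list" where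
  "leaf_start_aux False c s rs = (CNone, [])"
| "leaf_start_aux True c s rs = (CNone, [State (Leaf c s (total_used rs) rs)])"

fun leaf_start_from :: "nat \<Rightarrow> nat \<Rightarrow> open_row list \<Rightarrow> common \<times> choice list" where
  "leaf_start_from c s rs = leaf_start_aux (used_within c rs) c s rs"

fun leaf_start :: "base \<Rightarrow> decided \<Rightarrow> ix list \<Rightarrow> ix list \<Rightarrow> common \<times> choice list" where
  "leaf_start A fx xs ys = leaf_start_from (row_cap xs) (total_cap xs) (open_rows A fx xs ys)"

text \<open>A cell with all three colours forbidden must be deleted. The first such cell does not
  count, because the excess discounts one deletion per column.\<close>

fun forced_excess :: "cells \<Rightarrow> nat" and forced_deletions :: "cells \<Rightarrow> nat" and forced_deletions_aux where
  "forced_excess [] = 0"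
| "forced_excess ((i, Forbid d True True True) # cs) = forced_deletions cs"
| "forced_excess ((i, Forbid d False g b) # cs) = forced_excess cs"
| "forced_excess ((i, Forbid d True False b) # cs) = forced_excess cs"
| "forced_excess ((i, Forbid d True True False) # cs) = forced_excess cs"
| "forced_deletions [] = 0"
| "forced_deletions ((i, Forbid d r g b) # cs) = forced_deletions_aux r g b cs"
| "forced_deletions_aux True True True cs = Suc (forced_deletions cs)"
| "forced_deletions_aux False g b cs = forced_deletions cs"
| "forced_deletions_aux True False b cs = forced_deletions cs"
| "forced_deletions_aux True True False cs = forced_deletions cs"

fun forced_row :: "(ix \<times> cells) list \<Rightarrow> nat" where
  "forced_row [] = 0" | "forced_row ((y, cs) # us) = forced_excess cs + forced_row us"

fun forced_rows :: "open_row list \<Rightarrow> nat" where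
  "forced_rows [] = 0" | "forced_rows ((x, u, us) # rs) = forced_row us + forced_rows rs"

fun forbid_in_row :: "ix \<Rightarrow> col list \<Rightarrow> (ix \<times> cells) list \<Rightarrow> (ix \<times> cells) list" where
  "forbid_in_row y w [] = []" | "forbid_in_row y w ((j, cs) # us) = (j, forbid_word_if (adj j y) w cs) # forbid_in_row y w us"

fun forbid_in_column :: "ix \<Rightarrow> col list \<Rightarrow> (ix \<times> cells) list \<Rightarrow> (ix \<times> cells) list" where
  "forbid_in_column y w [] = []" | "forbid_in_column y w ((j, cs) # us) = (j, forbid_word_if (same_index j y) w cs) # forbid_in_column y w us"

fun forbid_in_column_if :: "bool \<Rightarrow> ix \<Rightarrow> col list \<Rightarrow> (ix \<times> cells) list \<Rightarrow> (ix \<times> cells) list" where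
  "forbid_in_column_if True y w us = forbid_in_column y w us" | "forbid_in_column_if False y w us = us"

fun forbid_in_rows :: "ix \<Rightarrow> ix \<Rightarrow> col list \<Rightarrow> open_row list \<Rightarrow> open_row list" where
  "forbid_in_rows x y w [] = []"
| "forbid_in_rows x y w ((i, u, us) # rs) = (i, u, forbid_in_column_if (adj i x) y w us) # forbid_in_rows x y w rs"

fun word_choices :: "col list list \<Rightarrow> choice list" where
  "word_choices [] = []" | "word_choices (w # ws) = Word w # word_choices ws"
fun plane_choices :: "plane list \<Rightarrow> choice list" where
  "plane_choices [] = []" | "plane_choices (p # ps) = Plane p # plane_choices ps"

text \<open>Beyond the bound there is no successor and the branch is refuted. A leaf with no open
  row is a survivor: it is its own only successor, so the fuel runs out and the search
  fails.\<close>

fun leaf_choices_aux :: "bool \<Rightarrow> nat \<Rightarrow> nat \<Rightarrow> nat \<Rightarrow> nat \<Rightarrow> open_row list \<Rightarrow> common \<times> choice list" where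
  "leaf_choices_aux False l c s t rs = (CNone, [])"
| "leaf_choices_aux True l c s t [] = (CNone, [State (Leaf c s t [])])"
| "leaf_choices_aux True l c s t ((x, u, []) # rs) = (CNone, [State (Leaf c s t rs)])"
| "leaf_choices_aux True l c s t ((x, u, (y, cs) # us) # rs) =
     (CLeaf c s t x u y us rs, word_choices (words_upto (Suc (mn (sb c u) (sb (forced_excess cs + s) l))) cs))"

text \<open>\<open>l\<close> is the excess used so far plus that forced in all open columns. The
  next column must leave the others their forced share, hence its own \<open>forced_excess\<close>
  is added back to \<open>s\<close> before \<open>l\<close> is subtracted. The final
  \<open>Suc\<close> turns excess into deletions.\<close>

fun leaf_choices :: "nat \<Rightarrow> nat \<Rightarrow> nat \<Rightarrow> nat \<Rightarrow> open_row list \<Rightarrow> common \<times> choice list" where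
  "leaf_choices l c s t rs = leaf_choices_aux (le l s) l c s t rs"

fun add_charge :: "bool \<Rightarrow> choice list \<Rightarrow> choice list" where
  "add_charge True cs = Charge # cs" | "add_charge False cs = cs"

fun branch :: "base \<Rightarrow> (key \<times> plane list) \<times> undecided \<Rightarrow> decided \<Rightarrow> key list \<Rightarrow> common \<times> choice list" where
  "branch A ((k, ps), us) fx ch = (CMain A k us fx ch, add_charge (may_charge k ch) (plane_choices ps))"

fun choices :: "state \<Rightarrow> common \<times> choice list" where
  "choices (Main A [] fx ch) = leaf_start A fx (charged_xs ch) (charged_ys ch)"
| "choices (Main A (u # us) fx ch) = branch A (pick u us []) fx ch"
| "choices (Leaf c s t rs) = leaf_choices (forced_rows rs + t) c s t rs"

fun apply_choice :: "common \<Rightarrow> choice \<Rightarrow> state" where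
  "apply_choice (CMain A k us fx ch) Charge = Main A us fx (k # ch)"
| "apply_choice (CMain A k us fx ch) (Plane p) = Main A (filter_undecided k p us) ((k, p) # fx) ch"
| "apply_choice (CLeaf c s t x u y us rs) (Word w) =
     Leaf c s (excess w + t) ((x, excess w + u, forbid_in_row y w us) # forbid_in_rows x y w rs)"
| "apply_choice CNone (State s) = s"

section \<open>Normalisation of known lines by symmetries\<close>

fun perm :: "ix list \<Rightarrow> 'a list \<Rightarrow> 'a list" where
  "perm [] l = []" | "perm (i # is) l = sel i l # perm is l"

fun recolour_word :: "K \<Rightarrow> col list \<Rightarrow> col list" where
  "recolour_word k [] = []" | "recolour_word k (c # cs) = recolour k c # recolour_word k cs"
fun recolour_plane :: "K \<Rightarrow> plane \<Rightarrow> plane" where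
  "recolour_plane k [] = []" | "recolour_plane k (c # cs) = recolour_word k c # recolour_plane k cs"

fun map_back :: "ix list \<Rightarrow> K \<Rightarrow> plane list \<Rightarrow> plane list" where
  "map_back r m [] = []" | "map_back r m (p # ps) = recolour_plane m (perm r p) # map_back r m ps"

text \<open>The symmetry acts along the known lines and fixes both layers. Hence the second line
  \<open>v\<close> is transformed by the symmetry that normalises the first, and the planes found
  are carried back by its inverse.\<close>

fun candidates :: "bool \<Rightarrow> hint \<Rightarrow> col list \<Rightarrow> plane list" where
  "candidates True (Hint perm_list k rho m w) v = map_back rho m (planes (table_entry (recolour_word k (perm perm_list v)) (table_row w tabH)))"
| "candidates False (Hint perm_list k rho m w) v = map_back rho m (planes (table_entry (recolour_word k (perm perm_list v)) (table_row w tabN)))"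

fun line_of :: "key \<Rightarrow> plane \<Rightarrow> col list" where
  "line_of (X i) P = sel i P" | "line_of (Y i) P = column i P"

fun is_hub :: "key \<Rightarrow> bool" where
  "is_hub (X i) = same_index i I5" | "is_hub (Y i) = same_index i I5"

text \<open>In the rim case the two crossing hub planes start out as charged and must not be listed
  as undecided.\<close>

fun undecided0 :: "bool \<Rightarrow> (key \<times> hint) list \<Rightarrow> plane \<Rightarrow> undecided" and undecided0_aux where
  "undecided0 h [] P = []"
| "undecided0 True ((k, hi) # hs) P = (k, candidates True hi (line_of k P)) # undecided0 True hs P"
| "undecided0 False ((k, hi) # hs) P = undecided0_aux (is_hub k) k hi hs P"
| "undecided0_aux True k hi hs P = undecided0 False hs P"
| "undecided0_aux False k hi hs P = (k, candidates False hi (line_of k P)) # undecided0 False hs P"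

definition dihedral :: "(ix list \<times> ix list) list" where
  "dihedral = [([I5, I4, I3, I2, I1, I0], [I5, I4, I3, I2, I1, I0]),
    ([I5, I0, I4, I3, I2, I1], [I5, I3, I2, I1, I0, I4]),
    ([I5, I1, I0, I4, I3, I2], [I5, I2, I1, I0, I4, I3]),
    ([I5, I2, I1, I0, I4, I3], [I5, I1, I0, I4, I3, I2]),
    ([I5, I3, I2, I1, I0, I4], [I5, I0, I4, I3, I2, I1]),
    ([I5, I1, I2, I3, I4, I0], [I5, I1, I2, I3, I4, I0]),
    ([I5, I2, I3, I4, I0, I1], [I5, I2, I3, I4, I0, I1]),
    ([I5, I3, I4, I0, I1, I2], [I5, I3, I4, I0, I1, I2]),
    ([I5, I4, I0, I1, I2, I3], [I5, I4, I0, I1, I2, I3]),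
    ([I5, I0, I1, I2, I3, I4], [I5, I0, I1, I2, I3, I4])]"
definition recolourings :: "(K \<times> K) list" where
  "recolourings = [(K R G B, K R G B), (K G R B, K G R B), (K B G R, K B G R), (K R B G, K R B G), (K G B R, K B R G), (K B R G, K G B R)]"

fun mem_word :: "col list \<Rightarrow> col list list \<Rightarrow> bool" and mem_word_aux where
  "mem_word w [] = False" | "mem_word w (v # vs) = mem_word_aux (eq_word w v) w vs"
| "mem_word_aux True w vs = True" | "mem_word_aux False w vs = mem_word w vs"

fun add_hint_if :: "bool \<Rightarrow> ix list \<Rightarrow> ix list \<Rightarrow> (K \<times> K) \<Rightarrow> col list \<Rightarrow> hint list \<Rightarrow> hint list" where
  "add_hint_if True perm_list rho (k, m) w hs = [Hint perm_list k rho m w]"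
| "add_hint_if False perm_list rho (k, m) w hs = hs"

fun hints_recolour :: "ix list \<Rightarrow> ix list \<Rightarrow> col list \<Rightarrow> (K \<times> K) list \<Rightarrow> hint list \<Rightarrow> hint list" and hints_recolour_aux where
  "hints_recolour perm_list rho w [] hs = hs"
| "hints_recolour perm_list rho w ((k, m) # ks) hs = hints_recolour_aux (recolour_word k w) perm_list rho (k, m) (hints_recolour perm_list rho w ks hs)"
| "hints_recolour_aux v perm_list rho km hs = add_hint_if (mem_word v keys) perm_list rho km v hs"

fun find_hints :: "col list \<Rightarrow> (ix list \<times> ix list) list \<Rightarrow> hint list" where
  "find_hints w [] = []"
| "find_hints w ((perm_list, rho) # ps) = hints_recolour perm_list rho (perm perm_list w) recolourings (find_hints w ps)"

fun first :: "'a list \<Rightarrow> 'a" where "first (x # xs) = x"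

definition allkeys :: "key list" where
  "allkeys = [X I0, Y I0, X I1, Y I1, X I2, Y I2, X I3, Y I3, X I4, Y I4, X I5, Y I5]"

text \<open>Hints depend on the first layer only and are shared by all its neighbours.\<close>

fun hints :: "plane \<Rightarrow> key list \<Rightarrow> (key \<times> hint) list" where
  "hints A [] = []"
| "hints A (k # ks) = (k, first (find_hints (line_of k A) dihedral)) # hints A ks"

fun alines :: "plane \<Rightarrow> ix list \<Rightarrow> line_choices" where
  "alines A [] = []" | "alines A (j # js) = line_choice j (forbid_word (sel j A) free_cells) # alines A js"

fun add6 :: "nat \<Rightarrow> nat" where "add6 n = Suc (Suc (Suc (Suc (Suc (Suc n)))))"
text \<open>36 exceeds the longest refuted branch: at most twelve planes, the step into the leaf,
  nine columns, and the closing of three rows.\<close>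

definition fuel :: nat where "fuel = add6 (add6 (add6 (add6 (add6 (add6 0)))))"

text \<open>
  Two adjacent rim planes are exchanged by a reflection, so only pairs in this order are searched.
\<close>

definition hub_dels :: "plane \<Rightarrow> nat" where
  "hub_dels P = dels (sel I5 P) + dels (column I5 P)"

fun check_rim :: "bool \<Rightarrow> (key \<times> hint) list \<Rightarrow> plane \<Rightarrow> plane \<Rightarrow> bool" where
  "check_rim False hs A P = True"
| "check_rim True hs A P =
    search choices apply_choice fuel (Main (False, A, P) (undecided0 False hs P) [] [X I5, Y I5])"

fun check_neighbours :: "(key \<times> hint) list \<Rightarrow> plane \<Rightarrow> plane list \<Rightarrow> bool" where
  "check_neighbours hs A [] = True"
| "check_neighbours hs A (P # Ps) =
    (search choices apply_choice fuel (Main (True, A, P) (undecided0 True hs P) [] []) \<and>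
     check_rim (le (hub_dels P) (hub_dels A)) hs A P \<and>
     check_neighbours hs A Ps)"

definition check_plane :: "plane \<Rightarrow> bool" where
  "check_plane A = check_neighbours (hints A allkeys) A (gen_planes fuel7 [] (alines A indices))"
text \<open>That the eight representatives meet every orbit of optimal planes is verified by
  \<open>reductions_ok\<close>.\<close>

definition rep0 :: plane where "rep0 = [[R,D,G,D,G,B],[B,G,R,G,R,D],[G,B,D,R,B,R],[D,R,B,G,R,G],[G,B,R,B,D,R],[D,R,B,R,B,G]]"
definition rep1 :: plane where "rep1 = [[R,D,G,D,G,B],[G,B,R,B,R,D],[D,G,B,R,B,R],[B,R,D,G,R,G],[G,B,R,B,D,R],[D,R,B,R,B,G]]"
definition rep2 :: plane where "rep2 = [[R,D,G,D,G,B],[B,G,R,G,R,D],[G,D,B,R,B,R],[B,R,D,G,R,G],[G,B,R,B,D,R],[D,R,B,R,B,G]]"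
definition rep3 :: plane where "rep3 = [[R,D,G,D,G,B],[B,G,R,G,R,D],[G,B,D,R,B,R],[B,R,D,G,R,G],[G,B,R,B,D,R],[D,R,B,R,B,G]]"
definition rep4 :: plane where "rep4 = [[R,D,G,D,G,B],[G,B,R,B,R,D],[D,G,B,R,B,R],[B,R,D,G,R,G],[G,B,R,B,D,R],[D,R,B,G,B,G]]"
definition rep5 :: plane where "rep5 = [[R,D,G,B,G,B],[B,G,R,G,D,R],[G,R,B,R,B,D],[B,D,R,G,R,G],[G,B,D,R,B,R],[D,R,B,D,R,G]]"
definition rep6 :: plane where "rep6 = [[R,D,G,B,G,B],[B,G,R,G,D,R],[G,R,B,R,B,D],[B,G,R,G,R,D],[G,B,D,R,B,R],[D,R,B,D,R,G]]"
definition rep7 :: plane where "rep7 = [[R,D,G,B,G,B],[B,G,R,G,R,D],[G,B,D,R,B,R],[B,R,D,G,R,G],[G,B,R,D,D,R],[D,R,B,R,B,G]]"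

section \<open>Words\<close>

lemma ix_UNIV: "UNIV = {I0, I1, I2, I3, I4, I5}"
  using ix.exhaust by blast

instance ix :: finite
  by standard (simp add: ix_UNIV)

lemma all_ix: "(\<forall>i. P i) \<longleftrightarrow> P I5 \<and> P I4 \<and> P I3 \<and> P I2 \<and> P I1 \<and> P I0"
  by (metis ix.exhaust)

lemma sum_ix: "(\<Sum>i\<in>UNIV. g i) = g I0 + g I1 + g I2 + g I3 + g I4 + (g I5 :: nat)"
  by (simp add: ix_UNIV)

lemma set_xsi: "set indices = UNIV"
  by (auto simp: indices_def ix_UNIV)

definition word :: "(ix \<Rightarrow> 'a) \<Rightarrow> 'a list" where
  "word f = [f I5, f I4, f I3, f I2, f I1, f I0]"

definition grid :: "(ix \<Rightarrow> ix \<Rightarrow> 'a) \<Rightarrow> 'a list list" where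
  "grid f = word (\<lambda>i. word (f i))"

lemma sel_lst [simp]: "sel i (word f) = f i"
  by (cases i) (simp_all add: word_def)

lemma sel_lst2 [simp]: "sel i (grid f) = word (f i)"
  by (simp add: grid_def)

lemma column_lst2 [simp]: "column i (grid f) = word (\<lambda>j. f j i)"
  by (simp add: grid_def word_def) (cases i; simp)

lemma transp_lst2 [simp]: "transp (grid f) = grid (\<lambda>i j. f j i)"
  by (simp add: transp_def) (simp add: grid_def word_def)

lemma adj_sym: "adj i j = adj j i"
  by (cases i; cases j) simp_all

lemma adj_irrefl [simp]: "adj i i = False"
  by (cases i) simp_all

lemma same_index_iff [simp]: "same_index i j \<longleftrightarrow> i = j"
  by (cases i; cases j) simp_all

lemma compat_iff: "compat a b \<longleftrightarrow> a \<noteq> b \<or> a = D"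
  by (cases a; cases b) simp_all

lemma compat_word_Cons [simp]: "compat_word (a # as) (b # bs) \<longleftrightarrow> compat a b \<and> compat_word as bs"
  by (cases a; cases b) simp_all

lemma compat_plane_aux_iff [simp]: "compat_plane_aux t as bs \<longleftrightarrow> t \<and> compat_plane as bs"
  by (cases t) simp_all

lemma eq_word_iff [simp]: "eq_word as bs \<longleftrightarrow> as = bs"
  by (induction as bs rule: eq_word.induct) auto

lemma eq_plane_iff [simp]: "eq_plane as bs \<longleftrightarrow> as = bs"
  and "eq_plane_aux t as bs \<longleftrightarrow> t \<and> as = bs"
  by (induction as bs and t as bs rule: eq_plane_eq_plane_aux.induct) auto

lemma mem_plane_iff [simp]: "mem_plane a bs \<longleftrightarrow> a \<in> set bs"
  and "mem_plane_aux t a bs \<longleftrightarrow> t \<or> a \<in> set bs"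
  by (induction a bs and t a bs rule: mem_plane_mem_plane_aux.induct) auto

lemma mem_word_iff [simp]: "mem_word w vs \<longleftrightarrow> w \<in> set vs"
  and "mem_word_aux t w vs \<longleftrightarrow> t \<or> w \<in> set vs"
  by (induction w vs and t w vs rule: mem_word_mem_word_aux.induct) auto

lemma keep_eq [simp]: "keep t x xs = (if t then x # xs else xs)"
  by (cases t) simp_all

lemma filter_word_eq [simp]: "filter_word w vs = filter (compat_word w) vs"
  by (induction vs) auto

lemma compat_word_lst [simp]: "compat_word (word f) (word g) \<longleftrightarrow> (\<forall>i. compat (f i) (g i))"
  by (simp add: word_def all_ix)

lemma compat_plane_lst2 [simp]: "compat_plane (grid f) (grid g) \<longleftrightarrow> (\<forall>i j. compat (f i j) (g i j))"
proof -
  have "compat_plane (word p) (word q) \<longleftrightarrow> (\<forall>i. compat_word (p i) (q i))" for p q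
    by (simp add: word_def all_ix)
  then show ?thesis by (simp add: grid_def)
qed

lemma dels_Cons [simp]: "dels (a # as) = (if a = D then Suc (dels as) else dels as)"
  by (cases a) simp_all

lemma excess_eq: "excess as = dels as - 1"
proof (induction as)
  case (Cons a as)
  then show ?case by (cases a) simp_all
qed simp

lemma dels_lst: "dels (word f) = (\<Sum>i\<in>UNIV. if f i = D then 1 else 0)"
  by (simp add: word_def sum_ix)

fun admits :: "col \<Rightarrow> palette \<Rightarrow> bool" where
  "admits D (Forbid d r g b) = (\<not> d)"
| "admits R (Forbid d r g b) = (\<not> r)"
| "admits G (Forbid d r g b) = (\<not> g)"
| "admits B (Forbid d r g b) = (\<not> b)"

lemma admits_ins: "admits c f \<Longrightarrow> compat a c \<Longrightarrow> admits c (forbid a f)"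
  by (cases f; cases a; cases c) auto

lemma admits_insif: "admits c f \<Longrightarrow> (t \<longrightarrow> compat a c) \<Longrightarrow> admits c (forbid_if t a f)"
  by (cases t) (auto intro: admits_ins)

lemma admits_only [simp]: "admits a (only a)"
  by (cases a) auto

lemma admits_free [simp]: "admits a (Forbid False False False False)"
  by (cases a) auto

definition line :: "(ix \<Rightarrow> col) \<Rightarrow> bool" where
  "line f \<longleftrightarrow> (\<forall>i j. adj i j \<longrightarrow> compat (f i) (f j))"

definition allowed :: "(ix \<Rightarrow> col) \<Rightarrow> cells \<Rightarrow> bool" where
  "allowed f cs \<longleftrightarrow> (\<forall>(i, s) \<in> set cs. admits (f i) s)"

lemma allowed_Cons [simp]: "allowed f ((i, s) # cs) \<longleftrightarrow> admits (f i) s \<and> allowed f cs"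
  by (simp add: allowed_def)

lemma allowed_Nil [simp]: "allowed f []"
  by (simp add: allowed_def)

lemma map_fst_upd [simp]: "map fst (forbid_adjacent i c cs) = map fst cs"
  by (induction i c cs rule: forbid_adjacent.induct) auto

lemma allowed_upd: "line f \<Longrightarrow> allowed f cs \<Longrightarrow> allowed f (forbid_adjacent i (f i) cs)"
  by (induction i "f i" cs rule: forbid_adjacent.induct) (auto simp: line_def intro!: admits_insif)

text \<open>The partial words that are beginnings of one fixed \<open>f\<close>, with
  \<open>k\<close> cells to go. Following \<open>f\<close> through the steps shows that it is
  generated.\<close>

definition gw_ok :: "(ix \<Rightarrow> col) \<Rightarrow> nat \<Rightarrow> partial_word \<Rightarrow> bool" where
  "gw_ok f k s \<longleftrightarrow> (case s of (acc, n, cs) \<Rightarrow>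
     rev acc @ map (f \<circ> fst) cs = map f indices \<and> allowed f cs \<and> dels (map (f \<circ> fst) cs) \<le> n \<and> length cs = k)"

lemma set_stc: "set (extend_col t c i acc n cs ts) = (if t then {} else {(c # acc, n, forbid_adjacent i c cs)}) \<union> set ts"
  by (cases t) auto

lemma set_stD: "set (extend_D t acc n cs ts) = (if t \<or> n = 0 then {} else {(D # acc, n - 1, cs)}) \<union> set ts"
  by (cases t; cases n) auto

lemma word_steps_step:
  assumes "line f" "s \<in> set ss" "gw_ok f (Suc k) s"
  shows "\<exists>s' \<in> set (word_steps ss). gw_ok f k s'"
  using assms(2)
proof (induction ss rule: word_steps.induct)
  case (2 acc n ss)
  then show ?case using assms(3) by (auto simp: gw_ok_def)
next
  case (3 acc n i d r g b cs ss)
  show ?case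
  proof (cases "s \<in> set ss")
    case True
    then show ?thesis using 3 by (auto simp: set_stc set_stD)
  next
    case False
    then have s: "s = (acc, n, (i, Forbid d r g b) # cs)" using 3 by simp
    have h: "rev acc @ map (f \<circ> fst) ((i, Forbid d r g b) # cs) = map f indices"
      "admits (f i) (Forbid d r g b)" "allowed f cs"
      "dels (f i # map (f \<circ> fst) cs) \<le> n" "length cs = k"
      using assms(3) by (auto simp: gw_ok_def s)
    have u: "map (f \<circ> fst) (forbid_adjacent i (f i) cs) = map (f \<circ> fst) cs"
      by (metis map_fst_upd map_map)
    have u': "length (forbid_adjacent i (f i) cs) = length cs"
      by (metis map_fst_upd length_map)
    note a = allowed_upd[OF assms(1) h(3), of i]
    show ?thesis
    proof (cases "f i")
      case D
      then have "gw_ok f k (D # acc, n - 1, cs)" "n \<noteq> 0" "\<not> d"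
        using h by (auto simp: gw_ok_def)
      then show ?thesis by (auto simp: set_stc set_stD)
    next
      case R
      then have "gw_ok f k (R # acc, n, forbid_adjacent i R cs)" "\<not> r"
        using h u u' a by (auto simp: gw_ok_def)
      then show ?thesis by (auto simp: set_stc set_stD)
    next
      case G
      then have "gw_ok f k (G # acc, n, forbid_adjacent i G cs)" "\<not> g"
        using h u u' a by (auto simp: gw_ok_def)
      then show ?thesis by (auto simp: set_stc set_stD)
    next
      case B
      then have "gw_ok f k (B # acc, n, forbid_adjacent i B cs)" "\<not> b"
        using h u u' a by (auto simp: gw_ok_def)
      then show ?thesis by (auto simp: set_stc set_stD)
    qed
  qed
qed simp

lemma rev_onto_eq [simp]: "rev_onto as bs = rev as @ bs"
  by (induction as arbitrary: bs) auto

lemma finished_words_eq [simp]: "finished_words xs = map (rev \<circ> fst) xs"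
  by (induction xs) auto

lemma word_xsi: "word f = map f indices"
  by (simp add: word_def indices_def)

lemma words_upto_complete:
  assumes "line f" "allowed f cs" "map fst cs = indices" "dels (word f) \<le> n"
  shows "word f \<in> set (words_upto n cs)"
proof -
  have c: "map (f \<circ> fst) cs = map f indices"
    using assms(3) by (metis map_map)
  have l: "length cs = 6" using arg_cong[OF assms(3), of length] by (simp add: indices_def)
  have "gw_ok f 6 ([], n, cs)"
    using assms c l by (simp add: gw_ok_def word_xsi)
  then obtain s where s: "s \<in> set (word_steps (word_steps (word_steps (word_steps (word_steps (word_steps [([], n, cs)]))))))"
    "gw_ok f 0 s"
    using word_steps_step[OF assms(1)] by (metis list.set_intros(1) eval_nat_numeral(2,3) semiring_norm(26,27,28) numeral_One One_nat_def)
  then have "rev (fst s) = word f" by (auto simp: gw_ok_def word_xsi)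
  then show ?thesis using s(1) unfolding words_upto_def by force
qed

section \<open>Completeness of the generated planes\<close>

definition plane2 :: "(ix \<Rightarrow> ix \<Rightarrow> col) \<Rightarrow> bool" where
  "plane2 g \<longleftrightarrow> (\<forall>i. line (g i)) \<and> (\<forall>j. line (\<lambda>i. g i j))"

definition total2 :: "(ix \<Rightarrow> ix \<Rightarrow> col) \<Rightarrow> nat" where
  "total2 g = (\<Sum>i\<in>UNIV. dels (word (g i)))"

lemma total2_transp: "total2 (\<lambda>i j. g j i) = total2 g"
  by (simp add: total2_def dels_lst sum_ix)

lemma plane2_transp: "plane2 g \<Longrightarrow> plane2 (\<lambda>i j. g j i)"
  by (auto simp: plane2_def)

lemma set_filtwif: "v \<in> set (filter_word_if t w vs) \<longleftrightarrow> v \<in> set vs \<and> (t \<longrightarrow> compat_word w v)"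
  by (cases t) auto

lemma narrow_eq: "narrow i w us = map (\<lambda>(j, a, b). (j, filter_word_if (adj i j) w a, filter_word_if (adj i j) w b)) us"
  by (induction us) auto

lemma narrow_single_eq: "narrow_single i w us = map (\<lambda>(j, a, b). (j, filter_word_if (adj i j) w a, [])) us"
  by (induction us) auto

text \<open>The fixed plane \<open>g\<close> is still reachable. The last clause expresses the
  surplus of one: among any two open lines, at least one is found in its list of single
  deletions.\<close>

definition gen_ok :: "(ix \<Rightarrow> ix \<Rightarrow> col) \<Rightarrow> chosen_lines \<Rightarrow> line_choices \<Rightarrow> bool" where
  "gen_ok g d us \<longleftrightarrow> (\<forall>(i, w) \<in> set d. w = word (g i)) \<and> fst ` set d \<union> fst ` set us = UNIV \<and>
     distinct (map fst us) \<and>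
     (\<forall>(i, a, b) \<in> set us. word (g i) \<in> set a \<or> word (g i) \<in> set b) \<and>
     (\<forall>(i, a, b) \<in> set us. \<forall>(j, a', b') \<in> set us. i \<noteq> j \<longrightarrow> word (g i) \<in> set a \<or> word (g j) \<in> set a')"

lemma line_at_eq: "\<forall>(i, w) \<in> set d. w = word (g i) \<Longrightarrow> i \<in> fst ` set d \<Longrightarrow> line_at i d = word (g i)"
proof (induction d)
  case (Cons x d)
  obtain j w where x: "x = (j, w)" by force
  show ?case
    using Cons by (cases "same_index i j") (auto simp: x)
qed simp

lemma rows_eq: "\<forall>(i, w) \<in> set d. w = word (g i) \<Longrightarrow> fst ` set d = UNIV \<Longrightarrow> rows d = grid g"
  by (simp add: rows_def line_at_eq grid_def word_def)

lemma plane2_cmp: "plane2 g \<Longrightarrow> adj i j \<Longrightarrow> compat_word (word (g i)) (word (g j))"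
  by (auto simp: plane2_def line_def)

text \<open>Narrowing removes only words that clash with a line of \<open>g\<close>, hence never
  another line of \<open>g\<close>.\<close>

lemma gen_planes_ok_fl:
  assumes "plane2 g" "gen_ok g d ((i, a, b) # us)"
  shows "gen_ok g ((i, word (g i)) # d) (narrow i (word (g i)) us)"
proof -
  let ?w = "word (g i)"
  have kp: "word (g j) \<in> set (filter_word_if (adj i j) ?w v) \<longleftrightarrow> word (g j) \<in> set v" for j v
    using plane2_cmp[OF assms(1)] by (auto simp: set_filtwif)
  have ff: "map fst (narrow i ?w us) = map fst us"
    by (simp add: narrow_eq comp_def case_prod_beta)
  then have palette: "fst ` set (narrow i ?w us) = fst ` set us"
    by (metis list.set_map)
  have mem: "\<exists>x y. (j, x, y) \<in> set us \<and> a' = filter_word_if (adj i j) ?w x \<and> b' = filter_word_if (adj i j) ?w y"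
    if "(j, a', b') \<in> set (narrow i ?w us)" for j a' b'
    using that by (auto simp: narrow_eq)
  have one: "word (g j) \<in> set a' \<or> word (g j) \<in> set b'" if "(j, a', b') \<in> set (narrow i ?w us)" for j a' b'
    using mem[OF that] assms kp unfolding gen_ok_def by fastforce
  have pair: "word (g j) \<in> set x \<or> word (g k) \<in> set x'"
    if "(j, x, y) \<in> set us" "(k, x', y') \<in> set us" "j \<noteq> k" for j x y k x' y'
  proof -
    have "\<forall>(j, x, y) \<in> set ((i, a, b) # us). \<forall>(k, x', y') \<in> set ((i, a, b) # us).
        j \<noteq> k \<longrightarrow> word (g j) \<in> set x \<or> word (g k) \<in> set x'"
      using assms(2) unfolding gen_ok_def by (elim conjE)
    from bspec[OF this list.set_intros(2)[OF that(1)]] that(2,3) show ?thesis by auto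
  qed
  have double_words: "word (g j) \<in> set a' \<or> word (g k) \<in> set c'"
    if "(j, a', b') \<in> set (narrow i ?w us)" "(k, c', d') \<in> set (narrow i ?w us)" "j \<noteq> k" for j a' b' k c' d'
    using mem[OF that(1)] mem[OF that(2)] pair[OF _ _ that(3)] kp by metis
  show ?thesis
    unfolding gen_ok_def
  proof (intro conjI)
    show "\<forall>(j, a', b') \<in> set (narrow i ?w us). word (g j) \<in> set a' \<or> word (g j) \<in> set b'"
      using one by blast
    show "\<forall>(j, a', b') \<in> set (narrow i ?w us). \<forall>(k, c', d') \<in> set (narrow i ?w us).
        j \<noteq> k \<longrightarrow> word (g j) \<in> set a' \<or> word (g k) \<in> set c'"
      using double_words by blast
  qed (use assms(2) ff palette in \<open>auto simp: gen_ok_def\<close>)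
qed

text \<open>A line missing from its first list is the exceptional one. The pairwise clause of
  \<open>gen_ok\<close> then puts every other line into its first list, so emptying the second lists
  loses nothing.\<close>

lemma gen_planes_ok_fl0:
  assumes "plane2 g" "gen_ok g d ((i, a, b) # us)" "word (g i) \<notin> set a"
  shows "gen_ok g ((i, word (g i)) # d) (narrow_single i (word (g i)) us)"
proof -
  let ?w = "word (g i)"
  have kp: "word (g j) \<in> set (filter_word_if (adj i j) ?w v) \<longleftrightarrow> word (g j) \<in> set v" for j v
    using plane2_cmp[OF assms(1)] by (auto simp: set_filtwif)
  have ff: "map fst (narrow_single i ?w us) = map fst us"
    by (simp add: narrow_single_eq comp_def case_prod_beta)
  then have palette: "fst ` set (narrow_single i ?w us) = fst ` set us"
    by (metis list.set_map)
  have mem: "\<exists>x y. (j, x, y) \<in> set us \<and> a' = filter_word_if (adj i j) ?w x \<and> b' = []"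
    if "(j, a', b') \<in> set (narrow_single i ?w us)" for j a' b'
    using that by (auto simp: narrow_single_eq)
  have mem0: "word (g j) \<in> set x" if "(j, x, y) \<in> set us" for j x y
  proof -
    have "\<forall>(j, x, y) \<in> set ((i, a, b) # us). \<forall>(k, x', y') \<in> set ((i, a, b) # us).
        j \<noteq> k \<longrightarrow> word (g j) \<in> set x \<or> word (g k) \<in> set x'"
      using assms(2) unfolding gen_ok_def by (elim conjE)
    from bspec[OF bspec[OF this list.set_intros(1), unfolded prod.case] list.set_intros(2)[OF that]]
    have "i \<noteq> j \<Longrightarrow> word (g j) \<in> set x" using assms(3) by simp
    moreover have "i \<noteq> j"
    proof
      assume "i = j"
      then have "i \<in> set (map fst us)" using that by force
      then show False using assms(2) unfolding gen_ok_def by simp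
    qed
    ultimately show ?thesis by simp
  qed
  have one: "word (g j) \<in> set a' \<or> word (g j) \<in> set b'" if "(j, a', b') \<in> set (narrow_single i ?w us)" for j a' b'
    using mem[OF that] assms mem0 kp by blast
  have pair: "word (g j) \<in> set x \<or> word (g k) \<in> set x'"
    if "(j, x, y) \<in> set us" "(k, x', y') \<in> set us" "j \<noteq> k" for j x y k x' y'
  proof -
    have "\<forall>(j, x, y) \<in> set ((i, a, b) # us). \<forall>(k, x', y') \<in> set ((i, a, b) # us).
        j \<noteq> k \<longrightarrow> word (g j) \<in> set x \<or> word (g k) \<in> set x'"
      using assms(2) unfolding gen_ok_def by (elim conjE)
    from bspec[OF this list.set_intros(2)[OF that(1)]] that(2,3) show ?thesis by auto
  qed
  have double_words: "word (g j) \<in> set a' \<or> word (g k) \<in> set c'"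
    if "(j, a', b') \<in> set (narrow_single i ?w us)" "(k, c', d') \<in> set (narrow_single i ?w us)" "j \<noteq> k" for j a' b' k c' d'
    using mem[OF that(1)] mem[OF that(2)] pair[OF _ _ that(3)] kp by metis
  show ?thesis
    unfolding gen_ok_def
  proof (intro conjI)
    show "\<forall>(j, a', b') \<in> set (narrow_single i ?w us). word (g j) \<in> set a' \<or> word (g j) \<in> set b'"
      using one by blast
    show "\<forall>(j, a', b') \<in> set (narrow_single i ?w us). \<forall>(k, c', d') \<in> set (narrow_single i ?w us).
        j \<noteq> k \<longrightarrow> word (g j) \<in> set a' \<or> word (g k) \<in> set c'"
      using double_words by blast
  qed (use assms(2) ff palette in \<open>auto simp: gen_ok_def\<close>)
qed

lemma gen_single_mem: "w \<in> set ws \<Longrightarrow> P \<in> set (f ((i, w) # d) (narrow i w us)) \<Longrightarrow> P \<in> set (gen_single f d i us ws)"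
  by (induction ws) auto

lemma gen_double_mem: "w \<in> set ws \<Longrightarrow> P \<in> set (f ((i, w) # d) (narrow_single i w us)) \<Longrightarrow> P \<in> set (gen_double f d i us ws)"
  by (induction ws) auto

lemma gen_planes_complete:
  assumes "plane2 g"
  shows "gen_ok g d us \<Longrightarrow> length us < n \<Longrightarrow> grid g \<in> set (gen_planes n d us)"
proof (induction n arbitrary: d us)
  case (Suc n)
  show ?case
  proof (cases us)
    case Nil
    then show ?thesis using Suc.prems rows_eq by (auto simp: gen_ok_def)
  next
    case (Cons u us')
    obtain i a b where u: "u = (i, a, b)" by (cases u) auto
    note compat = Suc.prems(1)[unfolded Cons u]
    show ?thesis
    proof (cases "word (g i) \<in> set a")
      case True
      have "grid g \<in> set (gen_planes n ((i, word (g i)) # d) (narrow i (word (g i)) us'))"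
        using Suc.IH[OF gen_planes_ok_fl[OF assms compat]] Suc.prems(2) Cons by (simp add: narrow_eq)
      then show ?thesis using True by (simp add: Cons u gen_single_mem)
    next
      case False
      then have "word (g i) \<in> set b" using compat by (auto simp: gen_ok_def)
      moreover have "grid g \<in> set (gen_planes n ((i, word (g i)) # d) (narrow_single i (word (g i)) us'))"
        using Suc.IH[OF gen_planes_ok_fl0[OF assms compat False]] Suc.prems(2) Cons by (simp add: narrow_single_eq)
      ultimately show ?thesis by (simp add: Cons u gen_double_mem)
    qed
  qed
qed simp

text \<open>An empty result with budget zero is the statement that the wheel is not
  3-colourable.\<close>

lemma words_upto_0: "words_upto 0 free_cells = []"
  by code_simp

lemma map_fst_cells0: "map fst free_cells = indices"
  by (simp add: free_cells_def indices_def)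

lemma allowed_cells0: "allowed f free_cells"
  by (simp add: free_cells_def allowed_def)

lemma line_ge1: "line f \<Longrightarrow> dels (word f) \<ge> 1"
  using words_upto_complete[OF _ allowed_cells0 map_fst_cells0, of f 0] by (fastforce simp: words_upto_0)

lemma plane2_ge1: "plane2 g \<Longrightarrow> dels (word (g i)) \<ge> 1"
  using line_ge1[of "g i"] by (simp add: plane2_def)

text \<open>The four remaining lines take at least one of the seven deletions each.\<close>

lemma double_words_rows:
  assumes "plane2 g" "total2 g \<le> 7" "i \<noteq> j"
  shows "dels (word (g i)) + dels (word (g j)) \<le> 3"
proof -
  have "total2 g = dels (word (g i)) + dels (word (g j)) + (\<Sum>k\<in>UNIV - {i, j}. dels (word (g k)))"
    unfolding total2_def by (subst sum.subset_diff[of "{i, j}"]) (use assms in auto)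
  moreover have "(\<Sum>k\<in>UNIV - {i, j}. dels (word (g k))) \<ge> (\<Sum>k\<in>UNIV - {i, j}. 1)"
    by (rule sum_mono) (use plane2_ge1[OF assms(1)] in auto)
  moreover have "card (UNIV - {i, j}) = 4"
    using assms(3) by (simp add: card_Diff_subset) (simp add: ix_UNIV)
  ultimately show ?thesis using assms(2) by simp
qed

lemma row_le2:
  assumes "plane2 g" "total2 g \<le> 7"
  shows "dels (word (g i)) \<le> 2"
proof -
  obtain j where "i \<noteq> j" by (metis ix.distinct(1))
  then show ?thesis using double_words_rows[OF assms, of i j] plane2_ge1[OF assms(1), of j] by simp
qed

lemma double_words_eq [simp]: "set (double_words ws) = {w \<in> set ws. dels w = 2}"
proof -
  have t: "is_one n \<longleftrightarrow> n = Suc 0" for n by (cases n rule: is_one.cases) auto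
  have k: "is_one (excess w) \<longleftrightarrow> dels w = 2" for w
    unfolding t excess_eq by arith
  show ?thesis
  proof (induction ws)
    case (Cons w ws)
    then show ?case unfolding double_words.simps keep_eq k by auto
  qed simp
qed

lemma gen_planes_ok_start:
  assumes "plane2 g" "total2 g \<le> 7" "fst ` set us = UNIV" "distinct (map fst us)"
    and "\<And>i a b. (i, a, b) \<in> set us \<Longrightarrow>
      (dels (word (g i)) = 1 \<longrightarrow> word (g i) \<in> set a) \<and> (dels (word (g i)) = 2 \<longrightarrow> word (g i) \<in> set b)"
  shows "gen_ok g [] us"
proof -
  have c: "dels (word (g i)) = 1 \<or> dels (word (g i)) = 2" for i
    using plane2_ge1[OF assms(1), of i] row_le2[OF assms(1,2), of i] by linarith
  have c2: "dels (word (g i)) = 1 \<or> dels (word (g j)) = 1" if "i \<noteq> j" for i j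
    using double_words_rows[OF assms(1,2) that] c[of i] c[of j] by linarith
  show ?thesis
    unfolding gen_ok_def
  proof (intro conjI ballI)
    fix u assume "u \<in> set us"
    moreover obtain i a b where "u = (i, a, b)" by (cases u) auto
    ultimately show "case u of (i, a, b) \<Rightarrow> word (g i) \<in> set a \<or> word (g i) \<in> set b"
      using assms(5) c by auto
  next
    fix u assume uv: "u \<in> set us"
    obtain i a b where e: "u = (i, a, b)" by (cases u) auto
    show "case u of (i, a, b) \<Rightarrow> \<forall>(j, a', b') \<in> set us. i \<noteq> j \<longrightarrow> word (g i) \<in> set a \<or> word (g j) \<in> set a'"
      unfolding e prod.case
    proof clarify
      fix j a' b' assume "(j, a', b') \<in> set us" "i \<noteq> j" "word (g j) \<notin> set a'"
      then show "word (g i) \<in> set a"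
        using c2 assms(5)[OF uv[unfolded e]] assms(5)[of j a' b'] by blast
    qed
  qed (use assms(3,4) in auto)
qed

lemma map_fst_insw [simp]: "map fst (forbid_word w cs) = map fst cs"
  by (induction w cs rule: forbid_word.induct) auto

lemma map_fst_inswif [simp]: "map fst (forbid_word_if t w cs) = map fst cs"
  by (cases t) auto

lemma forbid_word_Cons [simp]: "forbid_word (c # w) ((i, f) # cs) = (i, forbid c f) # forbid_word w cs"
  by (cases c; cases f) auto

lemma allowed_insw:
  assumes "allowed f cs" "map fst cs = indices" "\<And>i. compat (h i) (f i)"
  shows "allowed f (forbid_word (word h) cs)"
proof -
  have "allowed f (forbid_word (map h is) cs)" if "map fst cs = is" "allowed f cs" for "is" cs
    using that
  proof (induction "is" arbitrary: cs)
    case (Cons i js)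
    then show ?case by (cases cs) (auto intro!: admits_ins assms(3))
  qed simp
  from this[OF assms(2,1)] show ?thesis by (simp add: word_xsi)
qed

lemma allowed_inswif:
  "allowed f cs \<Longrightarrow> map fst cs = indices \<Longrightarrow> (t \<Longrightarrow> \<forall>i. compat (h i) (f i)) \<Longrightarrow> allowed f (forbid_word_if t (word h) cs)"
  by (cases t) (auto intro!: allowed_insw)

lemma line_choice_ok:
  assumes "line f" "allowed f cs" "map fst cs = indices" "line_choice i cs = (j, a, b)"
  shows "j = i" "dels (word f) = 1 \<Longrightarrow> word f \<in> set a" "dels (word f) = 2 \<Longrightarrow> word f \<in> set b"
  using words_upto_complete[OF assms(1-3), of "Suc 0"] words_upto_complete[OF assms(1-3), of "Suc (Suc 0)"] assms(4)
  by (auto simp: line_choice_def)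

lemma lines_beside_aux_eq: "lines_beside_aux t p k j js = (if t then lines_beside p k js else line_choice j (forbid_word_if (adj p j) k free_cells) # lines_beside p k js)"
  by (cases t) auto

lemma lines_beside_ok:
  assumes "plane2 g" "(i, a, b) \<in> set (lines_beside p (word (g p)) js)"
  shows "(dels (word (g i)) = 1 \<longrightarrow> word (g i) \<in> set a) \<and> (dels (word (g i)) = 2 \<longrightarrow> word (g i) \<in> set b)"
  using assms(2)
proof (induction js)
  case (Cons j js)
  have l: "line (g j)" using assms(1) by (simp add: plane2_def)
  have admits: "allowed (g j) (forbid_word_if (adj p j) (word (g p)) free_cells)"
    by (rule allowed_inswif[OF allowed_cells0 map_fst_cells0]) (use plane2_cmp[OF assms(1)] in auto)
  have m: "map fst (forbid_word_if (adj p j) (word (g p)) free_cells) = indices"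
    by (simp add: map_fst_cells0)
  consider "(i, a, b) \<in> set (lines_beside p (word (g p)) js)"
    | "line_choice j (forbid_word_if (adj p j) (word (g p)) free_cells) = (i, a, b)"
    using Cons.prems by (auto simp: lines_beside_aux_eq split: if_splits)
  then show ?case
  proof cases
    case 2
    then show ?thesis using line_choice_ok[OF l admits m 2] by blast
  qed (use Cons.IH in blast)
qed simp

lemma fst_linesk: "map fst (lines_beside p k js) = filter (\<lambda>j. j \<noteq> p) js"
  by (induction js) (auto simp: lines_beside_aux_eq line_choice_def)

lemma fixed_line_eq: "fixed_line p k n = (p, if n = 0 then [k] else [], if n = 0 then [] else [k])"
  by (cases n) auto

lemma allin_iff [simp]: "allin f Ps \<longleftrightarrow> (\<forall>P \<in> set Ps. f P)"
  by (induction Ps) auto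

lemma tabokD:
  assumes "table_complete f p ks" "plane2 g" "total2 g \<le> 7" "word (g p) \<in> set ks"
  shows "f (grid g)"
proof -
  let ?k = "word (g p)"
  let ?us = "fixed_line p ?k (excess ?k) # lines_beside p ?k indices"
  have "allin f (gen_planes fuel7 [] ?us)"
    using assms(1,4) by (induction ks) auto
  moreover have "grid g \<in> set (gen_planes fuel7 [] ?us)"
  proof (rule gen_planes_complete[OF assms(2)])
    show "gen_ok g [] ?us"
    proof (rule gen_planes_ok_start[OF assms(2,3)])
      have "fst ` set ?us = insert p (set (map fst (lines_beside p ?k indices)))"
        by (simp add: fixed_line_eq)
      then show "fst ` set ?us = UNIV"
        unfolding fst_linesk by (auto simp: set_xsi)
      show "distinct (map fst ?us)"
        by (simp add: fst_linesk fixed_line_eq) (simp add: indices_def)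
      fix i a b assume "(i, a, b) \<in> set ?us"
      then show "(dels (word (g i)) = 1 \<longrightarrow> word (g i) \<in> set a) \<and> (dels (word (g i)) = 2 \<longrightarrow> word (g i) \<in> set b)"
        using lines_beside_ok[OF assms(2)] by (auto simp: fixed_line_eq excess_eq split: if_splits)
    qed
    have "length (lines_beside p ?k indices) = length (filter (\<lambda>j. j \<noteq> p) indices)"
      by (metis fst_linesk length_map)
    also have "\<dots> \<le> 5" by (cases p) (simp_all add: indices_def)
    finally show "length ?us < fuel7" by (simp add: fuel7_def)
  qed
  ultimately show ?thesis by auto
qed

section \<open>Symmetries\<close>

text \<open>The inverse is an explicit argument because candidates are carried back by it;
  \<open>dihedral\<close> and \<open>recolourings\<close> list each symmetry with its
  inverse.\<close>

definition aut :: "(ix \<Rightarrow> ix) \<Rightarrow> (ix \<Rightarrow> ix) \<Rightarrow> bool" where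
  "aut f h \<longleftrightarrow> (\<forall>i. f (h i) = i) \<and> (\<forall>i. h (f i) = i) \<and> (\<forall>i j. adj (f i) (f j) = adj i j)"

definition colaut :: "(col \<Rightarrow> col) \<Rightarrow> (col \<Rightarrow> col) \<Rightarrow> bool" where
  "colaut k m \<longleftrightarrow> (\<forall>c. m (k c) = c) \<and> (\<forall>c. k (m c) = c) \<and> k D = D"

lemma aut_bij: "aut f h \<Longrightarrow> bij f"
  unfolding aut_def by (metis bijI')

lemma colaut_D: "colaut k m \<Longrightarrow> k c = D \<longleftrightarrow> c = D"
  unfolding colaut_def by metis

lemma colaut_ok: "colaut k m \<Longrightarrow> compat (k a) (k b) = compat a b"
  by (metis colaut_def colaut_D compat_iff)

lemma sum_aut: "aut f h \<Longrightarrow> (\<Sum>i\<in>UNIV. Q (f i)) = (\<Sum>i\<in>UNIV. Q i)"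
  using sum.reindex_bij_betw[OF aut_bij] by blast

lemma line_aut: "aut f h \<Longrightarrow> colaut k m \<Longrightarrow> line r \<Longrightarrow> line (\<lambda>i. k (r (f i)))"
  by (auto simp: line_def colaut_ok aut_def)

lemma dels_aut: "aut f h \<Longrightarrow> colaut k m \<Longrightarrow> dels (word (\<lambda>i. k (r (f i)))) = dels (word r)"
  unfolding dels_lst using sum_aut[of f h "\<lambda>i. if r i = D then 1 else 0"] by (simp add: colaut_D)

lemma aut_id: "aut id id" "colaut id id"
  by (auto simp: aut_def colaut_def)

lemma plane2_aut:
  assumes "aut f h" "aut f' h'" "colaut k m" "plane2 g"
  shows "plane2 (\<lambda>i j. k (g (f i) (f' j)))"
  unfolding plane2_def
proof (intro conjI allI)
  show "line (\<lambda>j. k (g (f i) (f' j)))" for i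
    using line_aut[OF assms(2,3), of "g (f i)"] assms(4) by (simp add: plane2_def)
  show "line (\<lambda>i. k (g (f i) (f' j)))" for j
    using line_aut[OF assms(1,3), of "\<lambda>i. g i (f' j)"] assms(4) by (simp add: plane2_def)
qed

lemma total2_aut:
  assumes "aut f h" "aut f' h'" "colaut k m"
  shows "total2 (\<lambda>i j. k (g (f i) (f' j))) = total2 g"
proof -
  have "dels (word (\<lambda>j. k (g (f i) (f' j)))) = dels (word (g (f i)))" for i
    using dels_aut[OF assms(2,3), of "g (f i)"] .
  then show ?thesis
    unfolding total2_def using sum_aut[OF assms(1), of "\<lambda>i. dels (word (g i))"] by simp
qed

lemma dihedral_aut:
  "(perm_list, rho) \<in> set dihedral \<Longrightarrow> perm_list = word (\<lambda>i. sel i perm_list) \<and> rho = word (\<lambda>i. sel i rho) \<and> aut (\<lambda>i. sel i perm_list) (\<lambda>i. sel i rho)"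
  unfolding dihedral_def aut_def by (auto simp: word_def all_ix)

lemma all_col: "(\<forall>c. P c) \<longleftrightarrow> P D \<and> P R \<and> P G \<and> P B"
  by (metis col.exhaust)

lemma recolourings_colaut: "(k, m) \<in> set recolourings \<Longrightarrow> colaut (recolour k) (recolour m)"
  unfolding recolourings_def colaut_def all_col by auto

lemma perm_lst: "perm (word f) (word r) = word (\<lambda>i. r (f i))"
  by (simp add: word_def) (simp flip: word_def)

lemma recolour_word_lst: "recolour_word k (word r) = word (\<lambda>i. recolour k (r i))"
  by (simp add: word_def)

lemma recolour_plane_lst2: "recolour_plane k (grid g) = grid (\<lambda>i j. recolour k (g i j))"
  unfolding grid_def by (subst word_def) (simp add: recolour_word_lst, simp add: word_def)

lemma map_back_eq: "map_back r m ps = map (\<lambda>p. recolour_plane m (perm r p)) ps"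
  by (induction ps) auto

definition hint_ok :: "hint \<Rightarrow> col list \<Rightarrow> bool" where
  "hint_ok h v \<longleftrightarrow> (case h of Hint perm_list k rho m w \<Rightarrow>
     (perm_list, rho) \<in> set dihedral \<and> (k, m) \<in> set recolourings \<and> w = recolour_word k (perm perm_list v) \<and> w \<in> set keys)"

lemma hints_recolour_aux_eq: "hints_recolour_aux v perm_list rho (k, m) hs = (if v \<in> set keys then [Hint perm_list k rho m v] else hs)"
  by (cases "v \<in> set keys") auto

lemma hints_recolour_ok:
  assumes "(perm_list, rho) \<in> set dihedral" "set ks \<subseteq> set recolourings" "h \<in> set (hints_recolour perm_list rho (perm perm_list v) ks hs)"
  shows "hint_ok h v \<or> h \<in> set hs"
  using assms(2,3)
proof (induction ks)
  case (Cons x ks)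
  obtain k m where x: "x = (k, m)" by force
  show ?case
    using Cons assms(1) by (auto simp: x hints_recolour_aux_eq hint_ok_def simp del: hints_recolour_aux.simps split: if_splits)
qed simp

lemma find_hints_ok: "set ps \<subseteq> set dihedral \<Longrightarrow> h \<in> set (find_hints v ps) \<Longrightarrow> hint_ok h v"
proof (induction ps)
  case (Cons p ps)
  obtain perm_list rho where p: "p = (perm_list, rho)" by force
  show ?case using Cons hints_recolour_ok[of perm_list rho recolourings h v] by (auto simp: p)
qed simp

fun all_have_hint :: "col list list \<Rightarrow> bool" and all_have_hint_aux where
  "all_have_hint [] = True" | "all_have_hint (w # ws) = all_have_hint_aux (find_hints w dihedral) ws"
| "all_have_hint_aux [] ws = False" | "all_have_hint_aux (h # hs) ws = all_have_hint ws"

lemma all_have_hint_aux_iff: "all_have_hint_aux hs ws \<longleftrightarrow> hs \<noteq> [] \<and> all_have_hint ws"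
  by (cases hs) auto

lemma allwD: "all_have_hint ws \<Longrightarrow> w \<in> set ws \<Longrightarrow> find_hints w dihedral \<noteq> []"
  by (induction ws) (auto simp: all_have_hint_aux_iff simp del: find_hints.simps)

text \<open>The seven keys meet the orbit of every proper word with at most two deletions.\<close>

lemma all_words_hint: "all_have_hint (words_upto (Suc (Suc 0)) free_cells)"
  by code_simp

definition the_hint :: "col list \<Rightarrow> hint" where
  "the_hint v = first (find_hints v dihedral)"

lemma first_mem: "xs \<noteq> [] \<Longrightarrow> first xs \<in> set xs"
  by (cases xs) auto

lemma the_hint_ok:
  assumes "line f" "dels (word f) \<le> 2"
  shows "hint_ok (the_hint (word f)) (word f)"
proof -
  have "word f \<in> set (words_upto (Suc (Suc 0)) free_cells)"
    using assms by (intro words_upto_complete) (auto simp: allowed_cells0 map_fst_cells0)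
  from find_hints_ok[OF subset_refl first_mem[OF allwD[OF all_words_hint this]]]
  show ?thesis by (simp add: the_hint_def)
qed

text \<open>Empty rows are claims as well: for instance, no plane with at most seven deletions has a
  hub line whose hub vertex is deleted.\<close>

lemma tabH_ok: "table_complete in_tabH I5 keys"
  by code_simp

lemma tabN_ok: "table_complete in_tabN I0 keys"
  by code_simp

definition layers :: "bool \<Rightarrow> ix \<times> ix" where
  "layers h = (if h then (I5, I0) else (I0, I1))"

text \<open>Normalising the first known line moves \<open>g\<close> to a plane in the table, and the
  inverse symmetry brings the entry back to \<open>g\<close>.\<close>

lemma candidates_complete:
  assumes "plane2 g" "total2 g \<le> 7" "hint_ok hi (word (\<lambda>y. g y (fst (layers h))))"
  shows "grid g \<in> set (candidates h hi (word (\<lambda>y. g y (snd (layers h)))))"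
proof -
  obtain perm_list k rho m w where hi: "hi = Hint perm_list k rho m w" by (cases hi)
  define f f' where "f = (\<lambda>i. sel i perm_list)" and "f' = (\<lambda>i. sel i rho)"
  have h: "perm_list = word f" "rho = word f'" "aut f f'" "colaut (recolour k) (recolour m)" "w \<in> set keys"
    "w = recolour_word k (perm perm_list (word (\<lambda>y. g y (fst (layers h)))))"
    using assms(3) dihedral_aut[of perm_list rho] recolourings_colaut[of k m] by (auto simp: hint_ok_def hi f_def f'_def)
  \<comment> \<open>The layer coordinate comes first, since the keys are lines of the layers; only
    positions within a layer are permuted.\<close>
  define g' where "g' = (\<lambda>z y. recolour k (g (f y) z))"
  have "plane2 g'"
    unfolding g'_def using plane2_aut[OF aut_id(1) h(3,4) plane2_transp[OF assms(1)]] by simp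
  moreover have "total2 g' = total2 (\<lambda>z y. g y z)"
    unfolding g'_def using total2_aut[OF aut_id(1) h(3,4), of "\<lambda>z y. g y z"] by simp
  ultimately have g': "plane2 g'" "total2 g' \<le> 7"
    using total2_transp[of g] assms(2) by simp_all
  have w: "w = word (g' (fst (layers h)))"
    by (simp add: h(1,6) perm_lst recolour_word_lst g'_def)
  have v: "recolour_word k (perm perm_list (word (\<lambda>y. g y (snd (layers h))))) = word (g' (snd (layers h)))"
    by (simp add: h(1) perm_lst recolour_word_lst g'_def)
  \<comment> \<open>In the stored form the position is outermost again, so the inverse permutation
    acts on the outer list.\<close>
  have b: "recolour_plane m (perm rho (grid (\<lambda>i j. g' j i))) = grid g"
  proof -
    have "perm rho (grid (\<lambda>i j. g' j i)) = grid (\<lambda>i j. g' j (f' i))"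
      unfolding grid_def h(2) by (simp add: perm_lst)
    then show ?thesis
      using h(3,4) by (simp add: recolour_plane_lst2 g'_def aut_def colaut_def)
  qed
  show ?thesis
  proof (cases h)
    case True
    then have "in_tabH (grid g')"
      using tabokD[OF tabH_ok g'] h(5) w by (simp add: layers_def)
    then have "recolour_plane m (perm rho (grid (\<lambda>i j. g' j i))) \<in> set (candidates h hi (word (\<lambda>y. g y (snd (layers h)))))"
      using True v w by (simp add: hi in_tabH_def map_back_eq layers_def)
    then show ?thesis by (simp add: b)
  next
    case False
    then have "in_tabN (grid g')"
      using tabokD[OF tabN_ok g'] h(5) w by (simp add: layers_def)
    then have "recolour_plane m (perm rho (grid (\<lambda>i j. g' j i))) \<in> set (candidates h hi (word (\<lambda>y. g y (snd (layers h)))))"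
      using False v w by (simp add: hi in_tabN_def map_back_eq layers_def)
    then show ?thesis by (simp add: b)
  qed
qed

section \<open>Soundness of the search\<close>

definition total3 :: "(ix \<Rightarrow> ix \<Rightarrow> ix \<Rightarrow> col) \<Rightarrow> nat" where
  "total3 c = (\<Sum>x\<in>UNIV. total2 (c x))"

definition proper3 :: "(ix \<Rightarrow> ix \<Rightarrow> ix \<Rightarrow> col) \<Rightarrow> bool" where
  "proper3 c \<longleftrightarrow> (\<forall>x y z x'. adj x x' \<longrightarrow>
     compat (c x y z) (c x' y z) \<and> compat (c y x z) (c y x' z) \<and> compat (c y z x) (c y z x'))"

text \<open>\<open>P\<close> says that a state describes a given object. Since \<open>P\<close>
  always passes to some successor, a finite refutation tree cannot start at such a state.\<close>

lemma search_sound: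
  assumes "\<And>s. P s \<Longrightarrow> \<exists>w \<in> set (snd (ch s)). P (ap (fst (ch s)) w)"
  shows "search ch ap n s \<Longrightarrow> \<not> P s"
proof (induction n arbitrary: s)
  case (Suc n)
  have s: "search_all ap f (c, ws) \<longleftrightarrow> (\<forall>w \<in> set ws. f (ap c w))" for f c ws
    by (induction ws) auto
  show ?case
  proof
    assume "P s"
    from assms[OF this] Suc show False
      by (metis prod.collapse s search.simps(2))
  qed
qed simp

lemma le_eq [simp]: "le m n \<longleftrightarrow> m \<le> n"
  by (induction m n rule: le.induct) auto

lemma sb_eq [simp]: "sb m n = m - n"
  by (induction m n rule: sb.induct) auto

lemma mn_eq [simp]: "mn m n = min m n"
  by (induction m n rule: mn.induct) auto

lemma forced_deletions_aux_eq [simp]: "forced_deletions_aux r g b cs = (if r \<and> g \<and> b then Suc (forced_deletions cs) else forced_deletions cs)"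
  by (cases r; cases g; cases b) auto

lemma forced_deletions_le: "allowed f cs \<Longrightarrow> forced_deletions cs \<le> dels (map (f \<circ> fst) cs)"
proof (induction cs)
  case (Cons a cs)
  obtain i d r g b where a: "a = (i, Forbid d r g b)" by (metis palette.exhaust prod.exhaust)
  show ?case using Cons by (cases "f i") (auto simp: a)
qed simp

lemma forced_excess_le: "allowed f cs \<Longrightarrow> forced_excess cs \<le> dels (map (f \<circ> fst) cs) - 1"
proof (induction cs)
  case (Cons a cs)
  obtain i d r g b where a: "a = (i, Forbid d r g b)" by (metis palette.exhaust prod.exhaust)
  have l: "forced_excess cs \<le> dels (map (f \<circ> fst) cs) - 1" using Cons by (simp add: a comp_def)
  show ?case
  proof (cases "r \<and> g \<and> b")
    case True
    then have "f i = D" using Cons.prems by (cases "f i") (auto simp: a)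
    then show ?thesis using True forced_deletions_le[of f cs] Cons.prems by (simp add: a comp_def)
  next
    case False
    then have "forced_excess (a # cs) = forced_excess cs" by (cases r; cases g; cases b) (auto simp: a)
    then show ?thesis using l by (auto simp: a comp_def)
  qed
qed simp

definition plane_of :: "(ix \<Rightarrow> ix \<Rightarrow> ix \<Rightarrow> col) \<Rightarrow> key \<Rightarrow> ix \<Rightarrow> ix \<Rightarrow> col" where
  "plane_of c k = (case k of X i \<Rightarrow> c i | Y j \<Rightarrow> (\<lambda>x. c x j))"

definition col_excess :: "(ix \<Rightarrow> ix \<Rightarrow> ix \<Rightarrow> col) \<Rightarrow> ix \<Rightarrow> ix \<Rightarrow> nat" where
  "col_excess c x y = dels (word (c x y)) - 1"

definition row_excess :: "(ix \<Rightarrow> ix \<Rightarrow> ix \<Rightarrow> col) \<Rightarrow> ix \<Rightarrow> (ix \<times> cells) list \<Rightarrow> nat" where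
  "row_excess c x us = sum_list (map (\<lambda>(y, _). col_excess c x y) us)"

definition rows_excess :: "(ix \<Rightarrow> ix \<Rightarrow> ix \<Rightarrow> col) \<Rightarrow> open_row list \<Rightarrow> nat" where
  "rows_excess c rs = sum_list (map (\<lambda>(x, u, us). row_excess c x us) rs)"

definition row_ok :: "(ix \<Rightarrow> ix \<Rightarrow> ix \<Rightarrow> col) \<Rightarrow> ix \<Rightarrow> (ix \<times> cells) list \<Rightarrow> bool" where
  "row_ok c x us \<longleftrightarrow> (\<forall>(y, cs) \<in> set us. allowed (c x y) cs \<and> map fst cs = indices)"

text \<open>Candidate lists are only required to contain planes with exactly seven deletions, as
  charging covers the others. A leaf keeps of the colouring just the allowed cells and the excess
  bounds.\<close>

fun state_ok :: "(ix \<Rightarrow> ix \<Rightarrow> ix \<Rightarrow> col) \<Rightarrow> state \<Rightarrow> bool" where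
  "state_ok c (Main (h, P, Q) undecided fx ch) \<longleftrightarrow>
     P = grid (\<lambda>x y. c x y (fst (layers h))) \<and> Q = grid (\<lambda>x y. c x y (snd (layers h))) \<and>
     (\<forall>(k, ps) \<in> set undecided. total2 (plane_of c k) = 7 \<longrightarrow> grid (plane_of c k) \<in> set ps) \<and>
     (\<forall>(k, p) \<in> set fx. p = grid (plane_of c k)) \<and>
     (\<forall>k \<in> set ch. total2 (plane_of c k) \<ge> 8) \<and>
     distinct (map fst undecided @ map fst fx @ ch)"
| "state_ok c (Leaf m s t rs) \<longleftrightarrow>
     (\<forall>(x, u, us) \<in> set rs. row_ok c x us \<and> u + row_excess c x us \<le> m) \<and> t + rows_excess c rs \<le> s"

text \<open>\<open>seven\<close> is discharged later by \<open>total2_ge7\<close>, a consequence of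
  the table certificates.\<close>

context
  fixes c :: "ix \<Rightarrow> ix \<Rightarrow> ix \<Rightarrow> col"
  assumes proper: "proper3 c" and t45: "total3 c \<le> 45"
    and seven: "\<And>g. plane2 g \<Longrightarrow> total2 g \<ge> 7"
begin

lemma plane2_dekey: "plane2 (plane_of c k)"
  using proper by (cases k) (auto simp: plane_of_def plane2_def proper3_def line_def)

lemma plane2_layer: "plane2 (\<lambda>x y. c x y z)"
  using proper by (auto simp: plane2_def proper3_def line_def)

lemma line_column: "line (c x y)"
  using proper by (auto simp: proper3_def line_def)

lemma forced_row_le: "row_ok c x us \<Longrightarrow> forced_row us \<le> row_excess c x us"
proof (induction us)
  case (Cons u us)
  obtain y cs where u: "u = (y, cs)" by force
  have "map (c x y \<circ> fst) cs = word (c x y)"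
    using Cons.prems by (auto simp: u row_ok_def word_xsi simp flip: map_map)
  then have "forced_excess cs \<le> col_excess c x y"
    using Cons.prems forced_excess_le[of "c x y" cs] by (simp add: u row_ok_def col_excess_def)
  then show ?case using Cons by (simp add: u row_ok_def row_excess_def)
qed simp

lemma forced_rows_le: "\<forall>(x, u, us) \<in> set rs. row_ok c x us \<Longrightarrow> forced_rows rs \<le> rows_excess c rs"
proof (induction rs)
  case (Cons r rs)
  obtain x u us where r: "r = (x, u, us)" by (cases r) auto
  show ?case using Cons forced_row_le[of x us] by (simp add: r rows_excess_def)
qed simp

lemma forbid_in_row_ok: "row_ok c x us \<Longrightarrow> row_ok c x (forbid_in_row y (word (c x y)) us) \<and> row_excess c x (forbid_in_row y (word (c x y)) us) = row_excess c x us"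
proof (induction us)
  case (Cons u us)
  obtain j cs where u: "u = (j, cs)" by force
  have "allowed (c x j) (forbid_word_if (adj j y) (word (c x y)) cs)"
    using Cons.prems proper by (intro allowed_inswif) (auto simp: u row_ok_def proper3_def adj_sym[of j y])
  then show ?case using Cons by (auto simp: u row_ok_def row_excess_def)
qed (simp add: row_ok_def)

lemma forbid_in_column_ok: "row_ok c i us \<Longrightarrow> adj i x \<Longrightarrow>
  row_ok c i (forbid_in_column y (word (c x y)) us) \<and> row_excess c i (forbid_in_column y (word (c x y)) us) = row_excess c i us"
proof (induction us)
  case (Cons u us)
  obtain j cs where u: "u = (j, cs)" by force
  have "allowed (c i j) (forbid_word_if (same_index j y) (word (c x y)) cs)"
    using Cons.prems proper by (intro allowed_inswif) (auto simp: u row_ok_def proper3_def adj_sym[of i x])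
  then show ?case using Cons by (auto simp: u row_ok_def row_excess_def simp del: same_index_iff)
qed (simp add: row_ok_def row_excess_def)

lemma forbid_in_rows_ok:
  assumes "\<forall>(x, u, us) \<in> set rs. row_ok c x us \<and> u + row_excess c x us \<le> m"
  shows "(\<forall>(i, u, us) \<in> set (forbid_in_rows x y (word (c x y)) rs). row_ok c i us \<and> u + row_excess c i us \<le> m) \<and>
    rows_excess c (forbid_in_rows x y (word (c x y)) rs) = rows_excess c rs"
  using assms
proof (induction rs)
  case (Cons r rs)
  obtain i u us where r: "r = (i, u, us)" by (cases r) auto
  have "row_ok c i (forbid_in_column_if (adj i x) y (word (c x y)) us) \<and>
    row_excess c i (forbid_in_column_if (adj i x) y (word (c x y)) us) = row_excess c i us"
    using Cons.prems forbid_in_column_ok[of i us x y] by (cases "adj i x") (auto simp: r)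
  then show ?case using Cons by (auto simp: r rows_excess_def)
qed (simp add: rows_excess_def)

lemma word_choices_eq: "word_choices ws = map Word ws" by (induction ws) auto
lemma plane_choices_eq: "plane_choices ps = map Plane ps" by (induction ps) auto

lemma leaf_step:
  assumes "state_ok c (Leaf m s t rs)"
  shows "\<exists>w \<in> set (snd (choices (Leaf m s t rs))). state_ok c (apply_choice (fst (choices (Leaf m s t rs))) w)"
proof -
  have l: "forced_rows rs + t \<le> s"
    using assms forced_rows_le[of rs] by (fastforce simp: case_prod_beta)
  show ?thesis
  proof (cases rs)
    case Nil
    then show ?thesis using assms l by simp
  next
    case (Cons r rs')
    obtain x u us where r: "r = (x, u, us)" by (cases r) auto
    show ?thesis
    proof (cases us)
      case Nil
      then show ?thesis using assms l Cons r by (simp add: rows_excess_def row_excess_def)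
    next
      case us: (Cons v us')
      obtain y cs where v: "v = (y, cs)" by force
      let ?w = "word (c x y)"
      have a: "allowed (c x y) cs" "map fst cs = indices" "row_ok c x us'"
        "u + (col_excess c x y + row_excess c x us') \<le> m" "t + (col_excess c x y + row_excess c x us' + rows_excess c rs') \<le> s"
        "\<forall>(x, u, us) \<in> set rs'. row_ok c x us \<and> u + row_excess c x us \<le> m"
        using assms by (auto simp: Cons r us v row_ok_def row_excess_def rows_excess_def)
      have e: "excess ?w = col_excess c x y" "dels ?w = Suc (col_excess c x y)"
        using line_ge1[OF line_column, of x y] by (auto simp: col_excess_def excess_eq)
      have b: "forced_row us' \<le> row_excess c x us'" "forced_rows rs' \<le> rows_excess c rs'"
        using forced_row_le[OF a(3)] forced_rows_le[of rs'] a(6) by (auto simp: case_prod_beta)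
      \<comment> \<open>\<open>a(4)\<close> gives the bound for the row and \<open>a(5)\<close> the
        one for the total, where \<open>b\<close> accounts for the excess forced in the other open
        columns.\<close>
      have "?w \<in> set (words_upto (Suc (min (m - u) (forced_excess cs + s - (forced_rows rs + t)))) cs)"
        using a(4,5) b e by (intro words_upto_complete[OF line_column a(1,2)]) (auto simp: Cons r us v)
      moreover have "state_ok c (apply_choice (CLeaf m s t x u y us' rs') (Word ?w))"
        using a forbid_in_row_ok[OF a(3), of y] forbid_in_rows_ok[OF a(6), of x y] e
        by (auto simp: rows_excess_def)
      ultimately show ?thesis using l by (auto simp: Cons r us v word_choices_eq)
    qed
  qed
qed

section \<open>Surplus of parallel planes over seven deletions\<close>

definition plane_excess :: "key \<Rightarrow> nat" where
  "plane_excess k = total2 (plane_of c k) - 7"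

lemma total_Y: "(\<Sum>j\<in>UNIV. total2 (plane_of c (Y j))) = total3 c"
  by (simp add: total3_def total2_def plane_of_def sum_ix)

text \<open>Six parallel planes use at least 42 of at most 45 deletions.\<close>

lemma sum_exc7: "(\<Sum>i\<in>UNIV. plane_excess (X i)) \<le> 3" "(\<Sum>i\<in>UNIV. plane_excess (Y i)) \<le> 3"
proof -
  have a: "total2 (plane_of c k) = plane_excess k + 7" for k
    using seven[OF plane2_dekey, of k] by (simp add: plane_excess_def)
  have x: "total3 c = (\<Sum>i\<in>UNIV. total2 (plane_of c (X i)))"
    by (simp add: total3_def plane_of_def)
  show "(\<Sum>i\<in>UNIV. plane_excess (X i)) \<le> 3"
    using x t45 unfolding a sum_ix by simp
  show "(\<Sum>i\<in>UNIV. plane_excess (Y i)) \<le> 3"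
    using total_Y t45 unfolding a sum_ix by simp
qed

lemma sum_list_exc7:
  assumes "distinct xs" "Z = X \<or> Z = Y"
  shows "sum_list (map (\<lambda>i. plane_excess (Z i)) xs) \<le> 3"
proof -
  have "sum_list (map (\<lambda>i. plane_excess (Z i)) xs) = (\<Sum>i\<in>set xs. plane_excess (Z i))"
    using assms by (simp add: sum_list_distinct_conv_sum_set)
  also have "\<dots> \<le> (\<Sum>i\<in>UNIV. plane_excess (Z i))"
    by (rule sum_mono2) auto
  finally show ?thesis using sum_exc7 assms(2) by auto
qed

text \<open>The six columns of a plane discount six deletions, while its surplus discounts
  seven.\<close>

lemma sum_ex: "(\<Sum>y\<in>UNIV. col_excess c x y) = plane_excess (X x) + 1"
proof -
  have "(\<Sum>y\<in>UNIV. col_excess c x y + 1) = total2 (plane_of c (X x))"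
    unfolding total2_def plane_of_def
  proof (intro sum.cong refl, simp only: key.case)
    fix y show "col_excess c x y + 1 = dels (word (c x y))"
      using line_ge1[OF line_column, of x y] by (simp add: col_excess_def)
  qed
  also have "\<dots> = plane_excess (X x) + 7"
    using seven[OF plane2_dekey, of "X x"] by (simp add: plane_excess_def)
  finally show ?thesis by (simp add: sum_ix)
qed

lemma set_xs_of: "set (charged_xs ch) = {i. X i \<in> set ch}"
  by (induction ch rule: charged_xs.induct) auto

lemma set_ys_of: "set (charged_ys ch) = {i. Y i \<in> set ch}"
  by (induction ch rule: charged_ys.induct) auto

lemma distinct_xs_of: "distinct ch \<Longrightarrow> distinct (charged_xs ch)"
  by (induction ch rule: charged_xs.induct) (auto simp: set_xs_of)

lemma distinct_ys_of: "distinct ch \<Longrightarrow> distinct (charged_ys ch)"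
  by (induction ch rule: charged_ys.induct) (auto simp: set_ys_of)

lemma base_column_ok:
  "allowed (c x y) (base_column (h, grid (\<lambda>x y. c x y (fst (layers h))), grid (\<lambda>x y. c x y (snd (layers h)))) x y)"
  using line_column[of x y] by (cases h) (auto simp: layers_def line_def intro!: admits_ins)

lemma map_fst_bcol: "map fst (base_column (h, P, Q) x y) = indices"
  by (cases h) (auto simp: indices_def)

lemma map_fst_addnb [simp]: "map fst (forbid_neighbours x y fx cs) = map fst cs"
  by (induction x y fx cs rule: forbid_neighbours.induct) auto

lemma forbid_neighbours_ok:
  "\<forall>(k, p) \<in> set fx. p = grid (plane_of c k) \<Longrightarrow> allowed (c x y) cs \<Longrightarrow> map fst cs = indices \<Longrightarrow>
    allowed (c x y) (forbid_neighbours x y fx cs)"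
proof (induction x y fx cs rule: forbid_neighbours.induct)
  case (2 x y i p fx cs)
  have "allowed (c x y) (forbid_word_if (adj i x) (word (c i y)) cs)"
    using 2 proper by (intro allowed_inswif) (auto simp: proper3_def)
  then show ?case using 2 by (auto simp: plane_of_def)
next
  case (3 x y j p fx cs)
  have "allowed (c x y) (forbid_word_if (adj j y) (word (c x j)) cs)"
    using 3 proper by (intro allowed_inswif) (auto simp: proper3_def)
  then show ?case using 3 by (auto simp: plane_of_def)
qed simp

lemma row_cells_ok:
  assumes "\<forall>(k, p) \<in> set fx. p = grid (plane_of c k)"
  shows "row_ok c x (row_cells (h, grid (\<lambda>x y. c x y (fst (layers h))), grid (\<lambda>x y. c x y (snd (layers h)))) fx x ys)"
  using forbid_neighbours_ok[OF assms base_column_ok map_fst_bcol]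
  by (induction ys) (auto simp: row_ok_def map_fst_bcol simp del: base_column.simps)

lemma row_excess_mkus: "row_excess c x (row_cells P fx x ys) = sum_list (map (col_excess c x) ys)"
  by (induction ys) (auto simp: row_excess_def)

lemma used_excess_eq:
  "\<forall>(k, p) \<in> set fx. p = grid (plane_of c k) \<Longrightarrow> used_excess x fx = sum_list (map (col_excess c x) (charged_ys (map fst fx)))"
  by (induction x fx rule: used_excess.induct) (auto simp: plane_of_def col_excess_def excess_eq)

lemma distinct_ys_of_append:
  "distinct (ks @ ch) \<Longrightarrow> distinct (charged_ys ks @ charged_ys ch)"
  by (auto simp: distinct_ys_of set_ys_of)

text \<open>Decided and charged indices are distinct, so the columns counted are different columns
  of the plane \<open>X x\<close>.\<close>

lemma row_bound:
  assumes "\<forall>(k, p) \<in> set fx. p = grid (plane_of c k)" "distinct (map fst fx @ ch)"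
  shows "used_excess x fx + row_excess c x (row_cells P fx x (charged_ys ch)) \<le> plane_excess (X x) + 1"
proof -
  have "used_excess x fx + row_excess c x (row_cells P fx x (charged_ys ch)) = sum_list (map (col_excess c x) (charged_ys (map fst fx) @ charged_ys ch))"
    by (simp add: used_excess_eq[OF assms(1)] row_excess_mkus)
  also have "\<dots> = (\<Sum>y \<in> set (charged_ys (map fst fx) @ charged_ys ch). col_excess c x y)"
    using distinct_ys_of_append[OF assms(2)] by (subst sum_list_distinct_conv_sum_set) auto
  also have "\<dots> \<le> (\<Sum>y\<in>UNIV. col_excess c x y)"
    by (rule sum_mono2) auto
  finally show ?thesis by (simp add: sum_ex)
qed

lemma row_cap_eq: "xs \<noteq> [] \<Longrightarrow> row_cap xs = (if length xs \<le> 3 then 5 - length xs else 2)"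
  by (cases xs rule: row_cap.cases) auto

lemma total_cap_eq: "total_cap xs = 3 + length xs"
  by (induction xs) auto

lemma open_rows_set: "r \<in> set (open_rows P fx xs ys) \<Longrightarrow> \<exists>x \<in> set xs. r = (x, used_excess x fx, row_cells P fx x ys)"
  by (induction xs) auto

lemma total_used_erows:
  "total_used (open_rows P fx xs ys) + rows_excess c (open_rows P fx xs ys) =
    sum_list (map (\<lambda>x. used_excess x fx + row_excess c x (row_cells P fx x ys)) xs)"
  by (induction xs) (auto simp: rows_excess_def)

lemma used_within_eq: "used_within m rs \<longleftrightarrow> (\<forall>(x, u, us) \<in> set rs. u \<le> m)"
  by (induction m rs rule: used_within.induct) auto

lemma leaf_init:
  assumes compat: "state_ok c (Main A [] fx ch)"
  shows "\<exists>w \<in> set (snd (choices (Main A [] fx ch))). state_ok c (apply_choice (fst (choices (Main A [] fx ch))) w)"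
proof -
  obtain h P Q where A: "A = (h, P, Q)" by (cases A)
  let ?xs = "charged_xs ch" and ?ys = "charged_ys ch"
  let ?rs = "open_rows A fx ?xs ?ys"
  have o: "P = grid (\<lambda>x y. c x y (fst (layers h)))" "Q = grid (\<lambda>x y. c x y (snd (layers h)))"
    "\<forall>(k, p) \<in> set fx. p = grid (plane_of c k)" "\<forall>k \<in> set ch. total2 (plane_of c k) \<ge> 8"
    "distinct (map fst fx @ ch)"
    using compat by (auto simp: A)
  have dx: "distinct ?xs" using o(5) distinct_xs_of by auto
  have e1: "plane_excess (X x) \<ge> 1" if "x \<in> set ?xs" for x
    using that o(4) by (force simp: set_xs_of plane_excess_def)
  have s3: "sum_list (map (\<lambda>i. plane_excess (X i)) ?xs) \<le> 3"
    using sum_list_exc7[OF dx] by blast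
  \<comment> \<open>Every other charged plane uses up at least one unit of the surplus 3.\<close>
  have cap: "plane_excess (X x) + 1 \<le> row_cap ?xs" if x: "x \<in> set ?xs" for x
  proof -
    have "sum_list (map (\<lambda>i. plane_excess (X i)) ?xs) = plane_excess (X x) + sum_list (map (\<lambda>i. plane_excess (X i)) (remove1 x ?xs))"
      using x by (rule sum_list_map_remove1)
    moreover have "sum_list (map (\<lambda>i. 1) (remove1 x ?xs)) \<le> sum_list (map (\<lambda>i. plane_excess (X i)) (remove1 x ?xs))"
      by (rule sum_list_mono) (use e1 dx in auto)
    moreover have "sum_list (map (\<lambda>i. 1) (remove1 x ?xs)) = length ?xs - 1"
      using x by (simp add: sum_list_triv length_remove1)
    ultimately have "plane_excess (X x) + (length ?xs - 1) \<le> 3" using s3 by simp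
    moreover have "?xs \<noteq> []" using x by auto
    ultimately show ?thesis using e1[OF x] by (cases "length ?xs") (auto simp: row_cap_eq)
  qed
  have rows: "row_ok c x us \<and> u + row_excess c x us \<le> row_cap ?xs" if r: "(x, u, us) \<in> set ?rs" for x u us
  proof -
    from open_rows_set[OF r] have x: "x \<in> set ?xs" "u = used_excess x fx" "us = row_cells A fx x ?ys" by auto
    show ?thesis
      using row_cells_ok[OF o(3), of x h ?ys] row_bound[OF o(3,5), of x A] cap[OF x(1)]
      by (simp add: x(2,3) A o(1,2))
  qed
  have "total_used ?rs + rows_excess c ?rs \<le> sum_list (map (\<lambda>x. plane_excess (X x) + 1) ?xs)"
    unfolding total_used_erows by (rule sum_list_mono) (rule row_bound[OF o(3,5)])
  also have "\<dots> = sum_list (map (\<lambda>x. plane_excess (X x)) ?xs) + length ?xs"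
    by (simp add: sum_list_Suc)
  also have "\<dots> \<le> total_cap ?xs"
    using s3 by (simp add: total_cap_eq)
  finally have "state_ok c (Leaf (row_cap ?xs) (total_cap ?xs) (total_used ?rs) ?rs)"
    using rows by auto
  moreover have "used_within (row_cap ?xs) ?rs"
    unfolding used_within_eq using rows by fastforce
  ultimately show ?thesis by simp
qed

lemma filter_adjacent_eq: "filter_adjacent t p ps = (if t then filter (compat_plane p) ps else ps)"
  by (induction t p ps rule: filter_adjacent.induct) auto

lemma filter_crossing_eq: "filter_crossing i w ps = filter (\<lambda>q. w = sel i q) ps"
  by (induction i w ps rule: filter_crossing.induct) auto

text \<open>Planes of one proper colouring are compatible with each other, so filtering by one of
  them keeps the others.\<close>

lemma filter_candidates_ok: "grid (plane_of c k') \<in> set ps \<Longrightarrow> grid (plane_of c k') \<in> set (filter_candidates k k' (grid (plane_of c k)) ps)"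
  using proper by (cases k; cases k') (auto simp: filter_adjacent_eq filter_crossing_eq plane_of_def proper3_def)

lemma filter_undecided_eq: "filter_undecided k p us = map (\<lambda>(k', ps). (k', filter_candidates k k' p ps)) us"
  by (induction us) auto

lemma pick_ok:
  "pick u us acc = (v, rest) \<Longrightarrow> set (v # rest) = set (u # us @ acc) \<and>
    (distinct (map fst (v # rest) @ zs) \<longleftrightarrow> distinct (map fst (u # us @ acc) @ zs))"
proof (induction us arbitrary: u acc)
  case (Cons w us)
  obtain k ps k' qs where uw: "u = (k, ps)" "w = (k', qs)" by (cases u; cases w) auto
  show ?case
  proof (cases "shorter qs ps")
    case True
    then have "pick w us (u # acc) = (v, rest)" using Cons.prems by (simp add: uw)
    from Cons.IH[OF this] show ?thesis by auto
  next
    case False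
    then have "pick u us (w # acc) = (v, rest)" using Cons.prems by (simp add: uw)
    from Cons.IH[OF this] show ?thesis by auto
  qed
next
  case Nil
  then show ?case by (cases u) auto
qed

lemma at_most_two_eq: "at_most_two xs \<longleftrightarrow> length xs \<le> 2"
  by (cases xs rule: at_most_two.cases) auto

lemma may_charge_ok:
  assumes "\<forall>k \<in> set (k # ch). total2 (plane_of c k) \<ge> 8" "distinct (k # ch)"
  shows "may_charge k ch"
proof -
  have e: "plane_excess k \<ge> 1" if "total2 (plane_of c k) \<ge> 8" for k
    using that by (simp add: plane_excess_def)
  have l: "length xs \<le> 3" if "distinct xs" "Z = X \<or> Z = Y" "\<And>i. i \<in> set xs \<Longrightarrow> plane_excess (Z i) \<ge> 1" for Z xs
  proof -
    have "sum_list (map (\<lambda>i. 1) xs) \<le> sum_list (map (\<lambda>i. plane_excess (Z i)) xs)"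
      by (rule sum_list_mono) (use that in auto)
    then show ?thesis using sum_list_exc7[OF that(1,2)] by (simp add: sum_list_triv)
  qed
  show ?thesis
  proof (cases k)
    case (X i)
    have "length (charged_xs (k # ch)) \<le> 3"
      by (rule l[of _ X]) (use assms distinct_xs_of[OF assms(2)] e in \<open>auto simp: set_xs_of\<close>)
    then show ?thesis by (simp add: X at_most_two_eq)
  next
    case (Y i)
    have "length (charged_ys (k # ch)) \<le> 3"
      by (rule l[of _ Y]) (use assms distinct_ys_of[OF assms(2)] e in \<open>auto simp: set_ys_of\<close>)
    then show ?thesis by (simp add: Y at_most_two_eq)
  qed
qed

text \<open>A plane with exactly seven deletions is among its candidates, and any other plane may be
  charged; either way one branch still describes \<open>c\<close>.\<close>

lemma main_step:
  assumes compat: "state_ok c (Main A (u # us) fx ch)"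
  shows "\<exists>w \<in> set (snd (choices (Main A (u # us) fx ch))). state_ok c (apply_choice (fst (choices (Main A (u # us) fx ch))) w)"
proof -
  obtain h P Q where A: "A = (h, P, Q)" by (cases A)
  obtain k ps rest where p: "pick u us [] = ((k, ps), rest)" by (metis prod.exhaust)
  have set: "set ((k, ps) # rest) = set (u # us)"
    and d: "distinct (map fst ((k, ps) # rest) @ map fst fx @ ch)"
    using pick_ok[OF p, of "map fst fx @ ch"] compat by (auto simp: A)
  have o: "P = grid (\<lambda>x y. c x y (fst (layers h)))" "Q = grid (\<lambda>x y. c x y (snd (layers h)))"
    "\<forall>(k, ps) \<in> set ((k, ps) # rest). total2 (plane_of c k) = 7 \<longrightarrow> grid (plane_of c k) \<in> set ps"
    "\<forall>(k, p) \<in> set fx. p = grid (plane_of c k)" "\<forall>k \<in> set ch. total2 (plane_of c k) \<ge> 8"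
    unfolding set using compat by (auto simp: A)
  have choices: "choices (Main A (u # us) fx ch) = (CMain A k rest fx ch, add_charge (may_charge k ch) (map Plane ps))"
    by (simp add: p plane_choices_eq)
  show ?thesis
  proof (cases "total2 (plane_of c k) = 7")
    case True
    let ?p = "grid (plane_of c k)"
    have "?p \<in> set ps" using o(3) True by auto
    then have "Plane ?p \<in> set (add_charge (may_charge k ch) (map Plane ps))"
      by (cases "may_charge k ch") auto
    moreover have "state_ok c (apply_choice (CMain A k rest fx ch) (Plane ?p))"
    proof -
      have "\<forall>(k', qs) \<in> set (filter_undecided k ?p rest). total2 (plane_of c k') = 7 \<longrightarrow> grid (plane_of c k') \<in> set qs"
        using o(3) filter_candidates_ok by (auto simp: filter_undecided_eq)
      moreover have "map fst (filter_undecided k ?p rest) = map fst rest"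
        by (simp add: filter_undecided_eq comp_def case_prod_beta)
      ultimately show ?thesis using o d by (auto simp: A)
    qed
    ultimately show ?thesis unfolding choices fst_conv snd_conv by (rule bexI[rotated])
  next
    case False
    then have t: "total2 (plane_of c k) \<ge> 8" using seven[OF plane2_dekey, of k] by simp
    then have "may_charge k ch" using o(5) d by (intro may_charge_ok) auto
    moreover have "state_ok c (apply_choice (CMain A k rest fx ch) Charge)"
      using o d t by (auto simp: A)
    ultimately show ?thesis unfolding choices by auto
  qed
qed

lemma state_step: "state_ok c s \<Longrightarrow> \<exists>w \<in> set (snd (choices s)). state_ok c (apply_choice (fst (choices s)) w)"
  by (cases s rule: choices.cases) (metis leaf_init, metis main_step, metis leaf_step)

lemma search_st: "search choices apply_choice n s \<Longrightarrow> \<not> state_ok c s"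
  by (rule search_sound) (rule state_step)

end

section \<open>Reduction to eight planes\<close>

text \<open>\<open>reductions\<close> lists, for each plane of \<open>tabH\<close> in order, a symmetry carrying it to a representative.\<close>

datatype reduction = Red "ix list" "ix list" K bool

text \<open>Rotation number and reflection flag; \<open>I5\<close> has no meaning as a rotation and
  is sent to the identity.\<close>

fun dih :: "ix \<Rightarrow> bool \<Rightarrow> ix list" where
  "dih I0 False = [I5, I4, I3, I2, I1, I0]"
| "dih I1 False = [I5, I0, I4, I3, I2, I1]"
| "dih I2 False = [I5, I1, I0, I4, I3, I2]"
| "dih I3 False = [I5, I2, I1, I0, I4, I3]"
| "dih I4 False = [I5, I3, I2, I1, I0, I4]"
| "dih I0 True = [I5, I1, I2, I3, I4, I0]"
| "dih I1 True = [I5, I2, I3, I4, I0, I1]"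
| "dih I2 True = [I5, I3, I4, I0, I1, I2]"
| "dih I3 True = [I5, I4, I0, I1, I2, I3]"
| "dih I4 True = [I5, I0, I1, I2, I3, I4]"
| "dih I5 b = [I5, I4, I3, I2, I1, I0]"

definition reductions :: "reduction list" where
 "reductions = [Red (dih I2 False) (dih I4 True) (K G B R) True,
  Red (dih I3 True) (dih I4 True) (K G B R) True,
  Red (dih I2 False) (dih I4 True) (K G B R) False,
  Red (dih I2 False) (dih I4 True) (K G B R) False,
  Red (dih I2 False) (dih I1 False) (K G B R) False,
  Red (dih I2 False) (dih I1 False) (K G B R) False,
  Red (dih I0 False) (dih I0 True) (K G B R) False,
  Red (dih I1 False) (dih I4 True) (K G B R) True,
  Red (dih I1 False) (dih I4 True) (K G B R) True,
  Red (dih I0 False) (dih I0 False) (K G B R) False,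
  Red (dih I4 True) (dih I4 True) (K G B R) True,
  Red (dih I4 True) (dih I4 True) (K G B R) True,
  Red (dih I0 False) (dih I4 False) (K G B R) False,
  Red (dih I0 False) (dih I1 True) (K G B R) False,
  Red (dih I2 False) (dih I4 True) (K G B R) True,
  Red (dih I3 True) (dih I4 True) (K G B R) True,
  Red (dih I2 False) (dih I4 False) (K G B R) False,
  Red (dih I2 False) (dih I4 False) (K G B R) False,
  Red (dih I0 False) (dih I2 False) (K G B R) False,
  Red (dih I1 True) (dih I4 True) (K G B R) True,
  Red (dih I1 True) (dih I4 True) (K G B R) True,
  Red (dih I0 False) (dih I3 True) (K G B R) False,
  Red (dih I2 False) (dih I1 True) (K G B R) False,
  Red (dih I2 False) (dih I1 True) (K G B R) False,
  Red (dih I4 False) (dih I4 True) (K G B R) True,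
  Red (dih I4 False) (dih I4 True) (K G B R) True,
  Red (dih I1 False) (dih I4 True) (K G B R) True,
  Red (dih I1 False) (dih I4 True) (K G B R) True,
  Red (dih I2 False) (dih I2 False) (K G B R) False,
  Red (dih I2 False) (dih I2 False) (K G B R) False,
  Red (dih I2 False) (dih I0 True) (K G B R) False,
  Red (dih I2 False) (dih I0 True) (K G B R) False,
  Red (dih I2 False) (dih I0 False) (K G B R) False,
  Red (dih I2 False) (dih I0 False) (K G B R) False,
  Red (dih I2 True) (dih I4 True) (K G B R) True,
  Red (dih I2 True) (dih I4 True) (K G B R) True,
  Red (dih I3 False) (dih I4 True) (K G B R) True,
  Red (dih I3 False) (dih I4 True) (K G B R) True,
  Red (dih I2 False) (dih I3 False) (K G B R) False,
  Red (dih I0 False) (dih I4 True) (K G B R) True,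
  Red (dih I0 False) (dih I3 False) (K G B R) False,
  Red (dih I0 False) (dih I2 True) (K G B R) False,
  Red (dih I2 False) (dih I3 False) (K G B R) False,
  Red (dih I0 False) (dih I4 True) (K G B R) False,
  Red (dih I0 False) (dih I4 True) (K G B R) True,
  Red (dih I0 False) (dih I4 True) (K G B R) True,
  Red (dih I0 False) (dih I4 True) (K G B R) True,
  Red (dih I0 False) (dih I1 False) (K G B R) False,
  Red (dih I0 True) (dih I4 True) (K G B R) True,
  Red (dih I0 True) (dih I4 True) (K G B R) True,
  Red (dih I0 True) (dih I3 False) (K B G R) False,
  Red (dih I0 True) (dih I3 False) (K B G R) False,
  Red (dih I0 True) (dih I2 True) (K B G R) False,
  Red (dih I3 False) (dih I1 False) (K B G R) True,
  Red (dih I0 False) (dih I2 True) (K G B R) False,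
  Red (dih I0 False) (dih I2 True) (K G B R) False,
  Red (dih I0 False) (dih I3 False) (K G B R) False,
  Red (dih I0 False) (dih I3 False) (K G B R) False,
  Red (dih I0 True) (dih I3 True) (K B G R) False,
  Red (dih I0 True) (dih I2 False) (K B G R) False,
  Red (dih I0 True) (dih I2 False) (K B G R) False,
  Red (dih I0 False) (dih I0 True) (K G B R) False,
  Red (dih I4 False) (dih I1 False) (K B G R) True,
  Red (dih I0 False) (dih I0 False) (K G B R) False,
  Red (dih I0 True) (dih I3 True) (K B G R) False,
  Red (dih I0 True) (dih I2 False) (K B G R) False,
  Red (dih I1 False) (dih I4 True) (K G B R) True,
  Red (dih I0 False) (dih I0 True) (K G B R) False,
  Red (dih I4 True) (dih I4 True) (K G B R) True,
  Red (dih I0 False) (dih I0 False) (K G B R) False,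
  Red (dih I0 False) (dih I0 True) (K G B R) False,
  Red (dih I1 True) (dih I1 False) (K B G R) True,
  Red (dih I0 True) (dih I2 False) (K B G R) False,
  Red (dih I0 False) (dih I0 True) (K G B R) False,
  Red (dih I0 False) (dih I0 True) (K G B R) False,
  Red (dih I0 True) (dih I2 False) (K B G R) False,
  Red (dih I0 True) (dih I4 False) (K B G R) False,
  Red (dih I0 True) (dih I4 False) (K B G R) False,
  Red (dih I0 True) (dih I4 False) (K B G R) False,
  Red (dih I3 False) (dih I4 True) (K G B R) True,
  Red (dih I0 True) (dih I1 True) (K B G R) False,
  Red (dih I2 True) (dih I4 True) (K G B R) True,
  Red (dih I0 False) (dih I0 False) (K G B R) False,
  Red (dih I0 False) (dih I0 False) (K G B R) False,
  Red (dih I0 True) (dih I1 True) (K B G R) False,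
  Red (dih I2 False) (dih I1 False) (K B G R) True,
  Red (dih I0 False) (dih I0 False) (K G B R) False,
  Red (dih I4 False) (dih I1 False) (K B G R) True,
  Red (dih I0 True) (dih I3 True) (K B G R) False,
  Red (dih I4 False) (dih I1 False) (K B G R) True,
  Red (dih I0 True) (dih I0 True) (K B G R) False,
  Red (dih I1 True) (dih I4 True) (K G B R) True,
  Red (dih I0 False) (dih I2 False) (K G B R) False,
  Red (dih I0 False) (dih I4 False) (K G B R) False,
  Red (dih I0 False) (dih I4 False) (K G B R) False,
  Red (dih I0 True) (dih I0 True) (K B G R) False,
  Red (dih I1 False) (dih I1 False) (K B G R) True,
  Red (dih I0 False) (dih I2 False) (K G B R) False,
  Red (dih I0 False) (dih I1 True) (K G B R) False,
  Red (dih I2 True) (dih I1 False) (K B G R) True,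
  Red (dih I0 False) (dih I1 True) (K G B R) False,
  Red (dih I0 False) (dih I1 True) (K G B R) False,
  Red (dih I0 True) (dih I0 False) (K B G R) False,
  Red (dih I0 True) (dih I0 False) (K B G R) False,
  Red (dih I0 True) (dih I0 False) (K B G R) False,
  Red (dih I4 False) (dih I4 True) (K G B R) True,
  Red (dih I0 False) (dih I4 False) (K G B R) False,
  Red (dih I3 False) (dih I1 False) (K B G R) True,
  Red (dih I0 False) (dih I3 True) (K G B R) False,
  Red (dih I0 False) (dih I3 True) (K G B R) False,
  Red (dih I0 False) (dih I2 False) (K G B R) False,
  Red (dih I0 False) (dih I2 False) (K G B R) False,
  Red (dih I0 True) (dih I0 True) (K B G R) False,
  Red (dih I0 False) (dih I3 True) (K G B R) False,
  Red (dih I0 False) (dih I3 True) (K G B R) False,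
  Red (dih I0 True) (dih I0 False) (K B G R) False,
  Red (dih I0 False) (dih I2 False) (K G B R) False,
  Red (dih I1 False) (dih I1 False) (K B G R) True,
  Red (dih I1 False) (dih I1 False) (K B G R) True,
  Red (dih I0 False) (dih I3 True) (K G B R) False,
  Red (dih I4 True) (dih I1 False) (K B G R) True,
  Red (dih I0 True) (dih I0 False) (K B G R) False,
  Red (dih I0 False) (dih I3 False) (K G B R) False,
  Red (dih I0 True) (dih I1 True) (K B G R) False,
  Red (dih I2 False) (dih I1 False) (K B G R) True,
  Red (dih I2 False) (dih I1 False) (K B G R) True,
  Red (dih I3 True) (dih I1 False) (K B G R) True,
  Red (dih I0 False) (dih I2 True) (K G B R) False,
  Red (dih I0 True) (dih I4 False) (K B G R) False,
  Red (dih I0 True) (dih I4 False) (K B G R) False,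
  Red (dih I0 True) (dih I1 False) (K B G R) False,
  Red (dih I0 False) (dih I4 True) (K G B R) True,
  Red (dih I0 False) (dih I4 True) (K G B R) False,
  Red (dih I0 True) (dih I4 True) (K B G R) False,
  Red (dih I0 True) (dih I4 True) (K G B R) True,
  Red (dih I0 False) (dih I1 False) (K G B R) False,
  Red (dih I0 False) (dih I3 False) (K G B R) False,
  Red (dih I0 False) (dih I3 False) (K G B R) False,
  Red (dih I0 False) (dih I2 True) (K G B R) False,
  Red (dih I0 False) (dih I2 True) (K G B R) False,
  Red (dih I0 True) (dih I1 False) (K B G R) False,
  Red (dih I0 True) (dih I1 False) (K B G R) False,
  Red (dih I0 False) (dih I4 True) (K G B R) False,
  Red (dih I0 True) (dih I4 True) (K B G R) False,
  Red (dih I0 False) (dih I1 False) (K B G R) True,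
  Red (dih I0 False) (dih I1 False) (K G B R) False,
  Red (dih I0 False) (dih I4 True) (K G B R) False,
  Red (dih I0 True) (dih I1 False) (K B G R) True,
  Red (dih I0 True) (dih I1 False) (K B G R) False,
  Red (dih I0 False) (dih I1 False) (K G B R) False,
  Red (dih I0 False) (dih I1 False) (K B G R) True,
  Red (dih I0 False) (dih I1 False) (K B G R) True,
  Red (dih I3 True) (dih I4 True) (K G B R) True,
  Red (dih I3 False) (dih I1 False) (K B G R) True,
  Red (dih I0 False) (dih I4 False) (K G B R) False,
  Red (dih I0 False) (dih I4 False) (K G B R) False,
  Red (dih I0 True) (dih I3 False) (K B G R) False,
  Red (dih I0 False) (dih I1 True) (K G B R) False,
  Red (dih I2 False) (dih I4 True) (K G B R) True,
  Red (dih I0 False) (dih I1 True) (K G B R) False,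
  Red (dih I0 False) (dih I4 True) (K G B R) False,
  Red (dih I0 False) (dih I4 True) (K G B R) False,
  Red (dih I0 True) (dih I1 False) (K B G R) False,
  Red (dih I0 True) (dih I2 True) (K B G R) False,
  Red (dih I0 False) (dih I1 False) (K G B R) False,
  Red (dih I0 True) (dih I2 True) (K B G R) False,
  Red (dih I0 False) (dih I1 False) (K G B R) False,
  Red (dih I0 True) (dih I4 True) (K B G R) False,
  Red (dih I0 True) (dih I3 False) (K B G R) False,
  Red (dih I0 True) (dih I3 False) (K B G R) False]"

definition reps :: "plane list" where
  "reps = [rep0, rep1, rep2, rep3, rep4, rep5, rep6, rep7]"

section \<open>Checking the reductions to representatives\<close>

fun perm_words :: "ix list \<Rightarrow> plane \<Rightarrow> plane" where
  "perm_words r [] = []" | "perm_words r (p # ps) = perm r p # perm_words r ps"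

fun transp_if :: "bool \<Rightarrow> plane \<Rightarrow> plane" where
  "transp_if True P = transp P" | "transp_if False P = P"

fun reduce :: "reduction \<Rightarrow> plane \<Rightarrow> plane" where
  "reduce (Red a b k t) P = recolour_plane k (perm a (perm_words b (transp_if t P)))"

fun plane_dels :: "plane \<Rightarrow> nat" where
  "plane_dels [] = 0" | "plane_dels (w # ws) = dels w + plane_dels ws"

fun entries_planes :: "(col list \<times> entry) list \<Rightarrow> plane list" where
  "entries_planes [] = []" | "entries_planes ((r, t) # es) = planes [t] @ entries_planes es"

fun table_planes :: "table \<Rightarrow> plane list" where
  "table_planes [] = []" | "table_planes ((k, es) # t) = entries_planes es @ table_planes t"

fun known_recolouring :: "K \<Rightarrow> (K \<times> K) list \<Rightarrow> bool" where
  "known_recolouring k [] = False"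
| "known_recolouring k ((k', m) # ks) = (k = k' \<or> known_recolouring k ks)"

fun known_symmetry :: "ix list \<Rightarrow> (ix list \<times> ix list) list \<Rightarrow> bool" where
  "known_symmetry p [] = False"
| "known_symmetry p ((p', r) # ps) = (p = p' \<or> known_symmetry p ps)"

text \<open>A certificate must name members of the verified symmetry lists, since
  \<open>reduce\<close> accepts arbitrary index lists and colour maps.\<close>

fun known_reduction :: "reduction \<Rightarrow> bool" where
  "known_reduction (Red a b k t) = (known_symmetry a dihedral \<and> known_symmetry b dihedral \<and> known_recolouring k recolourings)"

definition is_seven :: "nat \<Rightarrow> bool" where
  "is_seven n = (n = Suc (Suc (Suc (Suc (Suc (Suc (Suc 0)))))))"

text \<open>The number of deletions is checked along with the representative: this is the source of
  the lower bound 7 for planes.\<close>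

fun check_reductions :: "reduction list \<Rightarrow> plane list \<Rightarrow> bool" where
  "check_reductions rs [] = True"
| "check_reductions [] (P # Ps) = False"
| "check_reductions (r # rs) (P # Ps) =
    (known_reduction r \<and> mem_plane (reduce r P) reps \<and> is_seven (plane_dels P) \<and> check_reductions rs Ps)"

lemma reductions_ok: "check_reductions reductions (table_planes tabH)"
  by code_simp

lemma chkredD: "check_reductions rs Ps \<Longrightarrow> P \<in> set Ps \<Longrightarrow> \<exists>r. known_reduction r \<and> reduce r P \<in> set reps \<and> plane_dels P = 7"
  by (induction rs Ps rule: check_reductions.induct) (auto simp: is_seven_def)

lemma goodpiD: "known_symmetry p ps \<Longrightarrow> \<exists>r. (p, r) \<in> set ps"
  by (induction ps) (auto, blast+)

lemma goodKD: "known_recolouring k ps \<Longrightarrow> \<exists>r. (k, r) \<in> set ps"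
  by (induction ps) (auto, blast+)

lemma table_row_aux_eq: "table_row_aux t k v ts = (if t then v else table_row k ts)"
  by (cases t) auto

lemma table_entry_aux_eq: "table_entry_aux t k v ts = (if t then [v] else table_entry k ts)"
  by (cases t) auto

lemma planes_flates: "P \<in> set (planes (table_entry v es)) \<Longrightarrow> P \<in> set (entries_planes es)"
  by (induction es) (auto simp: table_entry_aux_eq simp del: planes.simps(2-) split: if_splits)

lemma planes_flat: "P \<in> set (planes (table_entry v (table_row w tb))) \<Longrightarrow> P \<in> set (table_planes tb)"
  by (induction tb) (auto simp: table_row_aux_eq dest: planes_flates split: if_splits)

lemma plane_dels_lst2: "plane_dels (grid g) = total2 g"
  unfolding grid_def total2_def by (subst word_def) (simp add: sum_ix)

lemma perm_words_lst2: "perm_words (word f) (grid g) = grid (\<lambda>i j. g i (f j))"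
  unfolding grid_def by (subst (2 3) word_def) (simp add: perm_lst)

lemma perm_lst2: "perm (word f) (grid g) = grid (\<lambda>i j. g (f i) j)"
  unfolding grid_def by (simp add: perm_lst)

lemma reduce_lst2:
  "reduce (Red (word a) (word b) k t) (grid g) = grid (\<lambda>i j. recolour k (if t then g (b j) (a i) else g (a i) (b j)))"
  by (cases t) (simp_all add: perm_words_lst2 perm_lst2 recolour_plane_lst2)

lemma aut_comp: "aut f h \<Longrightarrow> aut f' h' \<Longrightarrow> aut (\<lambda>i. f (f' i)) (\<lambda>i. h' (h i))"
  by (auto simp: aut_def)

lemma colaut_comp: "colaut f h \<Longrightarrow> colaut f' h' \<Longrightarrow> colaut (\<lambda>i. f (f' i)) (\<lambda>i. h' (h i))"
  by (auto simp: colaut_def)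

text \<open>Once the hub line is a key, the plane lies in the table for \<open>I5\<close> and
  \<open>I0\<close>. Its certificate then counts the deletions and gives the symmetry; composing
  this with the normalisation of the hub line reaches a representative.\<close>

lemma canon_plane:
  assumes g: "plane2 g" "total2 g \<le> 7"
  shows "total2 g = 7 \<and> (\<exists>a a' b b' k m t. aut a a' \<and> aut b b' \<and> colaut k m \<and>
    grid (\<lambda>i j. k (if t then g (b j) (a i) else g (a i) (b j))) \<in> set reps)"
proof -
  have "hint_ok (the_hint (word (g I5))) (word (g I5))"
    using the_hint_ok[of "g I5"] row_le2[OF g] g(1) by (simp add: plane2_def)
  then obtain perm_list k rho m w where "hint_ok (Hint perm_list k rho m w) (word (g I5))"
    by (metis hint.exhaust)
  then have h0: "(perm_list, rho) \<in> set dihedral" "(k, m) \<in> set recolourings" "recolour_word k (perm perm_list (word (g I5))) \<in> set keys"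
    by (auto simp: hint_ok_def)
  define f f' where "f = (\<lambda>i. sel i perm_list)" and "f' = (\<lambda>i. sel i rho)"
  have h: "perm_list = word f" "aut f f'" "colaut (recolour k) (recolour m)"
    using dihedral_aut[OF h0(1)] recolourings_colaut[OF h0(2)] by (auto simp: f_def f'_def)
  define g' where "g' = (\<lambda>z y. recolour k (g z (f y)))"
  have g': "plane2 g'" "total2 g' = total2 g"
    using plane2_aut[OF aut_id(1) h(2,3) g(1)] total2_aut[OF aut_id(1) h(2,3), of g]
    by (simp_all add: g'_def)
  have "word (g' I5) \<in> set keys"
    using h0(3) by (simp add: h(1) perm_lst recolour_word_lst g'_def)
  then have "in_tabH (grid g')"
    using tabokD[OF tabH_ok g'(1)] g(2) g'(2) by simp
  then have "grid (\<lambda>i j. g' j i) \<in> set (table_planes tabH)"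
    unfolding in_tabH_def by (simp add: planes_flat)
  from chkredD[OF reductions_ok this] obtain a0 b0 k' t where
    r: "known_reduction (Red a0 b0 k' t)" "reduce (Red a0 b0 k' t) (grid (\<lambda>i j. g' j i)) \<in> set reps"
      "plane_dels (grid (\<lambda>i j. g' j i)) = 7"
    by (metis reduction.exhaust)
  obtain a1 b1 m' where ab: "(a0, a1) \<in> set dihedral" "(b0, b1) \<in> set dihedral" "(k', m') \<in> set recolourings"
    using r(1) goodpiD goodKD by (metis known_reduction.simps)
  define a a' b b' where "a = (\<lambda>i. sel i a0)" and "a' = (\<lambda>i. sel i a1)"
    and "b = (\<lambda>i. sel i b0)" and "b' = (\<lambda>i. sel i b1)"
  have ab': "a0 = word a" "b0 = word b" "aut a a'" "aut b b'" "colaut (recolour k') (recolour m')"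
    using dihedral_aut[OF ab(1)] dihedral_aut[OF ab(2)] recolourings_colaut[OF ab(3)]
    by (auto simp: a_def a'_def b_def b'_def)
  have t7: "total2 g = 7"
    using r(3) g'(2) total2_transp[of g'] by (simp add: plane_dels_lst2)
  have r': "grid (\<lambda>i j. recolour k' (if t then g' (a i) (b j) else g' (b j) (a i))) \<in> set reps"
    using r(2) unfolding ab'(1,2) reduce_lst2 .
  have "\<exists>a a' b b' k m t. aut a a' \<and> aut b b' \<and> colaut k m \<and>
    grid (\<lambda>i j. k (if t then g (b j) (a i) else g (a i) (b j))) \<in> set reps"
  proof (cases t)
    case True
    \<comment> \<open>The constant condition exhibits the witness for the transposition flag. It is
      the negation of the stored flag because the certificate refers to the transposed
      plane.\<close>
    then have "grid (\<lambda>i j. recolour k' (recolour k (if False then g (f (b j)) (a i) else g (a i) (f (b j))))) \<in> set reps"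
      using r' by (simp add: g'_def)
    then show ?thesis
      using ab'(3) aut_comp[OF h(2) ab'(4)] colaut_comp[OF ab'(5) h(3)] by blast
  next
    case False
    then have "grid (\<lambda>i j. recolour k' (recolour k (if True then g (b j) (f (a i)) else g (f (a i)) (b j)))) \<in> set reps"
      using r' by (simp add: g'_def)
    then show ?thesis
      using ab'(4) aut_comp[OF h(2) ab'(3)] colaut_comp[OF ab'(5) h(3)] by blast
  qed
  then show ?thesis using t7 by blast
qed

lemma total2_ge7: "plane2 g \<Longrightarrow> total2 g \<ge> 7"
  using canon_plane[of g] by linarith

text \<open>Each of these eight evaluations runs through all compatible planes with seven deletions,
  placing the pair at \<open>I5\<close>, \<open>I0\<close> and, if the hub deletions are in the
  right order, also at \<open>I0\<close>, \<open>I1\<close>.\<close>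

lemma check_plane_rep5: "check_plane rep5"
  by code_simp

lemma check_plane_rep7: "check_plane rep7"
  by code_simp

lemma check_plane_rep6: "check_plane rep6"
  by code_simp

lemma check_plane_rep0: "check_plane rep0"
  by code_simp

lemma check_plane_rep2: "check_plane rep2"
  by code_simp

lemma check_plane_rep3: "check_plane rep3"
  by code_simp

lemma check_plane_rep1: "check_plane rep1"
  by code_simp

lemma check_plane_rep4: "check_plane rep4"
  by code_simp

lemma check_plane_reps: "A \<in> set reps \<Longrightarrow> check_plane A"
  using check_plane_rep0 check_plane_rep1 check_plane_rep2 check_plane_rep3 check_plane_rep4 check_plane_rep5 check_plane_rep6 check_plane_rep7
  by (auto simp: reps_def)

section \<open>Contradiction from two adjacent optimal layers\<close>

lemma chkBsD: "check_neighbours hs A Ps \<Longrightarrow> P \<in> set Ps \<Longrightarrow>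
    search choices apply_choice fuel (Main (True, A, P) (undecided0 True hs P) [] []) \<and>
    (hub_dels P \<le> hub_dels A \<longrightarrow>
      search choices apply_choice fuel (Main (False, A, P) (undecided0 False hs P) [] [X I5, Y I5]))"
proof (induction Ps)
  case (Cons Q Ps)
  have "check_rim t hs A Q \<longleftrightarrow>
      (t \<longrightarrow> search choices apply_choice fuel (Main (False, A, Q) (undecided0 False hs Q) [] [X I5, Y I5]))" for t
    by (cases t) auto
  then show ?case using Cons by auto
qed simp

text \<open>An invariant of transpositions, automorphisms and recolourings, so the order of the two
  layers survives normalisation of the first. The common vertex of hub row and hub column counts
  twice.\<close>

definition hub2 :: "(ix \<Rightarrow> ix \<Rightarrow> col) \<Rightarrow> nat" where
  "hub2 g = dels (word (g I5)) + dels (word (\<lambda>i. g i I5))"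

lemma hub_dels_lst2: "hub_dels (grid g) = hub2 g"
  by (simp add: hub_dels_def hub2_def)

lemma hub2_transp: "hub2 (\<lambda>i j. g j i) = hub2 g"
  by (simp add: hub2_def)

lemma hints_eq: "hints A ks = map (\<lambda>k. (k, the_hint (line_of k A))) ks"
  by (induction ks) (auto simp: the_hint_def)

lemma undecided0_aux_eq: "undecided0_aux t k hi hs P =
    (if t then undecided0 False hs P else (k, candidates False hi (line_of k P)) # undecided0 False hs P)"
  by (cases t) auto

lemma undecided0_eq: "undecided0 h hs P = map (\<lambda>(k, hi). (k, candidates h hi (line_of k P)))
    (filter (\<lambda>(k, hi). h \<or> \<not> is_hub k) hs)"
  by (induction hs; cases h) (auto simp: undecided0_aux_eq)

lemma is_hub_iff: "is_hub k \<longleftrightarrow> k = X I5 \<or> k = Y I5"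
  by (cases k) auto

lemma fst_alines: "map fst (alines A js) = js"
  by (induction js) (auto simp: line_choice_def)

lemma alines_ok:
  assumes "plane2 g" "\<And>i j. compat (g' i j) (g i j)" "(i, a, b) \<in> set (alines (grid g') js)"
  shows "(dels (word (g i)) = 1 \<longrightarrow> word (g i) \<in> set a) \<and> (dels (word (g i)) = 2 \<longrightarrow> word (g i) \<in> set b)"
  using assms(3)
proof (induction js)
  case (Cons j js)
  have l: "line (g j)" using assms(1) by (simp add: plane2_def)
  have admits: "allowed (g j) (forbid_word (word (g' j)) free_cells)"
    by (rule allowed_insw[OF allowed_cells0 map_fst_cells0]) (rule assms(2))
  have m: "map fst (forbid_word (word (g' j)) free_cells) = indices"
    by (simp add: map_fst_cells0)
  consider "(i, a, b) \<in> set (alines (grid g') js)" | "line_choice j (forbid_word (word (g' j)) free_cells) = (i, a, b)"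
    using Cons.prems by auto
  then show ?case
  proof cases
    case 2
    then show ?thesis using line_choice_ok[OF l admits m 2] by blast
  qed (use Cons.IH in blast)
qed simp

lemma neighbour_generated:
  assumes "plane2 g" "total2 g \<le> 7" "\<And>i j. compat (g' i j) (g i j)"
  shows "grid g \<in> set (gen_planes fuel7 [] (alines (grid g') indices))"
proof (rule gen_planes_complete[OF assms(1)])
  have f: "map fst (alines (grid g') indices) = indices" by (rule fst_alines)
  show "gen_ok g [] (alines (grid g') indices)"
  proof (rule gen_planes_ok_start[OF assms(1,2)])
    show "fst ` set (alines (grid g') indices) = UNIV"
      using f set_xsi by (metis list.set_map)
    show "distinct (map fst (alines (grid g') indices))"
      unfolding f by (simp add: indices_def)
  qed (use alines_ok[OF assms(1,3)] in blast)
  have "length (alines (grid g') indices) = 6"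
    using arg_cong[OF f, of length] by (simp add: indices_def)
  then show "length (alines (grid g') indices) < fuel7" by (simp add: fuel7_def)
qed

lemma line_of_lst2: "line_of k (grid (\<lambda>x y. c x y z)) = word (\<lambda>y. plane_of c k y z)"
  by (cases k) (auto simp: plane_of_def)

lemma rep_pair_impossible:
  assumes c: "proper3 c" "total3 c \<le> 45"
    and A: "grid (\<lambda>x y. c x y (fst (layers h))) \<in> set reps" "total2 (\<lambda>x y. c x y (fst (layers h))) \<le> 7"
    and B: "total2 (\<lambda>x y. c x y (snd (layers h))) \<le> 7"
    and hub: "\<not> h \<Longrightarrow> total2 (plane_of c (X I5)) \<ge> 8 \<and> total2 (plane_of c (Y I5)) \<ge> 8 \<and>
      hub2 (\<lambda>x y. c x y (snd (layers h))) \<le> hub2 (\<lambda>x y. c x y (fst (layers h)))"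
  shows False
proof -
  let ?A = "\<lambda>x y. c x y (fst (layers h))" and ?B = "\<lambda>x y. c x y (snd (layers h))"
  let ?hs = "hints (grid ?A) allkeys"
  let ?ch = "if h then [] else [X I5, Y I5]"
  note layer = plane2_layer[OF c total2_ge7] and key = plane2_dekey[OF c total2_ge7]
  have "adj (fst (layers h)) (snd (layers h))" by (simp add: layers_def)
  then have "\<And>x y. compat (?A x y) (?B x y)" using c(1) by (auto simp: proper3_def)
  then have "grid ?B \<in> set (gen_planes fuel7 [] (alines (grid ?A) indices))"
    by (intro neighbour_generated[OF layer B, of ?A])
  then have s: "search choices apply_choice fuel (Main (h, grid ?A, grid ?B) (undecided0 h ?hs (grid ?B)) [] ?ch)"
    using check_plane_reps[OF A(1)] chkBsD[of ?hs "grid ?A" _ "grid ?B"] hub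
    unfolding check_plane_def hub_dels_lst2 by (cases h) auto
  \<comment> \<open>The first layer has at most seven deletions, hence at most two on each line in
    either direction, so that a hint exists.\<close>
  have dom: "grid (plane_of c k) \<in> set (candidates h (the_hint (line_of k (grid ?A))) (line_of k (grid ?B)))"
    if "total2 (plane_of c k) = 7" for k
  proof -
    have l: "line (\<lambda>y. plane_of c k y (fst (layers h)))"
      using key[of k] by (simp add: plane2_def)
    have "dels (word (\<lambda>y. plane_of c k y (fst (layers h)))) \<le> 2"
    proof (cases k)
      case (X i)
      then show ?thesis using row_le2[OF layer A(2), of i] by (simp add: plane_of_def)
    next
      case (Y j)
      then show ?thesis
        using row_le2[OF plane2_transp[OF layer], of "fst (layers h)" j] A(2) total2_transp[of ?A]
        by (simp add: plane_of_def)
    qed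
    from candidates_complete[OF key _ the_hint_ok[OF l this]] that
    show ?thesis by (simp add: line_of_lst2)
  qed
  have "map fst (undecided0 h ?hs (grid ?B)) = filter (\<lambda>k. h \<or> \<not> is_hub k) allkeys"
    by (simp add: undecided0_eq hints_eq filter_map comp_def case_prod_beta)
  then have "distinct (map fst (undecided0 h ?hs (grid ?B)) @ ?ch)"
    by (cases h) (simp_all add: allkeys_def is_hub_iff)
  moreover have "\<forall>(k, ps) \<in> set (undecided0 h ?hs (grid ?B)). total2 (plane_of c k) = 7 \<longrightarrow> grid (plane_of c k) \<in> set ps"
    using dom by (auto simp: undecided0_eq hints_eq)
  ultimately have "state_ok c (Main (h, grid ?A, grid ?B) (undecided0 h ?hs (grid ?B)) [] ?ch)"
    using hub by auto
  with search_st[OF c total2_ge7 s] show False by blast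
qed

section \<open>Symmetries of the whole colouring\<close>

lemma total3_sum: "total3 c = (\<Sum>x\<in>UNIV. \<Sum>y\<in>UNIV. \<Sum>z\<in>UNIV. if c x y z = D then 1 else 0)"
  by (simp add: total3_def total2_def dels_lst)

lemma total3_swap12: "total3 (\<lambda>x y z. c y x z) = total3 c"
  unfolding total3_sum by (rule sum.swap)

lemma total3_swap23: "total3 (\<lambda>x y z. c x z y) = total3 c"
  unfolding total3_sum by (intro sum.cong refl sum.swap)

lemma total3_swap13: "total3 (\<lambda>x y z. c z y x) = total3 c"
  using total3_swap12[of "\<lambda>x y z. c z x y"] total3_swap23[of "\<lambda>x y z. c y x z"] total3_swap12[of c]
  by simp

lemma total3_layers: "total3 c = (\<Sum>z\<in>UNIV. total2 (\<lambda>x y. c x y z))"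
  using total3_swap12[of "\<lambda>x y z. c x z y"] total3_swap23[of c]
  by (simp add: total3_def[of "\<lambda>x y z. c y z x"])

lemma adj_all_I5: "\<forall>j. j \<noteq> i \<longrightarrow> adj i j \<Longrightarrow> i = I5"
  by (cases i) (simp_all add: all_ix)

lemma adj_I5: "j \<noteq> I5 \<Longrightarrow> adj I5 j"
  by (cases j) simp_all

text \<open>The hub is the only vertex adjacent to all others.\<close>

lemma aut_I5:
  assumes a: "aut f h"
  shows "f I5 = I5"
proof (rule adj_all_I5, intro allI impI)
  fix j assume "j \<noteq> f I5"
  then have "h j \<noteq> I5" using a unfolding aut_def by metis
  then have "adj I5 (h j)" by (rule adj_I5)
  then show "adj (f I5) j" using a unfolding aut_def by metis
qed

lemma hub2_aut:
  assumes "aut f h" "aut f' h'" "colaut k m"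
  shows "hub2 (\<lambda>i j. k (g (f i) (f' j))) = hub2 g"
  unfolding hub2_def aut_I5[OF assms(1)] aut_I5[OF assms(2)]
  using dels_aut[OF assms(2,3), of "g I5"] dels_aut[OF assms(1,3), of "\<lambda>i. g i I5"] by simp

lemma proper3_aut:
  assumes "aut f f'" "aut g g'" "aut h h'" "colaut k m" "proper3 c"
  shows "proper3 (\<lambda>x y z. k (c (f x) (g y) (h z)))"
  using assms unfolding proper3_def by (simp add: colaut_ok[OF assms(4)]) (simp add: aut_def)

lemma proper3_swap: "proper3 c \<Longrightarrow> proper3 (\<lambda>x y z. c y x z)" "proper3 c \<Longrightarrow> proper3 (\<lambda>x y z. c z y x)"
    "proper3 c \<Longrightarrow> proper3 (\<lambda>x y z. c x z y)"
  by (auto simp: proper3_def)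

lemma total3_aut:
  assumes "aut f f'" "aut g g'" "aut h h'" "colaut k m"
  shows "total3 (\<lambda>x y z. k (c (f x) (g y) (h z))) = total3 c"
  unfolding total3_def
  using total2_aut[OF assms(2,3,4)] sum_aut[OF assms(1), of "\<lambda>x. total2 (c x)"] by simp

text \<open>The symmetry that normalises the first layer is applied in the first two coordinates to
  the whole colouring, so both layers stay in place.\<close>

lemma pair_impossible:
  assumes c: "proper3 c" "total3 c \<le> 45"
    and A: "total2 (\<lambda>x y. c x y (fst (layers h))) \<le> 7"
    and B: "total2 (\<lambda>x y. c x y (snd (layers h))) \<le> 7"
    and hub: "\<not> h \<Longrightarrow> total2 (plane_of c (X I5)) \<ge> 8 \<and> total2 (plane_of c (Y I5)) \<ge> 8 \<and>
      hub2 (\<lambda>x y. c x y (snd (layers h))) \<le> hub2 (\<lambda>x y. c x y (fst (layers h)))"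
  shows False
proof -
  note layer = plane2_layer[OF c total2_ge7]
  obtain a a' b b' k m t where r: "aut a a'" "aut b b'" "colaut k m"
    "grid (\<lambda>i j. k (if t then c (b j) (a i) (fst (layers h)) else c (a i) (b j) (fst (layers h)))) \<in> set reps"
    using canon_plane[OF layer A] by blast
  define d where "d = (if t then (\<lambda>x y z. c y x z) else c)"
  have d: "proper3 d" "total3 d \<le> 45"
    using c proper3_swap(1)[OF c(1)] total3_swap12[of c] by (auto simp: d_def)
  have dz: "total2 (\<lambda>x y. d x y z) = total2 (\<lambda>x y. c x y z)" for z
    using total2_transp[of "\<lambda>x y. c x y z"] by (simp add: d_def)
  have db: "hub2 (\<lambda>x y. d x y z) = hub2 (\<lambda>x y. c x y z)" for z
    using hub2_transp[of "\<lambda>x y. c x y z"] by (simp add: d_def)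
  \<comment> \<open>Transposition exchanges the two hub planes, and both are charged.\<close>
  have dh: "total2 (plane_of d (X I5)) \<ge> 8 \<and> total2 (plane_of d (Y I5)) \<ge> 8" if "\<not> h"
    using hub[OF that] by (auto simp: d_def plane_of_def)
  \<comment> \<open>The branches coincide because \<open>d\<close> has absorbed the
    transposition.\<close>
  define e where "e = (\<lambda>x y z. k (if t then d (a x) (b y) z else d (a x) (b y) z))"
  have e: "e = (\<lambda>x y z. k (d (a x) (b y) (id z)))" by (simp add: e_def)
  show False
  proof (rule rep_pair_impossible[of e h])
    show "proper3 e" unfolding e by (rule proper3_aut[OF r(1,2) aut_id(1) r(3) d(1)])
    show "total3 e \<le> 45" unfolding e using total3_aut[OF r(1,2) aut_id(1) r(3), of d] d(2) by simp
    show "grid (\<lambda>x y. e x y (fst (layers h))) \<in> set reps"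
      using r(4) by (cases t) (simp_all add: e_def d_def)
    show "total2 (\<lambda>x y. e x y (fst (layers h))) \<le> 7"
      unfolding e using total2_aut[OF r(1,2,3), of "\<lambda>x y. d x y (fst (layers h))"] A dz by simp
    show "total2 (\<lambda>x y. e x y (snd (layers h))) \<le> 7"
      unfolding e using total2_aut[OF r(1,2,3), of "\<lambda>x y. d x y (snd (layers h))"] B dz by simp
    show "8 \<le> total2 (plane_of e (X I5)) \<and> 8 \<le> total2 (plane_of e (Y I5)) \<and>
      hub2 (\<lambda>x y. e x y (snd (layers h))) \<le> hub2 (\<lambda>x y. e x y (fst (layers h)))" if "\<not> h"
      unfolding e plane_of_def key.case
      using hub2_aut[OF r(1,2,3), of "\<lambda>x y. d x y (fst (layers h))"]
        hub2_aut[OF r(1,2,3), of "\<lambda>x y. d x y (snd (layers h))"] db hub[OF that]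
        total2_aut[OF r(2) aut_id(1) r(3), of "d I5"] total2_aut[OF r(1) aut_id(1) r(3), of "\<lambda>x. d x I5"]
        dh[OF that] aut_I5[OF r(1)] aut_I5[OF r(2)] by (simp add: plane_of_def)
  qed
qed

text \<open>The dihedral group acts transitively on the ten directed rim edges.\<close>

lemma aut_rim: "adj z z' \<Longrightarrow> z \<noteq> I5 \<Longrightarrow> z' \<noteq> I5 \<Longrightarrow> \<exists>f h. aut f h \<and> f I0 = z \<and> f I1 = z'"
proof -
  assume a: "adj z z'" "z \<noteq> I5" "z' \<noteq> I5"
  then have "\<exists>(perm_list, rho) \<in> set dihedral. sel I0 perm_list = z \<and> sel I1 perm_list = z'"
    by (cases z; cases z') (simp_all add: dihedral_def)
  then show ?thesis using dihedral_aut by blast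
qed

lemma hub_impossible:
  assumes c: "proper3 c" "total3 c \<le> 45"
  shows "total2 (\<lambda>x y. c x y I5) \<ge> 8"
proof (rule ccontr)
  assume n: "\<not> ?thesis"
  note layer = plane2_layer[OF c total2_ge7]
  let ?t = "\<lambda>z. total2 (\<lambda>x y. c x y z)"
  have g: "?t z \<ge> 7" for z by (rule total2_ge7[OF layer])
  \<comment> \<open>Five rim layers with 8 deletions and the hub layer with 7 would make 47. The
    neighbour \<open>z'\<close> serves to apply \<open>aut_rim\<close>, which moves \<open>z\<close>
    to \<open>I0\<close>.\<close>
  have "\<exists>z z'. ?t z \<le> 7 \<and> z \<noteq> I5 \<and> z' \<noteq> I5 \<and> adj z z'"
  proof (rule ccontr)
    assume "\<not> ?thesis"
    then have "?t z > 7" if "z \<noteq> I5" "z' \<noteq> I5" "adj z z'" for z z'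
      using that by (meson not_le)
    from this[of I0 I1] this[of I1 I0] this[of I2 I1] this[of I3 I2] this[of I4 I0]
    have "?t I0 > 7" "?t I1 > 7" "?t I2 > 7" "?t I3 > 7" "?t I4 > 7" by simp_all
    then show False using c(2) g[of I5] unfolding total3_layers sum_ix by linarith
  qed
  then obtain z z' where z: "?t z \<le> 7" "z \<noteq> I5" "z' \<noteq> I5" "adj z z'" by blast
  from aut_rim[OF z(4,2,3)] obtain f h where f: "aut f h" "f I0 = z" by blast
  let ?c = "\<lambda>x y z. id (c (id x) (id y) (f z))"
  show False
  proof (rule pair_impossible[of ?c True])
    show "proper3 ?c" by (rule proper3_aut[OF aut_id(1) aut_id(1) f(1) aut_id(2) c(1)])
    show "total3 ?c \<le> 45" using total3_aut[OF aut_id(1) aut_id(1) f(1) aut_id(2), of c] c(2) by simp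
  qed (use n z(1) aut_I5[OF f(1)] f(2) in \<open>auto simp: layers_def\<close>)
qed

lemma total3_ge46:
  assumes c: "proper3 c"
  shows "total3 c \<ge> 46"
proof (rule ccontr)
  assume "\<not> ?thesis"
  then have t: "total3 c \<le> 45" by simp
  have hz: "total2 (\<lambda>x y. c x y I5) \<ge> 8" by (rule hub_impossible[OF c t])
  \<comment> \<open>Exchanging coordinates carries the bound for hub layers over to the other two
    directions.\<close>
  have hx: "total2 (plane_of c (X I5)) \<ge> 8"
    using hub_impossible[of "\<lambda>x y z. c z y x"] proper3_swap(2)[OF c] total3_swap13[of c] t
      total2_transp[of "c I5"] by (simp add: plane_of_def)
  have hy: "total2 (plane_of c (Y I5)) \<ge> 8"
    using hub_impossible[of "\<lambda>x y z. c x z y"] proper3_swap(3)[OF c] total3_swap23[of c] t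
    by (simp add: plane_of_def)
  note layer = plane2_layer[OF c t total2_ge7]
  let ?t = "\<lambda>z. total2 (\<lambda>x y. c x y z)"
  have g: "?t z \<ge> 7" for z by (rule total2_ge7[OF layer])
  \<comment> \<open>Otherwise the charged rim layers meet every edge of the 5-cycle, so there are at
    least three, and with the charged hub layer 8 + 3 * 8 + 2 * 7 = 46.\<close>
  have "\<exists>z z'. ?t z \<le> 7 \<and> ?t z' \<le> 7 \<and> z \<noteq> I5 \<and> z' \<noteq> I5 \<and> adj z z'"
  proof (rule ccontr)
    assume "\<not> ?thesis"
    then have n: "?t z > 7 \<or> ?t z' > 7" if "z \<noteq> I5" "z' \<noteq> I5" "adj z z'" for z z'
      using that by (meson not_le)
    have "?t I0 > 7 \<or> ?t I1 > 7" "?t I1 > 7 \<or> ?t I2 > 7" "?t I2 > 7 \<or> ?t I3 > 7"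
      "?t I3 > 7 \<or> ?t I4 > 7" "?t I4 > 7 \<or> ?t I0 > 7"
      by (rule n; simp)+
    then show False
      using t hz g[of I0] g[of I1] g[of I2] g[of I3] g[of I4] unfolding total3_layers sum_ix by linarith
  qed
  \<comment> \<open>Adjacency is symmetric, so the pair can be named with the larger
    \<open>hub2\<close> first, as the search expects.\<close>
  then obtain z z' where z: "?t z \<le> 7" "?t z' \<le> 7" "z \<noteq> I5" "z' \<noteq> I5" "adj z z'"
      "hub2 (\<lambda>x y. c x y z') \<le> hub2 (\<lambda>x y. c x y z)"
    by (metis adj_sym nat_le_linear)
  from aut_rim[OF z(5,3,4)] obtain f h where f: "aut f h" "f I0 = z" "f I1 = z'" by blast
  let ?c = "\<lambda>x y z. id (c (id x) (id y) (f z))"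
  show False
  proof (rule pair_impossible[of ?c False])
    show "proper3 ?c" by (rule proper3_aut[OF aut_id(1) aut_id(1) f(1) aut_id(2) c])
    show "total3 ?c \<le> 45" using total3_aut[OF aut_id(1) aut_id(1) f(1) aut_id(2), of c] t by simp
    show "8 \<le> total2 (plane_of ?c (X I5)) \<and> 8 \<le> total2 (plane_of ?c (Y I5)) \<and>
      hub2 (\<lambda>x y. ?c x y (snd (layers False))) \<le> hub2 (\<lambda>x y. ?c x y (fst (layers False)))"
      using hx hy total2_aut[OF aut_id(1) f(1) aut_id(2), of "c I5"]
        total2_aut[OF aut_id(1) f(1) aut_id(2), of "\<lambda>x. c x I5"]
        z(6) f(2,3) by (simp add: plane_of_def layers_def)
  qed (use z(1,2) f(2,3) in \<open>auto simp: layers_def\<close>)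
qed

text \<open>The extremal colouring, nested by first, second and third coordinate, each from
  \<open>I5\<close> down to \<open>I0\<close>.\<close>

definition sol :: "plane list" where
 "sol =
  [[[B,G,R,G,D,R],
   [R,B,G,B,G,D],
   [G,R,B,R,D,B],
   [R,B,G,B,D,G],
   [G,R,B,D,R,B],
   [D,D,D,R,B,G]],
   [[R,B,G,B,G,D],
   [D,G,D,R,B,R],
   [B,D,R,G,R,G],
   [G,R,B,R,B,D],
   [B,G,R,G,D,R],
   [G,R,B,D,R,B]],
   [[D,D,D,R,B,G],
   [G,R,B,D,R,B],
   [D,G,D,B,G,R],
   [D,D,R,G,R,B],
   [R,B,G,B,G,D],
   [B,G,R,G,D,R]],
   [[G,R,B,D,R,B],
   [B,G,R,G,D,R],
   [R,B,G,D,B,G],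
   [B,G,D,R,G,R],
   [D,D,R,G,B,G],
   [R,B,G,B,G,D]],
   [[R,B,G,B,D,G],
   [G,R,B,R,B,D],
   [B,G,R,G,D,R],
   [G,R,B,D,R,B],
   [B,G,D,R,G,R],
   [D,D,R,G,R,B]],
   [[G,R,B,R,D,B],
   [B,D,R,G,R,G],
   [R,B,G,B,G,D],
   [B,G,R,G,D,R],
   [R,B,G,D,B,G],
   [D,G,D,B,G,R]]]"

section \<open>The independence number\<close>

definition wheel_vertex :: "ix \<Rightarrow> nat + nat" where
  "wheel_vertex i = (case i of I0 \<Rightarrow> Inl 0 | I1 \<Rightarrow> Inl 1 | I2 \<Rightarrow> Inl 2 | I3 \<Rightarrow> Inl 3 | I4 \<Rightarrow> Inl 4 | I5 \<Rightarrow> Inr 0)"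

lemma inj_vx: "inj wheel_vertex"
proof (rule injI)
  show "wheel_vertex i = wheel_vertex j \<Longrightarrow> i = j" for i j by (cases i; cases j) (simp_all add: wheel_vertex_def)
qed

lemma lessThan_5: "{..<5::nat} = {0, 1, 2, 3, 4}"
  by auto

lemma pverts_wheel: "pverts (wheel_graph 5) = range wheel_vertex"
  unfolding wheel_graph_def graph_join_def cycle_graph_def complete_graph_def
  by (auto simp: lessThan_5 ix_UNIV wheel_vertex_def)

lemma parcs_wheel: "(wheel_vertex i, wheel_vertex j) \<in> parcs (wheel_graph 5) \<longleftrightarrow> adj i j"
  unfolding wheel_graph_def graph_join_def cycle_graph_def complete_graph_def
  by (cases i; cases j) (simp_all add: wheel_vertex_def)

lemma parcs_K3: "(i, j) \<in> parcs (complete_graph 3) \<longleftrightarrow> i < 3 \<and> j < 3 \<and> i \<noteq> j"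
  by (simp add: complete_graph_def)

abbreviation (input) W3K3 where
  "W3K3 \<equiv> wheel_graph 5 \<box> wheel_graph 5 \<box> wheel_graph 5 \<box> complete_graph 3"

text \<open>The value 3 lies outside the vertices of the triangle and makes the map
  injective.\<close>

definition colour_number :: "col \<Rightarrow> nat" where
  "colour_number a = (case a of D \<Rightarrow> 3 | R \<Rightarrow> 0 | G \<Rightarrow> 1 | B \<Rightarrow> 2)"

definition vertex :: "ix \<times> ix \<times> ix \<Rightarrow> nat \<Rightarrow> (((nat + nat) \<times> (nat + nat)) \<times> (nat + nat)) \<times> nat" where
  "vertex p k = (case p of (x, y, z) \<Rightarrow> (((wheel_vertex x, wheel_vertex y), wheel_vertex z), k))"

lemma colour_number_inj: "colour_number a = colour_number b \<longleftrightarrow> a = b"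
  by (cases a; cases b) (simp_all add: colour_number_def)

lemma colour_number_less: "a \<noteq> D \<Longrightarrow> colour_number a < 3"
  by (cases a) (simp_all add: colour_number_def)

lemma vertex_inj: "vertex p k = vertex q l \<longleftrightarrow> p = q \<and> k = l"
  using inj_vx by (cases p; cases q) (auto simp: vertex_def inj_def)

lemma pverts_W3K3: "v \<in> pverts W3K3 \<longleftrightarrow> (\<exists>p k. k < 3 \<and> v = vertex p k)"
  by (auto simp: cartesian_graph_product_def pverts_wheel complete_graph_def vertex_def)

lemma wheel_vertex_eq: "wheel_vertex i = wheel_vertex j \<longleftrightarrow> i = j"
  using inj_vx by (simp add: inj_eq)

lemma parcs_W3K3:
  assumes "k < 3" "l < 3"
  shows "(vertex (x, y, z) k, vertex (x', y', z') l) \<in> parcs W3K3 \<longleftrightarrow>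
    x = x' \<and> y = y' \<and> z = z' \<and> k \<noteq> l \<or>
    k = l \<and> (x = x' \<and> y = y' \<and> adj z z' \<or> x = x' \<and> z = z' \<and> adj y y' \<or> y = y' \<and> z = z' \<and> adj x x')"
  using assms by (auto simp: cartesian_graph_product_def pverts_wheel parcs_wheel parcs_K3 vertex_def wheel_vertex_eq complete_graph_def)

definition support :: "(ix \<Rightarrow> ix \<Rightarrow> ix \<Rightarrow> col) \<Rightarrow> (ix \<times> ix \<times> ix) set" where
  "support c = {(x, y, z). c x y z \<noteq> D}"

definition colour_set where
  "colour_set c = (\<lambda>(x, y, z). vertex (x, y, z) (colour_number (c x y z))) ` support c"

lemma card_UNIV_ix: "card (UNIV :: ix set) = 6"
  by (simp add: ix_UNIV)

lemma card_support: "card (support c) + total3 c = 216"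
proof -
  have "total3 c = (\<Sum>(x, y, z) \<in> UNIV. if c x y z = D then 1 else 0)"
    unfolding total3_sum by (simp add: sum.cartesian_product flip: UNIV_Times_UNIV)
  also have "\<dots> = (\<Sum>p \<in> UNIV. if p \<in> - support c then 1 else 0)"
    by (rule sum.cong) (auto simp: support_def)
  also have "\<dots> = card (- support c)"
    by (subst sum.If_cases) (auto simp: Compl_eq)
  finally have "total3 c = card (- support c)" .
  moreover have "card (support c) + card (- support c) = card (UNIV :: (ix \<times> ix \<times> ix) set)"
    by (subst card_Un_disjoint[symmetric]) (auto simp: Un_commute)
  moreover have "card (UNIV :: (ix \<times> ix \<times> ix) set) = 216"
    by (simp add: card_UNIV_ix card_cartesian_product flip: UNIV_Times_UNIV)
  ultimately show ?thesis by simp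
qed

lemma card_colour_set: "card (colour_set c) = card (support c)"
  unfolding colour_set_def by (rule card_image) (auto simp: inj_on_def vertex_inj)

lemma independent_colour_set:
  assumes "proper3 c"
  shows "independent_set W3K3 (colour_set c)"
  unfolding independent_set_def
proof (intro conjI ballI)
  show "colour_set c \<subseteq> pverts W3K3"
  proof
    fix v assume "v \<in> colour_set c"
    then obtain x y z where "v = vertex (x, y, z) (colour_number (c x y z))" "c x y z \<noteq> D"
      by (auto simp: colour_set_def support_def)
    then show "v \<in> pverts W3K3" unfolding pverts_W3K3 using colour_number_less by blast
  qed
  fix u v assume "u \<in> colour_set c" "v \<in> colour_set c"
  then obtain x y z x' y' z' where
    uv: "u = vertex (x, y, z) (colour_number (c x y z))" "v = vertex (x', y', z') (colour_number (c x' y' z'))"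
    and s: "c x y z \<noteq> D" "c x' y' z' \<noteq> D"
    by (auto simp: colour_set_def support_def)
  show "(u, v) \<notin> parcs W3K3"
    unfolding uv parcs_W3K3[OF colour_number_less[OF s(1)] colour_number_less[OF s(2)]] colour_number_inj
    using assms s unfolding proper3_def compat_iff by metis
qed

text \<open>The fibre over each vertex of the wheel power is a triangle, so \<open>S\<close> meets
  it at most once. The colours read off therefore recover \<open>S\<close>, and at least 46 of the
  216 vertices carry none.\<close>

lemma independent_set_bound:
  assumes "independent_set W3K3 S"
  shows "card S \<le> 170"
proof -
  define c where "c x y z = (if vertex (x, y, z) 0 \<in> S then R else if vertex (x, y, z) 1 \<in> S then G
    else if vertex (x, y, z) 2 \<in> S then B else D)" for x y z
  have S: "\<And>u v. u \<in> S \<Longrightarrow> v \<in> S \<Longrightarrow> (u, v) \<notin> parcs W3K3" "S \<subseteq> pverts W3K3"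
    using assms by (auto simp: independent_set_def)
  have in_S: "vertex (x, y, z) (colour_number (c x y z)) \<in> S" if "c x y z \<noteq> D" for x y z
    using that by (auto simp: c_def colour_number_def split: if_splits)
  have "proper3 c"
  proof -
    have "c x y z \<noteq> c x' y' z' \<or> c x y z = D"
      if "x = x' \<and> y = y' \<and> adj z z' \<or> x = x' \<and> z = z' \<and> adj y y' \<or> y = y' \<and> z = z' \<and> adj x x'"
      for x y z x' y' z'
    proof (rule ccontr)
      assume "\<not> ?thesis"
      then have e: "c x y z = c x' y' z'" "c x y z \<noteq> D" "c x' y' z' \<noteq> D" by auto
      from S(1)[OF in_S[OF e(2)] in_S[OF e(3)]] show False
        using parcs_W3K3[OF colour_number_less[OF e(2)] colour_number_less[OF e(3)]] that e(1) by simp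
    qed
    then show ?thesis unfolding proper3_def compat_iff by blast
  qed
  have "S \<subseteq> colour_set c"
  proof
    fix v assume v: "v \<in> S"
    then have "v \<in> pverts W3K3" using S(2) by blast
    then obtain p k where p: "v = vertex p k" and "k < 3"
      unfolding pverts_W3K3 by blast
    moreover obtain x y z where "p = (x, y, z)" by (cases p)
    ultimately have k: "v = vertex (x, y, z) k" "k < 3" by simp_all
    have "k = 0 \<or> k = 1 \<or> k = 2" using k(2) by linarith
    then have nD: "c x y z \<noteq> D" using v k(1) by (auto simp: c_def)
    have "k = colour_number (c x y z)"
    proof (rule ccontr)
      assume "k \<noteq> colour_number (c x y z)"
      then have "(v, vertex (x, y, z) (colour_number (c x y z))) \<in> parcs W3K3"
        unfolding k(1) parcs_W3K3[OF k(2) colour_number_less[OF nD]] by simp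
      then show False using S(1)[OF v in_S[OF nD]] by simp
    qed
    then show "v \<in> colour_set c"
      using nD k(1) by (force simp: colour_set_def support_def)
  qed
  then have "card S \<le> card (colour_set c)"
    by (rule card_mono[rotated]) (simp add: colour_set_def)
  then show ?thesis
    using card_colour_set[of c] card_support[of c] total3_ge46[OF \<open>proper3 c\<close>] by simp
qed

definition solution :: "ix \<Rightarrow> ix \<Rightarrow> ix \<Rightarrow> col" where
  "solution x y z = sel z (sel y (sel x sol))"

text \<open>Quantifier and sum over \<open>ix\<close> in a form that unfolds under
  evaluation.\<close>

definition all6 :: "(ix \<Rightarrow> bool) \<Rightarrow> bool" where
  "all6 P \<longleftrightarrow> P I5 \<and> P I4 \<and> P I3 \<and> P I2 \<and> P I1 \<and> P I0"

definition sum6 :: "(ix \<Rightarrow> nat) \<Rightarrow> nat" where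
  "sum6 g = g I0 + g I1 + g I2 + g I3 + g I4 + g I5"

lemma all6_iff: "all6 P \<longleftrightarrow> (\<forall>i. P i)"
  by (simp add: all6_def all_ix)

lemma proper3_solution: "proper3 solution"
proof -
  have "all6 (\<lambda>x. all6 (\<lambda>x'. adj x x' \<longrightarrow> all6 (\<lambda>y. all6 (\<lambda>z.
     compat (solution x y z) (solution x' y z) \<and> compat (solution y x z) (solution y x' z) \<and>
     compat (solution y z x) (solution y z x')))))"
    by code_simp
  then show ?thesis unfolding proper3_def all6_iff by blast
qed

lemma total3_solution: "total3 solution = 46"
proof -
  have "sum6 (\<lambda>x. sum6 (\<lambda>y. dels [solution x y I5, solution x y I4, solution x y I3,
      solution x y I2, solution x y I1, solution x y I0])) = 46"
    by code_simp
  then show ?thesis unfolding total3_def total2_def sum6_def sum_ix word_def .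
qed

theorem theorem1p6:
  shows "independence_number
    (wheel_graph 5 \<box> wheel_graph 5 \<box> wheel_graph 5 \<box> complete_graph 3) = 170"
  unfolding independence_number_def
proof (rule Max_eqI)
  show "finite (card ` {S. independent_set W3K3 S})"
    by (rule finite_subset[of _ "{..170}"]) (auto dest: independent_set_bound)
  show "n \<le> 170" if "n \<in> card ` {S. independent_set W3K3 S}" for n
    using that independent_set_bound by auto
  \<comment> \<open>This is 216 - 46.\<close>
  have "card (colour_set solution) = 170"
    using card_colour_set[of solution] card_support[of solution] by (simp add: total3_solution)
  then show "170 \<in> card ` {S. independent_set W3K3 S}"
    using independent_colour_set[OF proper3_solution] by force
qed

end
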